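(* Let $\lambda$ be a strict partition. Then \[ gp_{\lambda} = \sum_{T\in \mathsf{ShPP}_P(\lambda)} (-\beta)^{|\lambda| - |\operatorname{wt}_{\mathrm{PP}}(T)|}\, {\bf x}^{\operatorname{wt}_{\mathrm{PP}}(T)} \quad\text{and}\quad gq_{\lambda} = \sum_{T\in \mathsf{ShPP}_Q(\lambda)} (-\beta)^{|\lambda| - |\operatorname{wt}_{\mathrm{PP}}(T)|}\, {\bf x}^{\operatorname{wt}_{\mathrm{PP}}(T)}. \]
   Context: A strict partition is $\lambda=(\lambda_1>\lambda_2>\dots>\lambda_k>0)$, with $|\lambda|=\sum_i\lambda_i$. Its shifted diagram is $\mathsf{SD}_\lambda=\{(i,i+j-1): 1\le i\le k,\ 1\le j\le \lambda_i\}$; boxes $(i,i)$ are diagonal boxes. For $i\in\mathbb{Z}$ write $i':=i-\tfrac12$ ("primed numbers"), with total order $1'<1<2'<2<\dots$. Let $\beta,x_1,x_2,\dots$ be commuting indeterminates. A semistandard shifted set-valued tableau of shape $\lambda$ is a filling $T$ of each box $(i,j)\in\mathsf{SD}_\lambda$ by a nonempty finite subset $T_{ij}$ of $\{1'<1<2'<2<\dots\}$ such that $\max T_{ij}\le \min T_{i+1,j}$ and $\max T_{ij}\le\min T_{i,j+1}$ whenever both boxes lie in the shape, no unprimed number occurs in two different boxes of the same column, and no primed number occurs in two different boxes of the same row. Set $|T|=\sum|T_{ij}|$ and ${\bf x}^T=\prod_i x_i^{a_i+b_i}$ where $a_i,b_i$ are the numbers of occurrences of $i$ and $i'$. Let $\mathsf{ShSVT}_Q(\lambda)$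 be the set of all such tableaux and $\mathsf{ShSVT}_P(\lambda)$ the subset with no primed numbers in diagonal boxes; define $GP_\lambda=\sum_{T\in\mathsf{ShSVT}_P(\lambda)}\beta^{|\lambda|-|T|}{\bf x}^T$ and $GQ_\lambda=\sum_{T\in\mathsf{ShSVT}_Q(\lambda)}\beta^{|\lambda|-|T|}{\bf x}^T$. The dual functions $gp_\lambda, gq_\lambda\in\mathbb{Z}[\beta]\llbracket x_1,x_2,\dots\rrbracket$ (indexed by strict partitions) are the unique power series satisfying $\sum_\lambda GQ_\lambda({\bf x})gp_\lambda({\bf y})=\sum_\lambda GP_\lambda({\bf x})gq_\lambda({\bf y})=\prod_{i,j\ge1}\frac{1-\overline{x_i}y_j}{1-x_iy_j}$, where $\overline{x}:=\frac{-x}{1+\beta x}$ and ${\bf y}=(y_1,y_2,\dots)$ are further indeterminates. A shifted plane partition of shape $\lambda$ is a filling of $\mathsf{SD}_\lambda$ by elements of $\{1'<1<2'<2<\dots\}$ with weakly increasing rows and columns. For such $T$, let $c_i$ be the number of distinct columns of $T$ containing $i$ and $r_i$ the number of distinct rows containing $i'$; set $|\operatorname{wt}_{\mathrm{PP}}(T)|=\sum_i(c_i+r_i)$ and ${\bf x}^{\operatorname{wt}_{\mathrm{PP}}(T)}=\prod_i x_i^{c_i+r_i}$. Let $\mathsf{ShPP}_Q(\lambda)$ be the set of all shifted plane partitions of shape $\lambda$ and $\mathsf{ShPP}_P(\lambda)$ the subset with no unprimed entries in diagonal boxes.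
   Formalization: In the definitions of GP_λ and GQ_λ the exponent of β is taken to be |T|−|λ| instead of the printed |λ|−|T|; with the printed sign no gp_λ over Z[β] satisfies the Cauchy identity (gp_(2) would need the coefficient −(β+1/β)/2). *)

theory Defs
  imports
    "HOL-Analysis.Infinite_Sum"
    "HOL-Library.Poly_Mapping"
    "HOL-Computational_Algebra.Polynomial"
begin

section \<open>Formal power series in arbitrarily many commuting variables\<close>

typedef ('v, 'a) mps = "UNIV :: (('v \<Rightarrow>\<^sub>0 nat) \<Rightarrow> 'a) set"
  morphisms mps_coeff Abs_mps ..

lemma mps_coeff_Abs [simp]: "mps_coeff (Abs_mps f) = f"
  by (simp add: Abs_mps_inverse)

lemma mps_eq_iff: "f = g \<longleftrightarrow> (\<forall>m. mps_coeff f m = mps_coeff g m)"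
  by (metis ext mps_coeff_inject)

lemma mps_eqI: "(\<And>m. mps_coeff f m = mps_coeff g m) \<Longrightarrow> f = g"
  by (simp add: mps_eq_iff)

lemma finite_exponent_divisors:
  fixes m :: "'v \<Rightarrow>\<^sub>0 nat"
  shows "finite {a. \<exists>b. a + b = m}"
proof -
  let ?F = "{f. \<forall>v. (v \<in> Poly_Mapping.keys m \<longrightarrow> f v \<in> {..Max (Poly_Mapping.lookup m ` Poly_Mapping.keys m)}) \<and> (v \<notin> Poly_Mapping.keys m \<longrightarrow> f v = (0::nat))}"
  have "finite ?F"
    by (rule finite_set_of_finite_funs) auto
  moreover have "Poly_Mapping.lookup ` {a. \<exists>b. a + b = m} \<subseteq> ?F"
  proof clarsimp
    fix a b :: "'v \<Rightarrow>\<^sub>0 nat" and v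
    show "(v \<in> Poly_Mapping.keys (a + b) \<longrightarrow> Poly_Mapping.lookup a v \<le> Max (Poly_Mapping.lookup (a + b) ` Poly_Mapping.keys (a + b))) \<and>
          (v \<notin> Poly_Mapping.keys (a + b) \<longrightarrow> Poly_Mapping.lookup a v = 0)"
    proof (intro conjI impI)
      assume "v \<in> Poly_Mapping.keys (a + b)"
      then have "Poly_Mapping.lookup (a + b) v \<le> Max (Poly_Mapping.lookup (a + b) ` Poly_Mapping.keys (a + b))"
        by (intro Max_ge) auto
      then show "Poly_Mapping.lookup a v \<le> Max (Poly_Mapping.lookup (a + b) ` Poly_Mapping.keys (a + b))"
        by (simp add: lookup_add)
    next
      assume "v \<notin> Poly_Mapping.keys (a + b)"
      then show "Poly_Mapping.lookup a v = 0"
        by (simp add: in_keys_iff lookup_add)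
    qed
  qed
  ultimately have "finite (Poly_Mapping.lookup ` {a. \<exists>b. a + b = m})"
    by (rule finite_subset[rotated])
  then show ?thesis
    by (rule finite_imageD) (auto intro: inj_onI poly_mapping_eqI)
qed

lemma finite_exponent_pairs [simp]:
  fixes m :: "'v \<Rightarrow>\<^sub>0 nat"
  shows "finite {(a, b). a + b = m}"
proof (rule finite_subset)
  show "{(a, b). a + b = m} \<subseteq> {a. \<exists>b. a + b = m} \<times> {b. \<exists>a. b + a = m}"
    by (clarsimp, metis add.commute)
  show "finite ({a. \<exists>b. a + b = m} \<times> {b. \<exists>a. b + a = m})"
    using finite_exponent_divisors[of m] by simp
qed

instantiation mps :: (type, comm_ring_1) comm_ring_1
begin

definition zero_mps :: "('a, 'b) mps" where
  "zero_mps = Abs_mps (\<lambda>_. 0)"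

definition one_mps :: "('a, 'b) mps" where
  "one_mps = Abs_mps (\<lambda>m. if m = 0 then 1 else 0)"

definition plus_mps :: "('a, 'b) mps \<Rightarrow> ('a, 'b) mps \<Rightarrow> ('a, 'b) mps" where
  "plus_mps f g = Abs_mps (\<lambda>m. mps_coeff f m + mps_coeff g m)"

definition minus_mps :: "('a, 'b) mps \<Rightarrow> ('a, 'b) mps \<Rightarrow> ('a, 'b) mps" where
  "minus_mps f g = Abs_mps (\<lambda>m. mps_coeff f m - mps_coeff g m)"

definition uminus_mps :: "('a, 'b) mps \<Rightarrow> ('a, 'b) mps" where
  "uminus_mps f = Abs_mps (\<lambda>m. - mps_coeff f m)"

definition times_mps :: "('a, 'b) mps \<Rightarrow> ('a, 'b) mps \<Rightarrow> ('a, 'b) mps" where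
  "times_mps f g = Abs_mps (\<lambda>m. \<Sum>(a, b)\<in>{(a, b). a + b = m}. mps_coeff f a * mps_coeff g b)"

instance
proof
  fix f g h :: "('a, 'b) mps"
  show "f + g + h = f + (g + h)" "f + g = g + f" "0 + f = f" "- f + f = 0" "f - g = f + - g"
    by (simp_all add: mps_eq_iff plus_mps_def zero_mps_def uminus_mps_def minus_mps_def algebra_simps)
  show "(0::('a, 'b) mps) \<noteq> 1"
    by (auto simp: mps_eq_iff zero_mps_def one_mps_def)
  show "f * g = g * f"
  proof (rule mps_eqI)
    fix m
    show "mps_coeff (f * g) m = mps_coeff (g * f) m"
      unfolding times_mps_def mps_coeff_Abs
      by (rule sum.reindex_bij_witness[where i = prod.swap and j = prod.swap])
         (auto simp: add.commute mult.commute)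
  qed
  show "(f + g) * h = f * h + g * h"
    by (simp add: mps_eq_iff times_mps_def plus_mps_def case_prod_unfold distrib_right sum.distrib)
  show "1 * f = f"
  proof (rule mps_eqI)
    fix m
    have "mps_coeff (1 * f) m = (\<Sum>(a, b)\<in>{(0, m)}. mps_coeff 1 a * mps_coeff f b)"
      unfolding times_mps_def mps_coeff_Abs
      by (rule sum.mono_neutral_right) (auto simp: one_mps_def split: if_splits)
    then show "mps_coeff (1 * f) m = mps_coeff f m"
      by (simp add: one_mps_def)
  qed
  show "f * g * h = f * (g * h)"
  proof (rule mps_eqI)
    fix m :: "'a \<Rightarrow>\<^sub>0 nat"
    let ?P = "\<lambda>m :: 'a \<Rightarrow>\<^sub>0 nat. {(a, b). a + b = m}"
    have "mps_coeff (f * g * h) m =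
        (\<Sum>p\<in>?P m. \<Sum>q\<in>?P (fst p). mps_coeff f (fst q) * mps_coeff g (snd q) * mps_coeff h (snd p))"
      by (simp add: times_mps_def case_prod_unfold sum_distrib_right)
    also have "\<dots> = (\<Sum>(p, q)\<in>Sigma (?P m) (\<lambda>p. ?P (fst p)).
        mps_coeff f (fst q) * mps_coeff g (snd q) * mps_coeff h (snd p))"
      by (rule sum.Sigma) auto
    also have "\<dots> = (\<Sum>(p, q)\<in>Sigma (?P m) (\<lambda>p. ?P (snd p)).
        mps_coeff f (fst p) * (mps_coeff g (fst q) * mps_coeff h (snd q)))"
      by (rule sum.reindex_bij_witness[where
            i = "\<lambda>(p, q). ((fst p + fst q, snd q), (fst p, fst q))" and
            j = "\<lambda>(p, q). ((fst q, snd q + snd p), (snd q, snd p))"])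
         (auto simp: add.assoc mult.assoc)
    also have "\<dots> = (\<Sum>p\<in>?P m. \<Sum>q\<in>?P (snd p).
        mps_coeff f (fst p) * (mps_coeff g (fst q) * mps_coeff h (snd q)))"
      by (rule sum.Sigma[symmetric]) auto
    also have "\<dots> = mps_coeff (f * (g * h)) m"
      by (simp add: times_mps_def case_prod_unfold sum_distrib_left)
    finally show "mps_coeff (f * g * h) m = mps_coeff (f * (g * h)) m" .
  qed
qed

end

instantiation mps :: (type, comm_ring_1) inverse
begin

definition inverse_mps :: "('a, 'b) mps \<Rightarrow> ('a, 'b) mps" where
  "inverse_mps f = (if f dvd 1 then THE g. f * g = 1 else 0)"

definition divide_mps :: "('a, 'b) mps \<Rightarrow> ('a, 'b) mps \<Rightarrow> ('a, 'b) mps" where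
  "divide_mps f g = f * inverse g"

instance ..

end

text \<open>The product topology with discrete coefficients: a net of series converges iff each of its
  coefficients is eventually constant. Infinite sums and products below refer to this topology.\<close>

instantiation mps :: (type, type) t2_space
begin

definition open_mps :: "('a, 'b) mps set \<Rightarrow> bool" where
  "open_mps U \<longleftrightarrow>
     (\<forall>f\<in>U. \<exists>M. finite M \<and> (\<forall>g. (\<forall>m\<in>M. mps_coeff g m = mps_coeff f m) \<longrightarrow> g \<in> U))"

instance
proof
  let ?near = "\<lambda>M (f :: ('a, 'b) mps) U. \<forall>g. (\<forall>m\<in>M. mps_coeff g m = mps_coeff f m) \<longrightarrow> g \<in> U"
  have openD: "\<exists>M. finite M \<and> ?near M f U" if "open U" "f \<in> U" for U f
    using bspec[OF that(1)[unfolded open_mps_def] that(2)] .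
  have openI: "open U" if "\<And>f. f \<in> U \<Longrightarrow> \<exists>M. finite M \<and> ?near M f U" for U
    unfolding open_mps_def by (rule ballI) (rule that)
  show "open (UNIV :: ('a, 'b) mps set)"
    by (rule openI) (rule exI[of _ "{}"], simp)
  show "open (S \<inter> T)" if S: "open S" and T: "open T" for S T :: "('a, 'b) mps set"
  proof (rule openI)
    fix f assume f: "f \<in> S \<inter> T"
    obtain M where M: "finite M" "?near M f S"
      using openD[OF S IntD1[OF f]] by (elim exE conjE)
    obtain N where N: "finite N" "?near N f T"
      using openD[OF T IntD2[OF f]] by (elim exE conjE)
    show "\<exists>M. finite M \<and> ?near M f (S \<inter> T)"
      by (rule exI[of _ "M \<union> N"]) (use M N in simp)
  qed
  show "open (\<Union>K)" if K: "\<forall>S\<in>K. open S" for K :: "('a, 'b) mps set set"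
  proof (rule openI)
    fix f assume "f \<in> \<Union>K"
    then obtain S where S: "S \<in> K" "f \<in> S" by (rule UnionE)
    obtain M where M: "finite M" "?near M f S"
      using openD[OF bspec[OF K S(1)] S(2)] by (elim exE conjE)
    show "\<exists>M. finite M \<and> ?near M f (\<Union>K)"
      by (rule exI[of _ M]) (use M S(1) in auto)
  qed
  show "\<exists>U V. open U \<and> open V \<and> f \<in> U \<and> g \<in> V \<and> U \<inter> V = {}"
    if fg: "f \<noteq> g" for f g :: "('a, 'b) mps"
  proof -
    obtain m where m: "mps_coeff f m \<noteq> mps_coeff g m"
      using fg by (auto simp: mps_eq_iff)
    have op: "open {h :: ('a, 'b) mps. mps_coeff h m = c}" for c
      by (rule openI, rule exI[of _ "{m}"]) simp
    show ?thesis
      by (rule exI[of _ "{h. mps_coeff h m = mps_coeff f m}"],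
          rule exI[of _ "{h. mps_coeff h m = mps_coeff g m}"]) (use op m in simp, auto)
  qed
qed

end

definition mps_const :: "'a \<Rightarrow> ('v, 'a::comm_ring_1) mps" where
  "mps_const c = Abs_mps (\<lambda>m. if m = 0 then c else 0)"

definition mps_var :: "'v \<Rightarrow> ('v, 'a::comm_ring_1) mps" where
  "mps_var v = Abs_mps (\<lambda>m. if m = Poly_Mapping.single v 1 then 1 else 0)"

text \<open>Substitution of the variable \<open>h v\<close> for each variable \<open>v\<close>, for an injective \<open>h\<close>.\<close>

definition mps_rename :: "('v \<Rightarrow> 'w) \<Rightarrow> ('v, 'a::comm_ring_1) mps \<Rightarrow> ('w, 'a) mps" where
  "mps_rename h f =
     Abs_mps (\<lambda>m. if Poly_Mapping.keys m \<subseteq> range h then mps_coeff f (Poly_Mapping.map_key h m) else 0)"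

definition mps_infprod :: "('i \<Rightarrow> ('v, 'a::comm_ring_1) mps) \<Rightarrow> 'i set \<Rightarrow> ('v, 'a) mps" where
  "mps_infprod f A = Lim (finite_subsets_at_top A) (prod f)"

text \<open>The coefficient ring \<open>\<int>[\<beta>]\<close> is \<^typ>\<open>int poly\<close>.\<close>

definition \<beta> :: "('v, int poly) mps" where
  "\<beta> = mps_const [:0, 1:]"

text \<open>Power series in \<open>x\<^sub>1, x\<^sub>2, \<dots>\<close> over \<open>\<int>[\<beta>]\<close>; the variable with index \<open>k\<close> stands for \<open>x\<^sub>k\<^sub>+\<^sub>1\<close>.\<close>

type_synonym xseries = "(nat, int poly) mps"


section \<open>Shifted tableaux\<close>

typedef strict_partition = "{l :: nat list. sorted_wrt (>) l \<and> 0 \<notin> set l}"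
  morphisms parts Abs_strict_partition
  by (rule exI[of _ "[]"]) simp

definition psize :: "strict_partition \<Rightarrow> nat" where
  "psize lam = sum_list (parts lam)"

definition shifted_diagram :: "strict_partition \<Rightarrow> (nat \<times> nat) set" where
  "shifted_diagram lam =
     {(i, i + j - 1) | i j. 1 \<le> i \<and> i \<le> length (parts lam) \<and> 1 \<le> j \<and> j \<le> parts lam ! (i - 1)}"

definition unprimed :: "nat \<Rightarrow> rat" where
  "unprimed i = of_nat i"

definition primed :: "nat \<Rightarrow> rat" where
  "primed i = of_nat i - 1/2"

definition letters :: "rat set" where
  "letters = unprimed ` {1..} \<union> primed ` {1..}"

text \<open>Tableaux are functions on all of \<open>\<nat> \<times> \<nat>\<close>, with the fixed value \<open>{}\<close> outside of the shape so that
  every filling of the shape is represented exactly once.\<close>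

definition ShSVT_Q :: "strict_partition \<Rightarrow> (nat \<times> nat \<Rightarrow> rat set) set" where
  "ShSVT_Q lam = {T.
     (\<forall>b\<in>shifted_diagram lam. T b \<noteq> {} \<and> finite (T b) \<and> T b \<subseteq> letters) \<and>
     (\<forall>b. b \<notin> shifted_diagram lam \<longrightarrow> T b = {}) \<and>
     (\<forall>i j. (i, j) \<in> shifted_diagram lam \<longrightarrow> (i + 1, j) \<in> shifted_diagram lam \<longrightarrow>
        Max (T (i, j)) \<le> Min (T (i + 1, j))) \<and>
     (\<forall>i j. (i, j) \<in> shifted_diagram lam \<longrightarrow> (i, j + 1) \<in> shifted_diagram lam \<longrightarrow>
        Max (T (i, j)) \<le> Min (T (i, j + 1))) \<and>
     (\<forall>k\<ge>1. \<forall>i i' j. unprimed k \<in> T (i, j) \<longrightarrow> unprimed k \<in> T (i', j) \<longrightarrow> i = i') \<and>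
     (\<forall>k\<ge>1. \<forall>i j j'. primed k \<in> T (i, j) \<longrightarrow> primed k \<in> T (i, j') \<longrightarrow> j = j')}"

definition ShSVT_P :: "strict_partition \<Rightarrow> (nat \<times> nat \<Rightarrow> rat set) set" where
  "ShSVT_P lam = {T \<in> ShSVT_Q lam. \<forall>i. \<forall>k\<ge>1. (i, i) \<in> shifted_diagram lam \<longrightarrow> primed k \<notin> T (i, i)}"

definition svt_size :: "strict_partition \<Rightarrow> (nat \<times> nat \<Rightarrow> rat set) \<Rightarrow> nat" where
  "svt_size lam T = (\<Sum>b\<in>shifted_diagram lam. card (T b))"

definition svt_occ :: "strict_partition \<Rightarrow> (nat \<times> nat \<Rightarrow> rat set) \<Rightarrow> rat \<Rightarrow> nat" where
  "svt_occ lam T a = card {b \<in> shifted_diagram lam. a \<in> T b}"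

definition svt_monomial :: "strict_partition \<Rightarrow> (nat \<times> nat \<Rightarrow> rat set) \<Rightarrow> xseries" where
  "svt_monomial lam T =
     Prod_any (\<lambda>k. mps_var k ^ (svt_occ lam T (unprimed (Suc k)) + svt_occ lam T (primed (Suc k))))"

text \<open>The exponent of \<open>\<beta>\<close> is the excess \<open>|T| - |lam| \<ge> 0\<close>, so the series have coefficients in \<open>\<int>[\<beta>]\<close>.\<close>

definition GP :: "strict_partition \<Rightarrow> xseries" where
  "GP lam = (\<Sum>\<^sub>\<infinity>T\<in>ShSVT_P lam. \<beta> ^ (svt_size lam T - psize lam) * svt_monomial lam T)"

definition GQ :: "strict_partition \<Rightarrow> xseries" where
  "GQ lam = (\<Sum>\<^sub>\<infinity>T\<in>ShSVT_Q lam. \<beta> ^ (svt_size lam T - psize lam) * svt_monomial lam T)"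


section \<open>The dual functions\<close>

text \<open>Power series in two sets of variables: \<^term>\<open>Inl k\<close> stands for \<open>x\<^sub>k\<^sub>+\<^sub>1\<close> and \<^term>\<open>Inr k\<close> for
  \<open>y\<^sub>k\<^sub>+\<^sub>1\<close>.\<close>

type_synonym xyseries = "(nat + nat, int poly) mps"

definition in_x :: "xseries \<Rightarrow> xyseries" where
  "in_x = mps_rename Inl"

definition in_y :: "xseries \<Rightarrow> xyseries" where
  "in_y = mps_rename Inr"

definition conj_var :: "('v, int poly) mps \<Rightarrow> ('v, int poly) mps" where
  "conj_var x = - x / (1 + \<beta> * x)"

definition cauchy_kernel :: xyseries where
  "cauchy_kernel = mps_infprod
     (\<lambda>(i, j). (1 - conj_var (mps_var (Inl i)) * mps_var (Inr j)) / (1 - mps_var (Inl i) * mps_var (Inr j)))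
     UNIV"

definition gp :: "strict_partition \<Rightarrow> xseries" where
  "gp = (THE g. (\<Sum>\<^sub>\<infinity>lam\<in>UNIV. in_x (GQ lam) * in_y (g lam)) = cauchy_kernel)"

definition gq :: "strict_partition \<Rightarrow> xseries" where
  "gq = (THE g. (\<Sum>\<^sub>\<infinity>lam\<in>UNIV. in_x (GP lam) * in_y (g lam)) = cauchy_kernel)"


section \<open>Shifted plane partitions\<close>

definition ShPP_Q :: "strict_partition \<Rightarrow> (nat \<times> nat \<Rightarrow> rat) set" where
  "ShPP_Q lam = {T \<in> shifted_diagram lam \<rightarrow>\<^sub>E letters.
     (\<forall>i j. (i, j) \<in> shifted_diagram lam \<longrightarrow> (i + 1, j) \<in> shifted_diagram lam \<longrightarrow> T (i, j) \<le> T (i + 1, j)) \<and>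
     (\<forall>i j. (i, j) \<in> shifted_diagram lam \<longrightarrow> (i, j + 1) \<in> shifted_diagram lam \<longrightarrow> T (i, j) \<le> T (i, j + 1))}"

definition ShPP_P :: "strict_partition \<Rightarrow> (nat \<times> nat \<Rightarrow> rat) set" where
  "ShPP_P lam = {T \<in> ShPP_Q lam. \<forall>i. \<forall>k\<ge>1. (i, i) \<in> shifted_diagram lam \<longrightarrow> T (i, i) \<noteq> unprimed k}"

definition pp_cols :: "strict_partition \<Rightarrow> (nat \<times> nat \<Rightarrow> rat) \<Rightarrow> nat \<Rightarrow> nat" where
  "pp_cols lam T k = card {j. \<exists>i. (i, j) \<in> shifted_diagram lam \<and> T (i, j) = unprimed k}"

definition pp_rows :: "strict_partition \<Rightarrow> (nat \<times> nat \<Rightarrow> rat) \<Rightarrow> nat \<Rightarrow> nat" where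
  "pp_rows lam T k = card {i. \<exists>j. (i, j) \<in> shifted_diagram lam \<and> T (i, j) = primed k}"

definition pp_wt_size :: "strict_partition \<Rightarrow> (nat \<times> nat \<Rightarrow> rat) \<Rightarrow> nat" where
  "pp_wt_size lam T = Sum_any (\<lambda>k. pp_cols lam T (Suc k) + pp_rows lam T (Suc k))"

definition pp_monomial :: "strict_partition \<Rightarrow> (nat \<times> nat \<Rightarrow> rat) \<Rightarrow> xseries" where
  "pp_monomial lam T = Prod_any (\<lambda>k. mps_var k ^ (pp_cols lam T (Suc k) + pp_rows lam T (Suc k)))"

end

theory Submission
  imports Defs
begin

text \<open>
  A strict partition is read as a particle configuration on the sites \<open>1, 2, \<dots>\<close>: a part \<open>p\<close> is a
  particle at site \<open>p\<close>, and adding a box of content \<open>c\<close> moves a particle from \<open>c\<close> to \<open>c + 1\<close> (for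
  \<open>c = 0\<close> it creates one). Removing the largest letter of a tableau turns \<open>GP\<close>, \<open>GQ\<close> and the plane
  partition sums into matrix coefficients of products of one-variable operators: \<open>U(x)\<close> adds a vertical
  and then a horizontal strip, \<open>D(y)\<close> removes a skew shape weighted by columns and then one weighted by
  rows. The theorem amounts to \<open>D(y) U(x) = K(x, y) U(x) D(y)\<close> with
  \<open>K(x, y) = (1 + \<beta>x + xy) / ((1 + \<beta>x)(1 - xy))\<close>, applied to the empty partition.

  Let \<open>Z\<close> remove an arbitrary skew shape with weight \<open>-\<beta>\<close> per box. By Moebius inversion \<open>Z\<^sup>-\<^sup>1\<close> removes
  sets of corners, and the row and column operators factor as \<open>R = Z V\<close> and \<open>C = W Z\<close>, where \<open>V\<close> and
  \<open>W\<close> remove vertical and horizontal strips; hence \<open>D = Z V W Z\<close>. All of \<open>U\<close>, \<open>V W\<close>, \<open>Z\<^sup>-\<^sup>1\<close> are transfer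
  matrices along the sites with at most three states, so their commutation relations (with a change of
  the boundary weight at site \<open>1\<close> in the case of \<open>GQ\<close>) follow by induction on the number of sites
  from finitely many linear relations between partial transfer sums. A particle that leaves the first
  \<open>N\<close> sites contributes only terms of degree above \<open>N\<close> in \<open>x\<close>, so it suffices to treat finitely many sites.

  The dual functions are unique because the leading terms of \<open>GP\<close> and \<open>GQ\<close> are triangular in
  dominance order.
\<close>

section \<open>Transfer matrices on bit lists\<close>

text \<open>\<open>Z\<close> itself is not a finite transfer matrix, since any number of particles
  may cross a cut downwards. This is why only its inverse and \<open>V W\<close> are commuted with
  \<open>U(x)\<close>; \<open>Z\<close> comes back when the resulting equations between vectors are
  multiplied by it. Moving \<open>U(x)\<close> past one \<open>Z\<close> costs
  \<open>1 / (1 + \<beta> x)\<close>, moving it past \<open>V W\<close> costs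
  \<open>(1 + \<beta> x)(1 + \<beta> x + x y) / (1 - x y)\<close>, and the three factors multiply to
  \<open>K(x, y)\<close>. The plane partitions dual to \<open>GQ\<close> have no unprimed entries on
  the diagonal. This restricts the column operator only, hence the first \<open>Z\<close> and
  \<open>W\<close> (parameter \<open>e = 0\<close>) but not the second \<open>Z\<close> (parameter
  \<open>1\<close>). The two \<open>Z\<close> therefore act differently at site \<open>1\<close>:
  the first turns the boundary weight \<open>KQ\<close> into \<open>KM\<close>, the second turns it
  back. In the code operators act on row vectors, so products are read from left to right:
  \<open>drem\<close> is \<open>zrem\<close>, \<open>hrem\<close>, \<open>vrem\<close>,
  \<open>zrem\<close>.\<close>

definition bit_lists :: "nat \<Rightarrow> bool list set" where
  "bit_lists n = {ls. length ls = n}"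

lemma bit_lists_0 [simp]: "bit_lists 0 = {[]}"
  by (auto simp: bit_lists_def)

lemma bit_lists_Suc: "bit_lists (Suc n) = Cons False ` bit_lists n \<union> Cons True ` bit_lists n"
  by (auto simp: bit_lists_def image_iff length_Suc_conv)

lemma finite_bit_lists [simp]: "finite (bit_lists n)"
  by (induction n) (auto simp: bit_lists_Suc)

lemma sum_bit_lists_Suc:
  "(\<Sum>ls\<in>bit_lists (Suc n). f ls) = (\<Sum>ls\<in>bit_lists n. f (False # ls)) + (\<Sum>ls\<in>bit_lists n. f (True # ls))"
  unfolding bit_lists_Suc by (subst sum.union_disjoint) (auto simp: sum.reindex inj_on_def)

text \<open>A configuration on the sites \<open>n, \<dots>, 1\<close> is a bit list with the highest site first. The state of
  \<open>uadd\<close> describes the cut above the head: \<open>UB\<close> if a particle crosses it upwards, \<open>UC\<close> if the site above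
  holds a particle that does not move (which is a corner if the head is empty), \<open>UA\<close> otherwise. The weights
  at the cut below site \<open>1\<close> are given by \<open>K\<close>. In \<open>vrem\<close> and \<open>hrem\<close> the flag tells whether a particle crosses
  the cut downwards, and \<open>e\<close> is the weight of a particle leaving below site \<open>1\<close>, so that \<open>e = 0\<close> forbids the
  removal of diagonal boxes. In \<open>vhrem\<close> the crossing particle is moved by \<open>vrem\<close> in state \<open>RQ\<close> and by
  \<open>hrem\<close> in state \<open>RR\<close>; a double crossing is never reached from \<open>RP\<close>.\<close>

datatype ustate = UA | UB | UC
datatype rstate = RP | RQ | RR

fun uadd :: "'a::comm_ring_1 \<Rightarrow> 'a \<Rightarrow> (ustate \<Rightarrow> 'a) \<Rightarrow> ustate \<Rightarrow> bool list \<Rightarrow> bool list \<Rightarrow> 'a" where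
  "uadd b x K s [] [] = K s"
| "uadd b x K s (m # ms) (l # ls) =
    (case s of
      UA \<Rightarrow> if m then (if l then uadd b x K UC ms ls else 0)
            else uadd b x K (if l then UB else UA) ms ls
    | UB \<Rightarrow> if m then (if l then x * uadd b x K UB ms ls
                        else x * uadd b x K UC ms ls + x * (1 + b * x) * uadd b x K UA ms ls)
            else (if l then 0 else x * uadd b x K UB ms ls)
    | UC \<Rightarrow> if m then (if l then uadd b x K UC ms ls else 0)
            else (if l then (1 + b * x) * uadd b x K UB ms ls
                  else (1 + b * x)\<^sup>2 * uadd b x K UA ms ls))"
| "uadd b x K s _ _ = 0"

fun vrem :: "'a::comm_ring_1 \<Rightarrow> 'a \<Rightarrow> 'a \<Rightarrow> bool \<Rightarrow> bool list \<Rightarrow> bool list \<Rightarrow> 'a" where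
  "vrem y z e c [] [] = (if c then e else 1)"
| "vrem y z e c (l # ls) (n # ns) =
    (if c then (if n then (if l then y * vrem y z e True ls ns else vrem y z e False ls ns) else 0)
     else if l then (if n then vrem y z e False ls ns else z * vrem y z e True ls ns)
     else (if n then 0 else vrem y z e False ls ns))"
| "vrem y z e c _ _ = 0"

fun hrem :: "'a::comm_ring_1 \<Rightarrow> 'a \<Rightarrow> 'a \<Rightarrow> bool \<Rightarrow> bool list \<Rightarrow> bool list \<Rightarrow> 'a" where
  "hrem y z e c [] [] = (if c then e else 1)"
| "hrem y z e c (l # ls) (n # ns) =
    (if c then (if l then 0 else if n then hrem y z e False ls ns else y * hrem y z e True ls ns)
     else if l then (if n then hrem y z e False ls ns else z * hrem y z e True ls ns)
     else (if n then 0 else hrem y z e False ls ns))"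
| "hrem y z e c _ _ = 0"

fun vhrem :: "'a::comm_ring_1 \<Rightarrow> 'a \<Rightarrow> 'a \<Rightarrow> rstate \<Rightarrow> bool list \<Rightarrow> bool list \<Rightarrow> 'a" where
  "vhrem y z e r [] [] = (case r of RP \<Rightarrow> 1 | RQ \<Rightarrow> 1 | RR \<Rightarrow> e)"
| "vhrem y z e r (l # ls) (n # ns) =
    (case r of
      RP \<Rightarrow> if l = n then vhrem y z e RP ls ns
            else if l then z * vhrem y z e RQ ls ns + z * vhrem y z e RR ls ns else 0
    | RQ \<Rightarrow> if n then (if l then y * vhrem y z e RQ ls ns + z * vhrem y z e RR ls ns
                        else vhrem y z e RP ls ns) else 0
    | RR \<Rightarrow> if l then 0 else if n then vhrem y z e RP ls ns
            else z * vhrem y z e RQ ls ns + y * vhrem y z e RR ls ns)"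
| "vhrem y z e r _ _ = 0"

definition list_comp :: "(bool list \<Rightarrow> bool list \<Rightarrow> 'a::comm_ring_1) \<Rightarrow> (bool list \<Rightarrow> bool list \<Rightarrow> 'a)
    \<Rightarrow> bool list \<Rightarrow> bool list \<Rightarrow> 'a" where
  "list_comp F G ms ns = (\<Sum>ls\<in>bit_lists (length ms). F ms ls * G ls ns)"

lemma list_comp_Nil: "list_comp F G [] [] = F [] [] * G [] []"
  by (simp add: list_comp_def)

lemma list_comp_Cons:
  "list_comp F G (m # ms) ns = (\<Sum>ls\<in>bit_lists (length ms). F (m # ms) (False # ls) * G (False # ls) ns)
     + (\<Sum>ls\<in>bit_lists (length ms). F (m # ms) (True # ls) * G (True # ls) ns)"
  by (simp add: list_comp_def sum_bit_lists_Suc)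

text \<open>Three states suffice: a particle can cross downwards below a site only if the
  intermediate bit there is empty for \<open>hrem\<close> and occupied for \<open>vrem\<close>, so
  the two never cross together. The boundary weight is \<open>e\<close> for \<open>hrem\<close> and
  \<open>1\<close> for \<open>vrem\<close>.\<close>

lemma vhrem_eq_list_comp:
  assumes "length ls = length ns"
  shows "list_comp (hrem y z e False) (vrem y z 1 False) ls ns = vhrem y z e RP ls ns
       \<and> list_comp (hrem y z e False) (vrem y z 1 True) ls ns = vhrem y z e RQ ls ns
       \<and> list_comp (hrem y z e True) (vrem y z 1 False) ls ns = vhrem y z e RR ls ns"
  using assms
proof (induction ls ns rule: list_induct2)
  case Nil
  show ?case by (simp add: list_comp_Nil)
next
  case (Cons l ls n ns)
  let ?k = "length ls"
  have *: "vhrem y z e RP ls ns = (\<Sum>k\<in>bit_lists ?k. hrem y z e False ls k * vrem y z 1 False k ns)"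
    "vhrem y z e RQ ls ns = (\<Sum>k\<in>bit_lists ?k. hrem y z e False ls k * vrem y z 1 True k ns)"
    "vhrem y z e RR ls ns = (\<Sum>k\<in>bit_lists ?k. hrem y z e True ls k * vrem y z 1 False k ns)"
    using Cons.IH by (simp_all add: list_comp_def)
  show ?case
    by (cases l; cases n)
      (auto simp: list_comp_Cons * sum_distrib_left sum.distrib algebra_simps)
qed


section \<open>Commutation relations between partial transfer sums\<close>

text \<open>\<open>vrem 0 b\<close> is the removal of a set of corners with weight \<open>b\<close> each. The relation for
  \<open>X UA False\<close> is the commutation rule, up to the term \<open>X UB True\<close> in which a particle has passed the
  highest site; the other relations make the induction work.\<close>

lemma zinv_relations:
  fixes b x e :: "'a::comm_ring_1" and K K' :: "ustate \<Rightarrow> 'a"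
  defines "q \<equiv> 1 + b * x"
  defines "X \<equiv> \<lambda>s c. list_comp (uadd b x K s) (vrem 0 b e c)"
  defines "Y \<equiv> \<lambda>c s. list_comp (vrem 0 b e c) (uadd b x K' s)"
  assumes len: "length ms = length ns"
    and K: "K' UC = q * K UA" "K' UB = K UB" "K UA = q * K' UA - e * b * K UB"
      "K UC = K UA + e * b * K' UB" "e * K UC = e * q * K' UA"
  shows "Y False UC ms ns = q * X UA False ms ns \<and> Y True UC ms ns = q * X UA True ms ns \<and>
    Y False UB ms ns = X UB False ms ns \<and> X UA False ms ns = q * Y False UA ms ns - b * X UB True ms ns \<and>
    X UC False ms ns = X UA False ms ns + b * Y True UB ms ns \<and> X UC True ms ns = q * Y True UA ms ns"
  using len
proof (induction ms ns rule: list_induct2)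
  case Nil
  \<comment> \<open>On empty lists every sum is a boundary weight, and the six relations follow from
    the conditions on \<open>K\<close> and \<open>K'\<close>.\<close>
  show ?case using K(5) by (simp add: X_def Y_def list_comp_Nil K(1,2,4)) (simp add: K(3) algebra_simps)
next
  case (Cons m ms n ns)
  have X: "X UA False (m # ms) (n # ns) = (if m then (if n then X UC False ms ns else b * X UC True ms ns)
      else if n then X UB False ms ns else X UA False ms ns + b * X UB True ms ns)"
    "X UA True (m # ms) (n # ns) = (if \<not> m \<and> n then X UA False ms ns else 0)"
    "X UB False (m # ms) (n # ns) = (if m then (if n then x * X UB False ms ns else x * X UC False ms ns + x * q * X UA False ms ns + x * b * X UB True ms ns)
      else if n then 0 else x * X UB False ms ns)"
    "X UB True (m # ms) (n # ns) = (if m then (if n then x * X UC False ms ns + x * q * X UA False ms ns else 0)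
      else if n then x * X UB False ms ns else 0)"
    "X UC False (m # ms) (n # ns) = (if m then (if n then X UC False ms ns else b * X UC True ms ns)
      else if n then q * X UB False ms ns else q\<^sup>2 * X UA False ms ns + b * q * X UB True ms ns)"
    "X UC True (m # ms) (n # ns) = (if \<not> m \<and> n then q\<^sup>2 * X UA False ms ns else 0)"
    unfolding X_def q_def
    by ((cases m; cases n; simp add: list_comp_def sum_bit_lists_Suc power2_eq_square sum_distrib_left sum.distrib algebra_simps)+)
  have Y: "Y False UA (m # ms) (n # ns) = (if m then (if n then Y False UC ms ns + b * Y True UB ms ns else b * Y True UA ms ns)
      else if n then Y False UB ms ns else Y False UA ms ns)"
    "Y True UA (m # ms) (n # ns) = (if \<not> m \<and> n then Y False UC ms ns else 0)"
    "Y False UB (m # ms) (n # ns) = (if m then (if n then x * Y False UB ms ns else x * Y False UC ms ns + x * q * Y False UA ms ns + x * b * Y True UB ms ns)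
      else if n then 0 else x * Y False UB ms ns)"
    "Y True UB (m # ms) (n # ns) = (if m then 0 else if n then x * Y False UB ms ns else x * Y False UC ms ns + x * q * Y False UA ms ns)"
    "Y False UC (m # ms) (n # ns) = (if m then (if n then Y False UC ms ns + b * q * Y True UB ms ns else b * q\<^sup>2 * Y True UA ms ns)
      else if n then q * Y False UB ms ns else q\<^sup>2 * Y False UA ms ns)"
    "Y True UC (m # ms) (n # ns) = (if \<not> m \<and> n then Y False UC ms ns else 0)"
    unfolding Y_def q_def
    by ((cases m; cases n; simp add: list_comp_def sum_bit_lists_Suc power2_eq_square sum_distrib_left sum.distrib algebra_simps)+)
  \<comment> \<open>Written as rewrite rules that eliminate six of the twelve partial sums; what
    remains are polynomial identities in the other six.\<close>
  have IH: "Y False UC ms ns = q * (q * Y False UA ms ns - b * X UB True ms ns)"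
    "Y True UC ms ns = q * X UA True ms ns" "Y False UB ms ns = X UB False ms ns"
    "X UA False ms ns = q * Y False UA ms ns - b * X UB True ms ns"
    "X UC False ms ns = q * Y False UA ms ns - b * X UB True ms ns + b * Y True UB ms ns"
    "X UC True ms ns = q * Y True UA ms ns"
    using Cons.IH by auto
  show ?case
    unfolding X Y IH by (cases m; cases n; simp add: q_def power2_eq_square algebra_simps)
qed

text \<open>The sixth relation is the commutation rule, up to terms \<open>X UB _\<close> in which a particle has passed the
  highest site. The nine relations together span all linear relations between the functions
  \<open>X s r\<close> and \<open>Y r s\<close> for generic parameters, hence they are inductive.\<close>

lemma vhrem_relations:
  fixes b x y e :: "'a::comm_ring_1" and K :: "ustate \<Rightarrow> 'a"
  defines "q \<equiv> 1 + b * x" and "z \<equiv> y + b" and "w \<equiv> 1 + b * x + x * y" and "u \<equiv> 1 - x * y"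
  defines "X \<equiv> \<lambda>s r. list_comp (uadd b x K s) (vhrem y z e r)"
  defines "Y \<equiv> \<lambda>r s. list_comp (vhrem y z e r) (uadd b x K s)"
  assumes len: "length ms = length ns"
    and K: "w * K UA = u * (q * K UA - b * K UB) + z * K UB + y * e * K UB"
      "e * K UC = q * (K UA + q * e * K UA - K UC)"
      "K UC = q * (q * K UA - b * K UB)"
      "u * K UA + z * e * K UB + y * K UB = w * (q * K UA - b * K UB)"
      "K UC = K UA + b * e * K UB"
  shows "w * X UA RP ms ns = u * (q * Y RP UA ms ns - b * X UB RQ ms ns) + z * Y RQ UB ms ns + y * Y RR UB ms ns \<and>
    z * X UA RQ ms ns + y * X UA RR ms ns = z * Y RQ UA ms ns + y * Y RR UA ms ns \<and>
    Y RR UC ms ns = q * (X UA RQ ms ns + q * X UA RR ms ns - Y RQ UC ms ns) \<and>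
    X UB RP ms ns = Y RP UB ms ns \<and>
    Y RP UC ms ns = q * (q * Y RP UA ms ns - b * X UB RQ ms ns) \<and>
    u * X UA RP ms ns + z * X UB RR ms ns + y * X UB RQ ms ns = w * (q * Y RP UA ms ns - b * X UB RQ ms ns) \<and>
    X UC RP ms ns = X UA RP ms ns + b * Y RR UB ms ns \<and>
    X UC RR ms ns = q * Y RQ UA ms ns + q\<^sup>2 * Y RR UA ms ns - q * X UC RQ ms ns \<and>
    y * X UC RQ ms ns + z * X UC RR ms ns = y * Y RQ UC ms ns + z * Y RR UC ms ns"
  using len
proof (induction ms ns rule: list_induct2)
  case Nil
  have "e * K UC = q * K UA + q\<^sup>2 * e * K UA - q * K UC"
    using K(2) by (simp add: algebra_simps power2_eq_square)
  with K show ?case by (simp add: X_def Y_def list_comp_Nil algebra_simps power2_eq_square)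
next
  case (Cons m ms n ns)
  have X: "X UA RP (m # ms) (n # ns) = (if m then (if n then X UC RP ms ns else z * X UC RQ ms ns + z * X UC RR ms ns)
      else if n then X UB RP ms ns else X UA RP ms ns + z * X UB RQ ms ns + z * X UB RR ms ns)"
    "X UA RQ (m # ms) (n # ns) = (if m then (if n then y * X UC RQ ms ns + z * X UC RR ms ns else 0)
      else if n then X UA RP ms ns + y * X UB RQ ms ns + z * X UB RR ms ns else 0)"
    "X UA RR (m # ms) (n # ns) = (if m then 0 else if n then X UA RP ms ns else z * X UA RQ ms ns + y * X UA RR ms ns)"
    "X UB RP (m # ms) (n # ns) = (if m then (if n then x * X UB RP ms ns
        else x * X UC RP ms ns + x * q * X UA RP ms ns + x * z * X UB RQ ms ns + x * z * X UB RR ms ns)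
      else if n then 0 else x * X UB RP ms ns)"
    "X UB RQ (m # ms) (n # ns) = (if m then (if n then x * X UC RP ms ns + x * q * X UA RP ms ns + x * y * X UB RQ ms ns + x * z * X UB RR ms ns else 0)
      else if n then x * X UB RP ms ns else 0)"
    "X UB RR (m # ms) (n # ns) = (if m then (if n then x * X UC RP ms ns + x * q * X UA RP ms ns
        else x * z * X UC RQ ms ns + x * y * X UC RR ms ns + x * q * z * X UA RQ ms ns + x * q * y * X UA RR ms ns)
      else if n then x * X UB RP ms ns else x * z * X UB RQ ms ns + x * y * X UB RR ms ns)"
    "X UC RP (m # ms) (n # ns) = (if m then (if n then X UC RP ms ns else z * X UC RQ ms ns + z * X UC RR ms ns)
      else if n then q * X UB RP ms ns else q\<^sup>2 * X UA RP ms ns + q * z * X UB RQ ms ns + q * z * X UB RR ms ns)"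
    "X UC RQ (m # ms) (n # ns) = (if m then (if n then y * X UC RQ ms ns + z * X UC RR ms ns else 0)
      else if n then q\<^sup>2 * X UA RP ms ns + q * y * X UB RQ ms ns + q * z * X UB RR ms ns else 0)"
    "X UC RR (m # ms) (n # ns) = (if m then 0 else if n then q\<^sup>2 * X UA RP ms ns else q\<^sup>2 * z * X UA RQ ms ns + q\<^sup>2 * y * X UA RR ms ns)"
    unfolding X_def q_def
    by ((cases m; cases n; simp add: list_comp_def sum_bit_lists_Suc power2_eq_square sum_distrib_left sum.distrib algebra_simps)+)
  have Y: "Y RP UA (m # ms) (n # ns) = (if m then (if n then Y RP UC ms ns + z * Y RQ UB ms ns + z * Y RR UB ms ns
        else z * Y RQ UA ms ns + z * Y RR UA ms ns)
      else if n then Y RP UB ms ns else Y RP UA ms ns)"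
    "Y RP UB (m # ms) (n # ns) = (if m then (if n then x * Y RP UB ms ns
        else x * Y RP UC ms ns + x * q * Y RP UA ms ns + x * z * Y RQ UB ms ns + x * z * Y RR UB ms ns)
      else if n then 0 else x * Y RP UB ms ns)"
    "Y RP UC (m # ms) (n # ns) = (if m then (if n then Y RP UC ms ns + q * z * Y RQ UB ms ns + q * z * Y RR UB ms ns
        else q\<^sup>2 * z * Y RQ UA ms ns + q\<^sup>2 * z * Y RR UA ms ns)
      else if n then q * Y RP UB ms ns else q\<^sup>2 * Y RP UA ms ns)"
    "Y RQ UA (m # ms) (n # ns) = (if n then (if m then y * Y RQ UC ms ns + z * Y RR UC ms ns else Y RP UC ms ns) else 0)"
    "Y RQ UB (m # ms) (n # ns) = (if m then (if n then x * y * Y RQ UB ms ns + x * z * Y RR UB ms ns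
        else x * y * Y RQ UC ms ns + x * z * Y RR UC ms ns + x * q * y * Y RQ UA ms ns + x * q * z * Y RR UA ms ns)
      else if n then x * Y RP UB ms ns else x * Y RP UC ms ns + x * q * Y RP UA ms ns)"
    "Y RQ UC (m # ms) (n # ns) = (if n then (if m then y * Y RQ UC ms ns + z * Y RR UC ms ns else Y RP UC ms ns) else 0)"
    "Y RR UA (m # ms) (n # ns) = (if m then 0 else if n then Y RP UC ms ns + z * Y RQ UB ms ns + y * Y RR UB ms ns
      else z * Y RQ UA ms ns + y * Y RR UA ms ns)"
    "Y RR UB (m # ms) (n # ns) = (if m then 0 else if n then x * Y RP UB ms ns
      else x * Y RP UC ms ns + x * q * Y RP UA ms ns + x * z * Y RQ UB ms ns + x * y * Y RR UB ms ns)"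
    "Y RR UC (m # ms) (n # ns) = (if m then 0 else if n then Y RP UC ms ns + q * z * Y RQ UB ms ns + q * y * Y RR UB ms ns
      else q\<^sup>2 * z * Y RQ UA ms ns + q\<^sup>2 * y * Y RR UA ms ns)"
    unfolding Y_def q_def
    by ((cases m; cases n; simp add: list_comp_def sum_bit_lists_Suc power2_eq_square sum_distrib_left sum.distrib algebra_simps)+)
  define AP AQ AR BP BQ BR CP CQ CR where Xd:
    "AP = X UA RP ms ns" "AQ = X UA RQ ms ns" "AR = X UA RR ms ns"
    "BP = X UB RP ms ns" "BQ = X UB RQ ms ns" "BR = X UB RR ms ns"
    "CP = X UC RP ms ns" "CQ = X UC RQ ms ns" "CR = X UC RR ms ns"
  define PA PB PC QA QB QC RA RB RC where Yd:
    "PA = Y RP UA ms ns" "PB = Y RP UB ms ns" "PC = Y RP UC ms ns"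
    "QA = Y RQ UA ms ns" "QB = Y RQ UB ms ns" "QC = Y RQ UC ms ns"
    "RA = Y RR UA ms ns" "RB = Y RR UB ms ns" "RC = Y RR UC ms ns"
  note defs = q_def z_def w_def u_def
  \<comment> \<open>The defects of the nine relations. They stay symbolic until a goal has become
    \<open>l - r = c\<close> with an explicit combination \<open>c\<close> of them, which holds by
    expansion alone; only then are they replaced by \<open>0\<close>.\<close>
  define r1 where "r1 = w * AP - (u * (q * PA - b * BQ) + z * QB + y * RB)"
  define r2 where "r2 = z * AQ + y * AR - (z * QA + y * RA)"
  define r3 where "r3 = RC - q * (AQ + q * AR - QC)"
  define r4 where "r4 = BP - PB"
  define r5 where "r5 = PC - q * (q * PA - b * BQ)"
  define r6 where "r6 = u * AP + z * BR + y * BQ - w * (q * PA - b * BQ)"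
  define r7 where "r7 = CP - (AP + b * RB)"
  define r8 where "r8 = CR - (q * QA + q\<^sup>2 * RA - q * CQ)"
  define r9 where "r9 = y * CQ + z * CR - (y * QC + z * RC)"
  note rdefs = r1_def r2_def r3_def r4_def r5_def r6_def r7_def r8_def r9_def
  have r0: "r1 = 0" "r2 = 0" "r3 = 0" "r4 = 0" "r5 = 0" "r6 = 0" "r7 = 0" "r8 = 0" "r9 = 0"
    unfolding rdefs Xd Yd right_minus_eq using Cons.IH by blast+
  \<comment> \<open>Each new relation is an explicit linear combination of the old ones.\<close>
  have lc: "l = r" if "l - r = c" "c = 0" for l r c :: 'a
    using that by simp
  show ?case
  proof (cases m; cases n)
    assume mn: "\<not> m" "\<not> n"
    show ?thesis
      unfolding X Y Xd[symmetric] Yd[symmetric] using mn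
    proof (simp only: if_True if_False, intro conjI, goal_cases)
      case 1
      show ?case by (rule lc[where c = "w * r6 + x * y * r1 - x * (z + y) * r5"], simp only: rdefs defs, simp add: power2_eq_square algebra_simps, simp add: r0)
    next
      case 2
      show ?case by (rule lc[where c = "y * r2"], simp only: rdefs defs, simp add: power2_eq_square algebra_simps, simp add: r0)
    next
      case 3
      show ?case by (rule lc[where c = "- (q\<^sup>2 * r2)"], simp only: rdefs defs, simp add: power2_eq_square algebra_simps, simp add: r0)
    next
      case 4
      show ?case by (rule lc[where c = "x * r4"], simp only: rdefs defs, simp add: power2_eq_square algebra_simps, simp add: r0)
    next
      case 5
      show ?case by (simp add: power2_eq_square algebra_simps)
    next
      case 6
      show ?case by (rule lc[where c = "r6"], simp only: rdefs defs, simp add: power2_eq_square algebra_simps, simp add: r0)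
    next
      case 7
      show ?case by (rule lc[where c = "b * x * (r6 + r1 - r5)"], simp only: rdefs defs, simp add: power2_eq_square algebra_simps, simp add: r0)
    next
      case 8
      show ?case by (rule lc[where c = "q\<^sup>2 * r2"], simp only: rdefs defs, simp add: power2_eq_square algebra_simps, simp add: r0)
    next
      case 9
      show ?case by (rule lc[where c = "z * q\<^sup>2 * r2"], simp only: rdefs defs, simp add: power2_eq_square algebra_simps, simp add: r0)
    qed
  next
    assume mn: "\<not> m" "n"
    show ?thesis
      unfolding X Y Xd[symmetric] Yd[symmetric] using mn
    proof (simp only: if_True if_False, intro conjI, goal_cases)
      case 1
      show ?case by (rule lc[where c = "(w + u * b * x) * r4"], simp only: rdefs defs, simp add: power2_eq_square algebra_simps, simp add: r0)
    next
      case 2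
      show ?case by (rule lc[where c = "z * r6 + y * r1 - (z + y) * r5"], simp only: rdefs defs, simp add: power2_eq_square algebra_simps, simp add: r0)
    next
      case 3
      show ?case by (rule lc[where c = "(q + 1) * r5 - q * (r1 + r6)"], simp only: rdefs defs, simp add: power2_eq_square algebra_simps, simp add: r0)
    next
      case 4
      show ?case by (rule refl)
    next
      case 5
      show ?case by (rule lc[where c = "q * b * x * r4"], simp only: rdefs defs, simp add: power2_eq_square algebra_simps, simp add: r0)
    next
      case 6
      show ?case by (rule lc[where c = "w * q * r4"], simp only: rdefs defs, simp add: power2_eq_square algebra_simps, simp add: r0)
    next
      case 7
      show ?case by (rule lc[where c = "b * x * r4"], simp only: rdefs defs, simp add: power2_eq_square algebra_simps, simp add: r0)
    next
      case 8
      show ?case by (rule lc[where c = "q\<^sup>2 * (r1 + r6) - q * (q + 1) * r5"], simp only: rdefs defs, simp add: power2_eq_square algebra_simps, simp add: r0)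
    next
      case 9
      show ?case by (rule lc[where c = "q * (y * r6 + z * r1) - (y + z) * r5"], simp only: rdefs defs, simp add: power2_eq_square algebra_simps, simp add: r0)
    qed
  next
    assume mn: "m" "\<not> n"
    show ?thesis
      unfolding X Y Xd[symmetric] Yd[symmetric] using mn
    proof (simp only: if_True if_False, intro conjI, goal_cases)
      case 1
      show ?case by (rule lc[where c = "z * r8 + z * x * r9"], simp only: rdefs defs, simp add: power2_eq_square algebra_simps, simp add: r0)
    next
      case 2
      show ?case by (simp add: power2_eq_square algebra_simps)
    next
      case 3
      show ?case by (simp add: power2_eq_square algebra_simps)
    next
      case 4
      show ?case by (rule lc[where c = "x * r7 + x * (r6 + r1 - r5)"], simp only: rdefs defs, simp add: power2_eq_square algebra_simps, simp add: r0)
    next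
      case 5
      show ?case by (simp add: power2_eq_square algebra_simps)
    next
      case 6
      show ?case by (rule lc[where c = "z * r8 + z * x * q * r2"], simp only: rdefs defs, simp add: power2_eq_square algebra_simps, simp add: r0)
    next
      case 7
      show ?case by (simp add: power2_eq_square algebra_simps)
    next
      case 8
      show ?case by (simp add: power2_eq_square algebra_simps)
    next
      case 9
      show ?case by (simp add: power2_eq_square algebra_simps)
    qed
  next
    assume mn: "m" "n"
    show ?thesis
      unfolding X Y Xd[symmetric] Yd[symmetric] using mn
    proof (simp only: if_True if_False, intro conjI, goal_cases)
      case 1
      show ?case by (rule lc[where c = "(w + u * b * x) * r7 + (1 + u * b * x) * r1 + u * b * x * r6 - u * q * r5"], simp only: rdefs defs, simp add: power2_eq_square algebra_simps, simp add: r0)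
    next
      case 2
      show ?case by (rule lc[where c = "z * r9"], simp only: rdefs defs, simp add: power2_eq_square algebra_simps, simp add: r0)
    next
      case 3
      show ?case by (rule lc[where c = "- (q * r9)"], simp only: rdefs defs, simp add: power2_eq_square algebra_simps, simp add: r0)
    next
      case 4
      show ?case by (rule lc[where c = "x * r4"], simp only: rdefs defs, simp add: power2_eq_square algebra_simps, simp add: r0)
    next
      case 5
      show ?case by (rule lc[where c = "q * b * x * (r7 + r1 + r6) + (1 - q\<^sup>2) * r5"], simp only: rdefs defs, simp add: power2_eq_square algebra_simps, simp add: r0)
    next
      case 6
      show ?case by (rule lc[where c = "(q + q * z * x) * (r7 + r1) + q * z * x * r6 - w * q * r5"], simp only: rdefs defs, simp add: power2_eq_square algebra_simps, simp add: r0)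
    next
      case 7
      show ?case by (simp add: power2_eq_square algebra_simps)
    next
      case 8
      show ?case by (rule lc[where c = "q * r9"], simp only: rdefs defs, simp add: power2_eq_square algebra_simps, simp add: r0)
    next
      case 9
      show ?case by (rule lc[where c = "y * r9"], simp only: rdefs defs, simp add: power2_eq_square algebra_simps, simp add: r0)
    qed
  qed
qed

section \<open>Strip and skew shape operators\<close>

text \<open>State of a cut when a single strip is added: \<open>AF\<close> if a box is added at its
  content; \<open>AC\<close> if none is and the site above is occupied in the small partition (for
  \<open>vadd\<close>, by a particle that does not move), so that an empty site below makes a
  corner; \<open>AN\<close> otherwise.\<close>

datatype astate = AN | AF | AC

fun vadd :: "'a::comm_ring_1 \<Rightarrow> 'a \<Rightarrow> (astate \<Rightarrow> 'a) \<Rightarrow> astate \<Rightarrow> bool list \<Rightarrow> bool list \<Rightarrow> 'a" where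
  "vadd x q I s [] [] = I s"
| "vadd x q I s (m # ms) (k # ks) =
    (case s of
      AN \<Rightarrow> if m then (if k then vadd x q I AC ms ks else 0)
            else vadd x q I (if k then AF else AN) ms ks
    | AF \<Rightarrow> if m then x * vadd x q I (if k then AF else AN) ms ks else 0
    | AC \<Rightarrow> if m then (if k then vadd x q I AC ms ks else 0)
            else q * vadd x q I (if k then AF else AN) ms ks)"
| "vadd x q I s _ _ = 0"

fun hadd :: "'a::comm_ring_1 \<Rightarrow> 'a \<Rightarrow> (astate \<Rightarrow> 'a) \<Rightarrow> astate \<Rightarrow> bool list \<Rightarrow> bool list \<Rightarrow> 'a" where
  "hadd x q I s [] [] = I s"
| "hadd x q I s (k # ks) (l # ls) =
    (case s of
      AN \<Rightarrow> if k then (if l then hadd x q I AC ks ls else 0)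
            else hadd x q I (if l then AF else AN) ks ls
    | AF \<Rightarrow> if l then 0 else x * hadd x q I (if k then AC else AF) ks ls
    | AC \<Rightarrow> if k then (if l then hadd x q I AC ks ls else 0)
            else if l then hadd x q I AF ks ls else q * hadd x q I AN ks ls)"
| "hadd x q I s _ _ = 0"

text \<open>A crossing particle is moved either by the second strip (\<open>AN\<close>,
  \<open>AF\<close>) or by the first; in the latter case it occupies the site above when the second
  strip is added (\<open>AF\<close>, \<open>AC\<close>). These are the two summands of
  \<open>UB\<close>.\<close>

lemma uadd_eq_list_comp:
  fixes b x :: "'a::comm_ring_1"
  defines "q \<equiv> 1 + b * x"
  assumes "length ms = length ls"
    and K: "K UA = I AN * J AN" "K UB = I AN * J AF + I AF * J AC" "K UC = I AC * J AC"
  shows "uadd b x K UA ms ls = list_comp (vadd x q I AN) (hadd x q J AN) ms ls \<and>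
    uadd b x K UB ms ls = list_comp (vadd x q I AN) (hadd x q J AF) ms ls + list_comp (vadd x q I AF) (hadd x q J AC) ms ls \<and>
    uadd b x K UC ms ls = list_comp (vadd x q I AC) (hadd x q J AC) ms ls"
  using assms(2)
proof (induction ms ls rule: list_induct2)
  case Nil
  then show ?case by (simp add: list_comp_Nil K)
next
  case (Cons m ms l ls)
  then show ?case
    by (cases m; cases l)
      (simp_all add: list_comp_def sum_bit_lists_Suc sum_distrib_left sum.distrib q_def power2_eq_square algebra_simps)
qed

text \<open>\<open>f\<close> is the number of boxes removed from the diagonal belonging to the cut above the head. A row of the
  skew shape ends at an occupied site of the large partition, a column starts at an empty site of the
  small one; \<open>cutwt\<close> gives one box of each row (or column) the weight \<open>y\<close> and the others \<open>t\<close>.\<close>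

fun skewrem :: "(bool \<Rightarrow> bool \<Rightarrow> nat \<Rightarrow> 'a::comm_ring_1) \<Rightarrow> 'a \<Rightarrow> nat \<Rightarrow> bool list \<Rightarrow> bool list \<Rightarrow> 'a" where
  "skewrem g e f [] [] = e ^ f"
| "skewrem g e f (l # ls) (n # ns) =
    (if of_bool n \<le> f + of_bool l
     then g l n (f + of_bool l - of_bool n) * skewrem g e (f + of_bool l - of_bool n) ls ns else 0)"
| "skewrem g e f _ _ = 0"

definition cutwt :: "'a::comm_ring_1 \<Rightarrow> 'a \<Rightarrow> bool \<Rightarrow> nat \<Rightarrow> 'a" where
  "cutwt y t c f = (if c \<and> f > 0 then y * t ^ (f - 1) else t ^ f)"

definition zrem where "zrem t = skewrem (\<lambda>l n f. t ^ f)"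
definition rrem where "rrem y t = skewrem (\<lambda>l n. cutwt y t l)"
definition crem where "crem y t = skewrem (\<lambda>l n. cutwt y t (\<not> n))"

lemmas rem_defs = zrem_def rrem_def crem_def

text \<open>In a block of rows whose lengths drop by one, last boxes can be stripped only from a
  lower segment of the block. \<open>vrem\<close> gives the topmost stripped row
  \<open>y - t\<close> and those below it \<open>y\<close>, and \<open>zrem\<close> gives
  \<open>t\<close> to all other boxes. The sum over the segments telescopes by
  \<open>t + (y - t) = y\<close> and leaves one \<open>y\<close> per row.\<close>

lemma rrem_eq_list_comp:
  fixes y t e :: "'a::comm_ring_1"
  assumes "length ls = length ns"
  shows "list_comp (vrem y (y - t) e False) (zrem t e f) ls ns = rrem y t e f ls ns
    \<and> list_comp (vrem y (y - t) e True) (zrem t e f) ls ns = rrem y t e (Suc f) ls ns"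
  using assms
proof (induction ls ns arbitrary: f rule: list_induct2)
  case Nil
  show ?case by (simp add: list_comp_Nil rem_defs)
next
  case (Cons l ls n ns)
  have IH: "(\<Sum>k\<in>bit_lists (length ls). vrem y (y - t) e False ls k * skewrem (\<lambda>l n f. t ^ f) e f k ns)
      = skewrem (\<lambda>l n. cutwt y t l) e f ls ns"
    "(\<Sum>k\<in>bit_lists (length ls). vrem y (y - t) e True ls k * skewrem (\<lambda>l n f. t ^ f) e f k ns)
      = skewrem (\<lambda>l n. cutwt y t l) e (Suc f) ls ns" for f
    using Cons.IH[of f] by (simp_all add: list_comp_def rem_defs)
  have p: "(\<Sum>k\<in>bit_lists (length ls). F k * (c * G k)) = c * (\<Sum>k\<in>bit_lists (length ls). F k * G k)"
    "(\<Sum>k\<in>bit_lists (length ls). c * F k * G k) = c * (\<Sum>k\<in>bit_lists (length ls). F k * G k)"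
    for F G :: "bool list \<Rightarrow> 'a" and c
    by (simp_all add: sum_distrib_left mult_ac)
  show ?case
    by (cases l; cases n; cases f;
      simp add: list_comp_def sum_bit_lists_Suc rem_defs p IH cutwt_def; simp add: algebra_simps)
qed

text \<open>The mirror image: the strip peeled off last is taken from the top boxes of the columns,
  and the blocks are runs of empty sites of the small partition.\<close>

lemma crem_eq_list_comp:
  fixes y t e :: "'a::comm_ring_1"
  assumes "length ls = length ns"
  shows "list_comp (zrem t e f) (hrem y (y - t) e False) ls ns = crem y t e f ls ns
    \<and> list_comp (zrem t e f) (hrem y (y - t) e True) ls ns = crem y t e (Suc f) ls ns"
  using assms
proof (induction ls ns arbitrary: f rule: list_induct2)
  case Nil
  show ?case by (simp add: list_comp_Nil rem_defs)
next
  case (Cons l ls n ns)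
  have IH: "(\<Sum>k\<in>bit_lists (length ls). skewrem (\<lambda>l n f. t ^ f) e f ls k * hrem y (y - t) e False k ns)
      = skewrem (\<lambda>l n. cutwt y t (\<not> n)) e f ls ns"
    "(\<Sum>k\<in>bit_lists (length ls). skewrem (\<lambda>l n f. t ^ f) e f ls k * hrem y (y - t) e True k ns)
      = skewrem (\<lambda>l n. cutwt y t (\<not> n)) e (Suc f) ls ns" for f
    using Cons.IH[of f] by (simp_all add: list_comp_def rem_defs)
  have p: "(\<Sum>k\<in>bit_lists (length ls). F k * (c * G k)) = c * (\<Sum>k\<in>bit_lists (length ls). F k * G k)"
    "(\<Sum>k\<in>bit_lists (length ls). c * F k * G k) = c * (\<Sum>k\<in>bit_lists (length ls). F k * G k)"
    for F G :: "bool list \<Rightarrow> 'a" and c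
    by (simp_all add: sum_distrib_left mult_ac)
  show ?case
    by (cases l; cases n; cases f;
      simp add: list_comp_def sum_bit_lists_Suc rem_defs p IH cutwt_def; simp add: algebra_simps)
qed

text \<open>Moebius inversion: for \<open>y = 0\<close> every nonempty row has weight
  \<open>0\<close>, and by \<open>rrem_eq_list_comp\<close> this says that
  \<open>vrem 0 (- t)\<close> followed by \<open>zrem t\<close> is the identity.\<close>

lemma rrem_zero:
  assumes "length ls = length ns"
  shows "rrem 0 t e 0 ls ns = (if ls = ns then 1 else 0)"
  using assms
  by (induction ls ns rule: list_induct2) (auto simp: rrem_def cutwt_def)

section \<open>Eigenvectors modulo a filtration\<close>

text \<open>\<open>F d\<close> stands for the series of order at least \<open>d\<close> in the
  variables \<open>x\<close>. The eigenvector argument works from these closure properties and from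
  inverses of \<open>1 + b x\<close>.\<close>

locale filtered_ring =
  fixes F :: "nat \<Rightarrow> 'a::comm_ring_1 set"
  assumes F_0: "F 0 = UNIV"
    and F_Suc: "F (Suc d) \<subseteq> F d"
    and F_zero: "0 \<in> F d"
    and F_add: "f \<in> F d \<Longrightarrow> g \<in> F d \<Longrightarrow> f + g \<in> F d"
    and F_mult: "f \<in> F c \<Longrightarrow> g \<in> F d \<Longrightarrow> f * g \<in> F (c + d)"
begin

lemma F_mono: "c \<le> d \<Longrightarrow> f \<in> F d \<Longrightarrow> f \<in> F c"
  by (induction d rule: dec_induct) (use F_Suc in auto)

lemma F_mult_right: "f \<in> F d \<Longrightarrow> f * g \<in> F d"
  using F_mult[of f d g 0] by (simp add: F_0)

lemma F_mult_left: "f \<in> F d \<Longrightarrow> g * f \<in> F d"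
  using F_mult_right[of f d g] by (simp add: mult.commute)

lemma F_sum: "(\<And>i. i \<in> A \<Longrightarrow> f i \<in> F d) \<Longrightarrow> sum f A \<in> F d"
  by (induction A rule: infinite_finite_induct) (auto simp: F_zero F_add)

lemma F_diff: "f \<in> F d \<Longrightarrow> g \<in> F d \<Longrightarrow> f - g \<in> F d"
  using F_add[of f d "- 1 * g"] F_mult_left[of g d "- 1"] by simp

definition cong :: "nat \<Rightarrow> 'a \<Rightarrow> 'a \<Rightarrow> bool" where
  "cong N f g \<longleftrightarrow> f - g \<in> F (Suc N)"

lemma cong_refl [simp]: "cong N f f"
  by (simp add: cong_def F_zero)

lemma cong_sym: "cong N f g \<Longrightarrow> cong N g f"
  unfolding cong_def using F_diff[of 0 "Suc N" "f - g"] by (simp add: F_zero)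

lemma cong_trans [trans]: "cong N f g \<Longrightarrow> cong N g h \<Longrightarrow> cong N f h"
  unfolding cong_def using F_add[of "f - g" "Suc N" "g - h"] by simp

lemma cong_eq_trans [trans]:
  "f = g \<Longrightarrow> cong N g h \<Longrightarrow> cong N f h"
  "cong N f g \<Longrightarrow> g = h \<Longrightarrow> cong N f h"
  by simp_all

lemma cong_mult_left: "cong N f g \<Longrightarrow> cong N (c * f) (c * g)"
  unfolding cong_def using F_mult_left[of "f - g" "Suc N" c] by (simp add: right_diff_distrib)

lemma cong_mult_right: "cong N f g \<Longrightarrow> cong N (f * c) (g * c)"
  using cong_mult_left[of N f g c] by (simp add: mult.commute)

lemma cong_sum: "(\<And>i. i \<in> A \<Longrightarrow> cong N (f i) (g i)) \<Longrightarrow> cong N (sum f A) (sum g A)"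
  unfolding cong_def sum_subtractf[symmetric] by (rule F_sum)

end

definition rowact :: "nat \<Rightarrow> (bool list \<Rightarrow> 'a::comm_ring_1) \<Rightarrow> (bool list \<Rightarrow> bool list \<Rightarrow> 'a) \<Rightarrow> bool list \<Rightarrow> 'a" where
  "rowact N v M ns = (\<Sum>ls\<in>bit_lists N. v ls * M ls ns)"

lemma rowact_list_comp:
  "rowact N v (list_comp M1 M2) ns = rowact N (rowact N v M1) M2 ns"
proof -
  have "rowact N v (list_comp M1 M2) ns = (\<Sum>ls\<in>bit_lists N. \<Sum>ks\<in>bit_lists N. v ls * M1 ls ks * M2 ks ns)"
    unfolding rowact_def list_comp_def
    by (intro sum.cong refl) (simp add: bit_lists_def sum_distrib_left mult.assoc)
  also have "\<dots> = (\<Sum>ks\<in>bit_lists N. \<Sum>ls\<in>bit_lists N. v ls * M1 ls ks * M2 ks ns)"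
    by (rule sum.swap)
  finally show ?thesis by (simp add: rowact_def sum_distrib_right)
qed

lemma rowact_cong:
  "(\<And>ls. length ls = N \<Longrightarrow> v ls = v' ls) \<Longrightarrow> (\<And>ls. length ls = N \<Longrightarrow> M ls ns = M' ls ns)
    \<Longrightarrow> rowact N v M ns = rowact N v' M' ns"
  unfolding rowact_def by (intro sum.cong refl) (auto simp: bit_lists_def)

lemma rowact_scale: "rowact N (\<lambda>ls. c * v ls) M ns = c * rowact N v M ns"
  by (simp add: rowact_def sum_distrib_left mult.assoc)

text \<open>The size of the partition: the head of a list is its highest site, with number
  \<open>Suc (length ls)\<close>.\<close>

fun bit_weight :: "bool list \<Rightarrow> nat" where
  "bit_weight [] = 0"
| "bit_weight (l # ls) = (if l then Suc (length ls) else 0) + bit_weight ls"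

definition vac :: "bool list \<Rightarrow> 'a::comm_ring_1" where
  "vac ls = (if True \<in> set ls then 0 else 1)"

primrec addvec :: "nat \<Rightarrow> (nat \<Rightarrow> bool list \<Rightarrow> bool list \<Rightarrow> 'a::comm_ring_1) \<Rightarrow> nat \<Rightarrow> bool list \<Rightarrow> 'a" where
  "addvec N M 0 = vac"
| "addvec N M (Suc k) = rowact N (addvec N M k) (M k)"

lemma vac_rowact:
  assumes "length ns = N" "\<And>ls. length ls = N \<Longrightarrow> True \<notin> set ls \<Longrightarrow> M ls ns = vac ns"
  shows "rowact N vac M ns = vac ns"
proof -
  have "rowact N vac M ns = (\<Sum>ls\<in>{replicate N False}. vac ls * M ls ns)"
    unfolding rowact_def
  proof (rule sum.mono_neutral_right)
    show "finite (bit_lists N)" "{replicate N False} \<subseteq> bit_lists N"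
      by simp (simp add: bit_lists_def)
    show "\<forall>i\<in>bit_lists N - {replicate N False}. vac i * M i ns = 0"
    proof
      fix i assume "i \<in> bit_lists N - {replicate N False}"
      then have "True \<in> set i"
        using replicate_eqI[of i N False] by (force simp: bit_lists_def)
      then show "vac i * M i ns = 0" by (simp add: vac_def)
    qed
  qed
  with assms show ?thesis by (auto simp: vac_def)
qed

lemma vrem_vac:
  assumes "length ls = length ns" "True \<notin> set ls"
  shows "vrem y z e False ls ns = vac ns"
  using assms by (induction ls ns rule: list_induct2) (auto simp: vac_def)

lemma vhrem_vac:
  assumes "length ls = length ns" "True \<notin> set ls"
  shows "vhrem y z e RP ls ns = vac ns"
  using assms by (induction ls ns rule: list_induct2) (auto simp: vac_def)

context filtered_ring
begin

lemma rowact_cong_mod: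
  "(\<And>ls. length ls = N \<Longrightarrow> cong N (v ls) (v' ls)) \<Longrightarrow> cong N (rowact N v M ns) (rowact N v' M ns)"
  unfolding rowact_def by (intro cong_sum cong_mult_right) (auto simp: bit_lists_def)

text \<open>Each upward step of a particle carries a factor in \<open>F 1\<close>, so the order
  grows by at least the number of added boxes. In state \<open>UB\<close> a particle has left the
  list for site \<open>Suc (length ls)\<close> and counts as a part of that size.\<close>

lemma uadd_order:
  assumes "length ms = length ls" "x \<in> F 1" "K UB \<in> F 1" "f \<in> F (d + bit_weight ms)"
  shows "f * uadd b x K s ms ls \<in> F (d + bit_weight ls + (if s = UB then Suc (length ls) else 0))"
  using assms(1,4)
proof (induction ms ls arbitrary: f d s rule: list_induct2)
  case Nil
  then show ?case using F_mult[of f d "K UB" 1] assms(3) F_mult_right[of f d] by auto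
next
  case (Cons m ms l ls)
  let ?k = "length ls"
  have fx: "f * x \<in> F (Suc (d + bit_weight (m # ms)))"
    using F_mult[OF Cons.prems assms(2)] by simp
  \<comment> \<open>The head of \<open>ms\<close> is moved into the offset: \<open>d'\<close>
    absorbs its site number if it is occupied, and the factor \<open>x\<close> if one is
    spent.\<close>
  have up: "g * uadd b x K s ms ls \<in> F c"
    if "g \<in> F c'" "c' = d' + bit_weight ms" "c \<le> d' + bit_weight ls + (if s = UB then Suc ?k else 0)" for g c c' d' s
    using Cons.IH[of g d' s] that F_mono by blast
  have k: "length ms = ?k" by (rule Cons.hyps)
  have A: "f * x * uadd b x K UA ms ls \<in> F (d + ?k + bit_weight ls + 2)" if m
    by (rule up[OF fx, of "d + ?k + 2"]) (use that k in auto)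
  have C: "f * x * uadd b x K UC ms ls \<in> F (d + ?k + bit_weight ls + 2)" if m
    by (rule up[OF fx, of "d + ?k + 2"]) (use that k in auto)
  have B1: "f * x * uadd b x K UB ms ls \<in> F (d + ?k + bit_weight ls + ?k + 3)" if m
    by (rule up[OF fx, of "d + ?k + 2"]) (use that k in auto)
  have B0: "f * x * uadd b x K UB ms ls \<in> F (d + bit_weight ls + ?k + 2)" if "\<not> m"
    by (rule up[OF fx, of "d + 1"]) (use that k in auto)
  have A': "f * uadd b x K UA ms ls \<in> F (d + bit_weight ls)" if "\<not> m"
    by (rule up[OF Cons.prems, of d]) (use that k in auto)
  have B': "f * uadd b x K UB ms ls \<in> F (d + bit_weight ls + ?k + 1)" if "\<not> m"
    by (rule up[OF Cons.prems, of d]) (use that k in auto)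
  have C': "f * uadd b x K UC ms ls \<in> F (d + ?k + bit_weight ls + 1)" if m
    by (rule up[OF Cons.prems, of "d + ?k + 1"]) (use that k in auto)
  have CA: "f * (x * uadd b x K UC ms ls + x * (1 + b * x) * uadd b x K UA ms ls) \<in> F (d + ?k + bit_weight ls + 2)" if m
    using F_add[OF C[OF that] F_mult_right[OF A[OF that], of "1 + b * x"]]
    by (simp add: algebra_simps)
  have qA: "f * ((1 + b * x)\<^sup>2 * uadd b x K UA ms ls) \<in> F (d + bit_weight ls)" if "\<not> m"
    using F_mult_left[OF A'[OF that], of "(1 + b * x)\<^sup>2"] by (simp only: mult.left_commute)
  have qB: "f * ((1 + b * x) * uadd b x K UB ms ls) \<in> F (d + bit_weight ls + ?k + 1)" if "\<not> m"
    using F_mult_left[OF B'[OF that], of "1 + b * x"] by (simp only: mult.left_commute)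
  have Fle: "g \<in> F c \<Longrightarrow> c' \<le> c \<Longrightarrow> g \<in> F c'" for g c c'
    by (rule F_mono)
  show ?case
  proof (cases s)
    case UA
    then show ?thesis
      by (cases m; cases l) (auto simp: F_zero intro: Fle[OF A'] Fle[OF B'] Fle[OF C'])
  next
    case UB
    then show ?thesis
      by (cases m; cases l)
        (auto simp: F_zero mult.assoc[symmetric] intro: Fle[OF B0] Fle[OF B1] Fle[OF CA[unfolded mult.assoc[symmetric]]])
  next
    case UC
    then show ?thesis
      by (cases m; cases l) (auto simp: F_zero intro: Fle[OF qA] Fle[OF qB] Fle[OF C'])
  qed
qed

lemma addvec_order:
  assumes "length ls = N" "\<And>i. i < k \<Longrightarrow> x i \<in> F 1" "\<And>i. i < k \<Longrightarrow> K i UB \<in> F 1"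
  shows "addvec N (\<lambda>i. uadd b (x i) (K i) UA) k ls \<in> F (bit_weight ls)"
  using assms
proof (induction k arbitrary: ls)
  case 0
  have "bit_weight ls = 0" if "True \<notin> set ls" for ls
    using that by (induction ls) auto
  then show ?case by (auto simp: vac_def F_zero F_0)
next
  case (Suc k)
  show ?case
    unfolding addvec.simps rowact_def
  proof (rule F_sum)
    fix ms assume "ms \<in> bit_lists N"
    then have "length ms = N" by (simp add: bit_lists_def)
    with Suc show "addvec N (\<lambda>i. uadd b (x i) (K i) UA) k ms * uadd b (x k) (K k) UA ms ls \<in> F (bit_weight ls)"
      using uadd_order[of ms ls "x k" "K k" _ 0 b UA] by auto
  qed
qed

text \<open>A part that has grown beyond \<open>N\<close> has cost \<open>N + 1\<close> factors from
  \<open>F 1\<close>, and no operator \<open>M\<close> applied afterwards can lower the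
  order.\<close>

lemma overflow_error:
  assumes v: "\<And>ms. length ms = N \<Longrightarrow> v ms \<in> F (bit_weight ms)" and "x \<in> F 1" "K UB \<in> F 1"
  shows "rowact N v (list_comp (uadd b x K UB) M) ns \<in> F (Suc N)"
  unfolding rowact_def
proof (rule F_sum)
  fix ms assume "ms \<in> bit_lists N"
  then have ms: "length ms = N" by (simp add: bit_lists_def)
  show "v ms * list_comp (uadd b x K UB) M ms ns \<in> F (Suc N)"
    unfolding list_comp_def sum_distrib_left
  proof (rule F_sum)
    fix ls assume "ls \<in> bit_lists (length ms)"
    then have ls: "length ls = N" using ms by (simp add: bit_lists_def)
    have "v ms * uadd b x K UB ms ls \<in> F (bit_weight ls + Suc N)"
      using uadd_order[of ms ls x K "v ms" 0 b UB] assms v ms ls by simp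
    then have "v ms * uadd b x K UB ms ls \<in> F (Suc N)"
      by (rule F_mono[rotated]) simp
    then show "v ms * (uadd b x K UB ms ls * M ls ns) \<in> F (Suc N)"
      using F_mult_right by (simp add: mult.assoc[symmetric])
  qed
qed

text \<open>The one surplus term in the fourth of the \<open>zinv_relations\<close> has a particle
  above site \<open>N\<close>, so it disappears modulo order \<open>N + 1\<close> and a plain
  commutation rule is left.\<close>

lemma rowact_step_zinv:
  fixes b x e :: 'a and K K' :: "ustate \<Rightarrow> 'a"
  defines "q \<equiv> 1 + b * x"
  assumes v: "\<And>ms. length ms = N \<Longrightarrow> v ms \<in> F (bit_weight ms)" and xK: "x \<in> F 1" "K UB \<in> F 1"
    and K: "K' UC = q * K UA" "K' UB = K UB" "K UA = q * K' UA - e * b * K UB"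
      "K UC = K UA + e * b * K' UB" "e * K UC = e * q * K' UA"
    and len: "length ns = N"
  shows "cong N (rowact N (rowact N v (uadd b x K UA)) (vrem 0 b e False) ns)
    (q * rowact N (rowact N v (vrem 0 b e False)) (uadd b x K' UA) ns)"
proof -
  have "rowact N (rowact N v (uadd b x K UA)) (vrem 0 b e False) ns
      - q * rowact N (rowact N v (vrem 0 b e False)) (uadd b x K' UA) ns
      = - b * rowact N v (list_comp (uadd b x K UB) (vrem 0 b e True)) ns"
    unfolding rowact_list_comp[symmetric] unfolding rowact_def sum_distrib_left sum_subtractf[symmetric]
  proof (intro sum.cong refl)
    fix ms assume "ms \<in> bit_lists N"
    then have "length ms = length ns" using len by (simp add: bit_lists_def)
    have "list_comp (uadd b x K UA) (vrem 0 b e False) ms ns =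
      q * list_comp (vrem 0 b e False) (uadd b x K' UA) ms ns - b * list_comp (uadd b x K UB) (vrem 0 b e True) ms ns"
      using zinv_relations[OF \<open>length ms = length ns\<close> K[unfolded q_def]] unfolding q_def by blast
    then show "v ms * list_comp (uadd b x K UA) (vrem 0 b e False) ms ns -
      q * (v ms * list_comp (vrem 0 b e False) (uadd b x K' UA) ms ns) =
      - b * (v ms * list_comp (uadd b x K UB) (vrem 0 b e True) ms ns)"
      by (simp only:) (simp add: algebra_simps)
  qed
  then show ?thesis
    unfolding cong_def by (simp only: F_mult_left overflow_error[of N v x K, OF v xK])
qed

lemma rowact_step_vhrem:
  fixes b x y e :: 'a and K :: "ustate \<Rightarrow> 'a"
  defines "q \<equiv> 1 + b * x" and "z \<equiv> y + b" and "w \<equiv> 1 + b * x + x * y" and "u \<equiv> 1 - x * y"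
  assumes v: "\<And>ms. length ms = N \<Longrightarrow> v ms \<in> F (bit_weight ms)" and xK: "x \<in> F 1" "K UB \<in> F 1"
    and K: "w * K UA = u * (q * K UA - b * K UB) + z * K UB + y * e * K UB"
      "e * K UC = q * (K UA + q * e * K UA - K UC)"
      "K UC = q * (q * K UA - b * K UB)"
      "u * K UA + z * e * K UB + y * K UB = w * (q * K UA - b * K UB)"
      "K UC = K UA + b * e * K UB"
    and len: "length ns = N"
  shows "cong N (u * rowact N (rowact N v (uadd b x K UA)) (vhrem y z e RP) ns)
    (w * q * rowact N (rowact N v (vhrem y z e RP)) (uadd b x K UA) ns)"
proof -
  let ?E = "\<lambda>r. rowact N v (list_comp (uadd b x K UB) (vhrem y z e r)) ns"
  \<comment> \<open>The sixth of the \<open>vhrem_relations\<close>, solved for its first term; both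
    \<open>w * b\<close> and \<open>y\<close> are coefficients of the overflow term with
    \<open>RQ\<close>.\<close>
  have *: "u * (v ms * list_comp (uadd b x K UA) (vhrem y z e RP) ms ns) =
      w * q * (v ms * list_comp (vhrem y z e RP) (uadd b x K UA) ms ns)
      - (w * b + y) * (v ms * list_comp (uadd b x K UB) (vhrem y z e RQ) ms ns)
      - z * (v ms * list_comp (uadd b x K UB) (vhrem y z e RR) ms ns)" if "ms \<in> bit_lists N" for ms
  proof -
    have "length ms = length ns" using that len by (simp add: bit_lists_def)
    have "u * list_comp (uadd b x K UA) (vhrem y z e RP) ms ns + z * list_comp (uadd b x K UB) (vhrem y z e RR) ms ns
      + y * list_comp (uadd b x K UB) (vhrem y z e RQ) ms ns = w * (q * list_comp (vhrem y z e RP) (uadd b x K UA) ms ns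
      - b * list_comp (uadd b x K UB) (vhrem y z e RQ) ms ns)"
      using vhrem_relations[OF \<open>length ms = length ns\<close> K[unfolded q_def z_def w_def u_def]]
      unfolding q_def z_def w_def u_def by blast
    then have "u * list_comp (uadd b x K UA) (vhrem y z e RP) ms ns =
      w * (q * list_comp (vhrem y z e RP) (uadd b x K UA) ms ns - b * list_comp (uadd b x K UB) (vhrem y z e RQ) ms ns)
      - z * list_comp (uadd b x K UB) (vhrem y z e RR) ms ns - y * list_comp (uadd b x K UB) (vhrem y z e RQ) ms ns"
      by (simp add: algebra_simps)
    then have "v ms * (u * list_comp (uadd b x K UA) (vhrem y z e RP) ms ns) = v ms * (
      w * (q * list_comp (vhrem y z e RP) (uadd b x K UA) ms ns - b * list_comp (uadd b x K UB) (vhrem y z e RQ) ms ns)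
      - z * list_comp (uadd b x K UB) (vhrem y z e RR) ms ns - y * list_comp (uadd b x K UB) (vhrem y z e RQ) ms ns)"
      by simp
    then show ?thesis by (simp add: algebra_simps)
  qed
  have "u * rowact N (rowact N v (uadd b x K UA)) (vhrem y z e RP) ns
      = w * q * rowact N (rowact N v (vhrem y z e RP)) (uadd b x K UA) ns
      - (w * b + y) * ?E RQ - z * ?E RR"
    unfolding rowact_list_comp[symmetric] unfolding rowact_def sum_distrib_left sum_subtractf[symmetric]
    by (rule sum.cong[OF refl *])
  then have "u * rowact N (rowact N v (uadd b x K UA)) (vhrem y z e RP) ns
      - w * q * rowact N (rowact N v (vhrem y z e RP)) (uadd b x K UA) ns
      = - (w * b + y) * ?E RQ + - z * ?E RR"
    by (simp add: algebra_simps)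
  then show ?thesis
    unfolding cong_def by (simp only: F_add F_mult_left overflow_error[of N v x K, OF v xK])
qed


end

text \<open>Weights of the diagonal. In \<open>KQ\<close> a new diagonal box carries
  \<open>x\<close> if the unprimed strip adds it and \<open>x (1 + b x)\<close> if the primed strip
  does, since it may then receive the unprimed letter as well; a corner on the diagonal may receive
  either letter. \<open>KP\<close> keeps the unprimed strip only.\<close>

definition KP :: "'a::comm_ring_1 \<Rightarrow> 'a \<Rightarrow> ustate \<Rightarrow> 'a" where
  "KP b x s = (case s of UA \<Rightarrow> 1 | UB \<Rightarrow> x | UC \<Rightarrow> 1 + b * x)"

definition KQ :: "'a::comm_ring_1 \<Rightarrow> 'a \<Rightarrow> ustate \<Rightarrow> 'a" where
  "KQ b x s = (case s of UA \<Rightarrow> 1 | UB \<Rightarrow> 2 * x + b * x\<^sup>2 | UC \<Rightarrow> (1 + b * x)\<^sup>2)"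

text \<open>\<open>KM\<close> is \<open>KQ\<close> transported through the removal of corners (see \<open>uvec_zinv\<close>); it is needed because, unlike
  \<open>KP\<close>, \<open>KQ\<close> is not preserved by it.\<close>

definition KM :: "'a::comm_ring_1 \<Rightarrow> 'a \<Rightarrow> ustate \<Rightarrow> 'a" where
  "KM b x s = (case s of UA \<Rightarrow> 1 + b * x | UB \<Rightarrow> 2 * x + b * x\<^sup>2 | UC \<Rightarrow> 1 + b * x)"

definition uvec :: "nat \<Rightarrow> ('a::comm_ring_1 \<Rightarrow> 'a \<Rightarrow> ustate \<Rightarrow> 'a) \<Rightarrow> 'a \<Rightarrow> (nat \<Rightarrow> 'a) \<Rightarrow> nat \<Rightarrow> bool list \<Rightarrow> 'a" where
  "uvec N K b x = addvec N (\<lambda>i. uadd b (x i) (K b (x i)) UA)"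

lemma uvec_0: "uvec N K b x 0 = vac"
  and uvec_Suc: "uvec N K b x (Suc k) = rowact N (uvec N K b x k) (uadd b (x k) (K b (x k)) UA)"
  by (simp_all add: uvec_def)

text \<open>Only unprimed letters can be barred from the diagonal, so \<open>e\<close> enters the
  column factor and the row factor has boundary weight \<open>1\<close>.\<close>

definition drem :: "'a::comm_ring_1 \<Rightarrow> 'a \<Rightarrow> 'a \<Rightarrow> bool list \<Rightarrow> bool list \<Rightarrow> 'a" where
  "drem e y t = list_comp (crem y t e 0) (rrem y t 1 0)"

primrec dvec :: "nat \<Rightarrow> 'a::comm_ring_1 \<Rightarrow> 'a \<Rightarrow> (nat \<Rightarrow> 'a) \<Rightarrow> nat \<Rightarrow> bool list \<Rightarrow> 'a" where
  "dvec N e t y 0 = vac"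
| "dvec N e t y (Suc k) = (\<lambda>ls. \<Sum>ns\<in>bit_lists N. drem e (y k) t ls ns * dvec N e t y k ns)"

lemma uadd_UA_vac:
  assumes "length ms = length ls" "True \<notin> set ls"
  shows "uadd b x K UA ms ls = K UA * vac ms"
  using assms by (induction ms ls rule: list_induct2) (auto simp: vac_def)

lemma uvec_vac:
  assumes "K = KP \<or> K = KQ" "length ls = N" "True \<notin> set ls"
  shows "uvec N K b x k ls = 1"
proof (induction k)
  case 0
  then show ?case using assms by (simp add: uvec_0 vac_def)
next
  case (Suc k)
  have "ls = replicate N False"
    using assms replicate_eqI[of ls N False] by force
  have "uvec N K b x (Suc k) ls = (\<Sum>ms\<in>bit_lists N. if ms = ls then 1 else 0)"
    unfolding uvec_Suc rowact_def
  proof (rule sum.cong[OF refl])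
    fix ms assume "ms \<in> bit_lists N"
    then have ms: "length ms = N" by (simp add: bit_lists_def)
    have v: "(vac ms :: 'a) = (if ms = ls then 1 else 0)"
    proof (cases "True \<in> set ms")
      case False
      then have "ms = replicate N False" using ms replicate_eqI[of ms N False] by force
      then show ?thesis using False \<open>ls = _\<close> by (simp add: vac_def)
    qed (use assms in \<open>auto simp: vac_def\<close>)
    show "uvec N K b x k ms * uadd b (x k) (K b (x k)) UA ms ls = (if ms = ls then 1 else 0)"
      using uadd_UA_vac[of ms ls b "x k" "K b (x k)"] assms ms Suc v by (auto simp: KP_def KQ_def)
  qed
  also have "\<dots> = 1" using assms by (simp add: bit_lists_def[of N, symmetric] sum.delta') (simp add: bit_lists_def)
  finally show ?case .
qed

context filtered_ring
begin

lemma uvec_order: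
  assumes "length ls = N" "\<And>i. x i \<in> F 1" "K = KP \<or> K = KQ \<or> K = KM"
  shows "uvec N K b x k ls \<in> F (bit_weight ls)"
proof -
  have "2 * z + b * z\<^sup>2 \<in> F 1" if "z \<in> F 1" for z
    using F_mult_left[OF that, of "2 + b * z"] by (simp add: algebra_simps power2_eq_square)
  then show ?thesis
    unfolding uvec_def using assms
    by (intro addvec_order) (auto simp: KP_def KQ_def KM_def)
qed

text \<open>Origin of \<open>KM\<close>: for \<open>KQ\<close> and \<open>e = 1\<close> the
  condition on \<open>UA\<close> reads \<open>q * K' UA = 1 + b (2 x + b x\<^sup>2)\<close>; the
  right side is \<open>q\<^sup>2\<close>, so \<open>K' UA = q\<close> solves it. With
  \<open>e = 0\<close> the conditions lead from \<open>KM\<close> back to \<open>KQ\<close>, and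
  \<open>KP\<close> with \<open>e = 1\<close> is preserved.\<close>

lemma uvec_zinv:
  fixes K K' :: "'a \<Rightarrow> 'a \<Rightarrow> ustate \<Rightarrow> 'a" and b e :: 'a
  assumes x: "\<And>i. x i \<in> F 1" and len: "length ns = N"
    and K: "(e, K, K') = (1, KP, KP) \<or> (e, K, K') = (1, KQ, KM) \<or> (e, K, K') = (0, KM, KQ)"
  shows "cong N (rowact N (uvec N K b x k) (vrem 0 b e False) ns)
    ((\<Prod>i<k. 1 + b * x i) * uvec N K' b x k ns)"
  using len
proof (induction k arbitrary: ns)
  case 0
  then show ?case by (simp add: uvec_0 vac_rowact vrem_vac)
next
  case (Suc k)
  let ?q = "1 + b * x k"
  have KUB: "K b (x k) UB \<in> F 1"
    using K x[of k] F_mult_left[OF x, of "2 + b * x k" k]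
    by (auto simp: KP_def KQ_def KM_def algebra_simps power2_eq_square)
  have v: "\<And>ms. length ms = N \<Longrightarrow> uvec N K b x k ms \<in> F (bit_weight ms)"
    using uvec_order x K by auto
  have "cong N (rowact N (rowact N (uvec N K b x k) (uadd b (x k) (K b (x k)) UA)) (vrem 0 b e False) ns)
      (?q * rowact N (rowact N (uvec N K b x k) (vrem 0 b e False)) (uadd b (x k) (K' b (x k)) UA) ns)"
    by (rule rowact_step_zinv[of N "uvec N K b x k" "x k" "K b (x k)", OF v x KUB _ _ _ _ _ Suc.prems])
      (use K in \<open>auto simp: KP_def KQ_def KM_def power2_eq_square algebra_simps\<close>)
  also have "cong N (?q * rowact N (rowact N (uvec N K b x k) (vrem 0 b e False)) (uadd b (x k) (K' b (x k)) UA) ns)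
      (?q * rowact N (\<lambda>ls. (\<Prod>i<k. 1 + b * x i) * uvec N K' b x k ls) (uadd b (x k) (K' b (x k)) UA) ns)"
    by (intro cong_mult_left rowact_cong_mod Suc.IH)
  finally show ?case
    unfolding rowact_scale by (simp add: uvec_Suc mult_ac)
qed

text \<open>Here the boundary weight does not change: \<open>KP\<close> is kept for
  \<open>e = 1\<close> and \<open>KM\<close> for \<open>e = 0\<close>. The denominator stays on the
  left because \<open>1 - x y\<close> need not be invertible in a filtered ring.\<close>

lemma uvec_vhrem:
  fixes K :: "'a \<Rightarrow> 'a \<Rightarrow> ustate \<Rightarrow> 'a" and b e y :: 'a
  assumes x: "\<And>i. x i \<in> F 1" and len: "length ns = N"
    and K: "(e, K) = (1, KP) \<or> (e, K) = (0, KM)"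
  shows "cong N ((\<Prod>i<k. 1 - x i * y) * rowact N (uvec N K b x k) (vhrem y (y + b) e RP) ns)
    ((\<Prod>i<k. (1 + b * x i + x i * y) * (1 + b * x i)) * uvec N K b x k ns)"
  using len
proof (induction k arbitrary: ns)
  case 0
  then show ?case by (simp add: uvec_0 vac_rowact vhrem_vac)
next
  case (Suc k)
  let ?u = "1 - x k * y" and ?wq = "(1 + b * x k + x k * y) * (1 + b * x k)"
  let ?U = "\<Prod>i<k. 1 - x i * y" and ?WQ = "\<Prod>i<k. (1 + b * x i + x i * y) * (1 + b * x i)"
  let ?A = "uadd b (x k) (K b (x k)) UA" and ?S = "vhrem y (y + b) e RP" and ?v = "uvec N K b x k"
  have KUB: "K b (x k) UB \<in> F 1"
    using K x[of k] F_mult_left[OF x, of "2 + b * x k" k]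
    by (auto simp: KP_def KQ_def KM_def algebra_simps power2_eq_square)
  have v: "\<And>ms. length ms = N \<Longrightarrow> ?v ms \<in> F (bit_weight ms)"
    using uvec_order x K by auto
  have "cong N (?u * rowact N (rowact N ?v ?A) ?S ns) (?wq * rowact N (rowact N ?v ?S) ?A ns)"
    by (rule rowact_step_vhrem[of N "uvec N K b x k" "x k" "K b (x k)", OF v x KUB _ _ _ _ _ Suc.prems])
      (use K in \<open>auto simp: KP_def KQ_def KM_def power2_eq_square algebra_simps\<close>)
  then have "cong N (?U * (?u * rowact N (rowact N ?v ?A) ?S ns)) (?U * (?wq * rowact N (rowact N ?v ?S) ?A ns))"
    by (rule cong_mult_left)
  also have "?U * (?wq * rowact N (rowact N ?v ?S) ?A ns) = ?wq * rowact N (\<lambda>ls. ?U * rowact N ?v ?S ls) ?A ns"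
    unfolding rowact_scale by (simp add: mult_ac)
  also have "cong N \<dots> (?wq * rowact N (\<lambda>ls. ?WQ * ?v ls) ?A ns)"
    by (intro cong_mult_left rowact_cong_mod Suc.IH)
  finally show ?case
    unfolding rowact_scale by (simp add: uvec_Suc mult_ac)
qed

text \<open>The weight \<open>K\<close> becomes \<open>K'\<close> through \<open>zrem\<close> with
  parameter \<open>e\<close>, is kept by \<open>vhrem\<close>, and returns to \<open>K\<close>
  through \<open>zrem\<close> with parameter \<open>1\<close>. If \<open>c\<close>,
  \<open>u\<close>, \<open>w\<close> are the products of \<open>1 + b x\<close>,
  \<open>1 - x y\<close>, \<open>1 + b x + x y\<close>, the three passages contribute
  \<open>1 / c\<close>, \<open>w c / u\<close> and \<open>1 / c\<close>.\<close>

lemma uvec_drem: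
  fixes K K' :: "'a \<Rightarrow> 'a \<Rightarrow> ustate \<Rightarrow> 'a" and b e y :: 'a
  assumes x: "\<And>i. x i \<in> F 1" and len: "length ns = N"
    and K: "(e, K, K') = (1, KP, KP) \<or> (e, K, K') = (0, KQ, KM)"
    and qi: "\<And>i. (1 + b * x i) * qi i = 1"
  shows "cong N ((\<Prod>i<k. (1 - x i * y) * (1 + b * x i)) * rowact N (uvec N K b x k) (drem e y (- b)) ns)
    ((\<Prod>i<k. 1 + b * x i + x i * y) * uvec N K b x k ns)"
proof -
  let ?v = "uvec N K b x k" and ?v' = "uvec N K' b x k"
  define c u w where "c = (\<Prod>i<k. 1 + b * x i)" and "u = (\<Prod>i<k. 1 - x i * y)" and "w = (\<Prod>i<k. 1 + b * x i + x i * y)"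
  have cwq: "(\<Prod>i<k. (1 + b * x i + x i * y) * (1 + b * x i)) = w * c"
    by (simp add: c_def w_def prod.distrib)
  let ?Z = "\<lambda>e. zrem (- b) e 0" and ?H = "hrem y (y + b) e False" and ?V = "vrem y (y + b) 1 False"
  let ?S = "vhrem y (y + b) e RP"
  \<comment> \<open>Multiplication by \<open>zrem\<close> on the right turns a statement about the
    removal of corners into one about its inverse; this is where Moebius inversion enters.\<close>
  have undo: "cong N (c * rowact N v2 (?Z e') ls) (v1 ls)"
    if "\<And>ls. length ls = N \<Longrightarrow> cong N (rowact N v1 (vrem 0 b e' False) ls) (c * v2 ls)" "length ls = N" for v1 v2 e' ls
  proof -
    have "cong N (rowact N (rowact N v1 (vrem 0 b e' False)) (?Z e') ls) (rowact N (\<lambda>ls. c * v2 ls) (?Z e') ls)"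
      by (rule rowact_cong_mod) (rule that)
    also have "rowact N (rowact N v1 (vrem 0 b e' False)) (?Z e') ls = rowact N v1 (\<lambda>l n. if l = n then 1 else 0) ls"
      unfolding rowact_list_comp[symmetric]
      by (rule rowact_cong) (use rrem_eq_list_comp[of _ ls 0 "- b" e' 0] rrem_zero[of _ ls "- b" e'] that in auto)
    also have "\<dots> = v1 ls"
    proof -
      have "rowact N v1 (\<lambda>l n. if l = n then 1 else 0) ls = (\<Sum>l\<in>bit_lists N. if ls = l then v1 l else 0)"
        unfolding rowact_def by (rule sum.cong) auto
      then show ?thesis using that by (simp add: bit_lists_def[of N, symmetric] sum.delta') (simp add: bit_lists_def)
    qed
    finally show ?thesis by (simp add: rowact_scale cong_sym)
  qed
  \<comment> \<open>\<open>uvec_zinv\<close> is used from \<open>K'\<close> to \<open>K\<close>, so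
    that its inverse leads from \<open>K\<close> to \<open>K'\<close>.\<close>
  have 1: "cong N (c * rowact N ?v (?Z e) ls) (?v' ls)" if "length ls = N" for ls
    by (rule undo) (use uvec_zinv[where K = K' and K' = K and e = e and b = b and k = k and x = x, OF x] K that in \<open>auto simp: c_def\<close>)
  have 2: "cong N (c * rowact N ?v' (?Z 1) ls) (?v ls)" if "length ls = N" for ls
    by (rule undo) (use uvec_zinv[where K = K and K' = K' and e = 1 and b = b and k = k and x = x, OF x] K that in \<open>auto simp: c_def\<close>)
  have 3: "cong N (u * rowact N ?v' ?S ls) (w * c * ?v' ls)" if "length ls = N" for ls
    using uvec_vhrem[where e = e and K = K' and k = k and y = y and b = b and x = x, OF x that] K cwq by (auto simp: u_def)
  have D: "rowact N ?v (drem e y (- b)) ns = rowact N (rowact N (rowact N ?v (?Z e)) ?S) (?Z 1) ns"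
  proof -
    have "rowact N ?v (drem e y (- b)) ns = rowact N (rowact N ?v (crem y (- b) e 0)) (rrem y (- b) 1 0) ns"
      by (simp add: drem_def rowact_list_comp)
    also have "\<dots> = rowact N (rowact N ?v (list_comp (?Z e) ?H)) (list_comp ?V (?Z 1)) ns"
      by (intro rowact_cong) (use len crem_eq_list_comp[of _ _ "- b" e 0 y] rrem_eq_list_comp[of _ ns y "- b" 1 0] in auto)
    also have "\<dots> = rowact N (rowact N (rowact N ?v (?Z e)) (list_comp ?H ?V)) (?Z 1) ns"
      by (simp add: rowact_list_comp[abs_def])
    also have "\<dots> = rowact N (rowact N (rowact N ?v (?Z e)) ?S) (?Z 1) ns"
      by (intro rowact_cong) (auto dest!: conjunct1[OF vhrem_eq_list_comp] simp: vhrem_eq_list_comp)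
    finally show ?thesis .
  qed
  let ?R = "\<lambda>v. rowact N (rowact N v ?S) (?Z 1) ns"
  have "cong N (c * c * u * ?R (rowact N ?v (?Z e))) (c * u * ?R ?v')"
  proof -
    have "cong N (?R (\<lambda>ls. c * rowact N ?v (?Z e) ls)) (?R ?v')"
      by (intro rowact_cong_mod 1)
    from cong_mult_left[OF this, of "c * u"] show ?thesis
      unfolding rowact_scale[abs_def] by (simp add: mult_ac)
  qed
  also have "cong N (c * u * ?R ?v') (c * (w * c) * rowact N ?v' (?Z 1) ns)"
  proof -
    have "cong N (rowact N (\<lambda>ls. u * rowact N ?v' ?S ls) (?Z 1) ns) (rowact N (\<lambda>ls. w * c * ?v' ls) (?Z 1) ns)"
      by (intro rowact_cong_mod 3)
    from cong_mult_left[OF this, of c] show ?thesis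
      unfolding rowact_scale[abs_def] by (simp add: mult_ac)
  qed
  also have "cong N (c * (w * c) * rowact N ?v' (?Z 1) ns) (w * c * ?v ns)"
    using cong_mult_left[OF 2[OF len], of "w * c"] by (simp add: mult_ac)
  finally have *: "cong N (c * c * u * rowact N ?v (drem e y (- b)) ns) (w * c * ?v ns)"
    by (simp add: D)
  have ci: "c * (\<Prod>i<k. qi i) = 1"
    by (simp add: c_def prod.distrib[symmetric] qi)
  have "c * c * u * g * (\<Prod>i<k. qi i) = u * c * g" "w * c * g * (\<Prod>i<k. qi i) = w * g" for g
    using ci by (metis mult.assoc mult.commute mult.right_neutral)+
  with cong_mult_right[OF *, of "\<Prod>i<k. qi i"]
  have "cong N (u * c * rowact N ?v (drem e y (- b)) ns) (w * ?v ns)" by simp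
  then show ?thesis by (simp add: u_def c_def w_def prod.distrib)
qed

text \<open>The row vector is an eigenvector of each \<open>drem\<close> modulo order
  \<open>N + 1\<close>, so the variables \<open>y j\<close> can be split off one at a time. What is
  left pairs \<open>uvec\<close> with the empty configuration and equals \<open>1\<close>.\<close>

theorem truncated_cauchy:
  fixes K :: "'a \<Rightarrow> 'a \<Rightarrow> ustate \<Rightarrow> 'a" and b e :: 'a
  assumes x: "\<And>i. x i \<in> F 1"
    and K: "(e, K) = (1, KP) \<or> (e, K) = (0, KQ)"
    and qi: "\<And>i. (1 + b * x i) * qi i = 1"
  shows "cong N ((\<Prod>j<l. \<Prod>i<k. (1 - x i * y j) * (1 + b * x i)) *
      (\<Sum>ls\<in>bit_lists N. uvec N K b x k ls * dvec N e (- b) y l ls))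
    (\<Prod>j<l. \<Prod>i<k. 1 + b * x i + x i * y j)"
proof (induction l)
  case 0
  have "(\<Sum>ls\<in>bit_lists N. uvec N K b x k ls * vac ls) = (\<Sum>ls\<in>{replicate N False}. uvec N K b x k ls * vac ls)"
  proof (rule sum.mono_neutral_right)
    show "\<forall>i\<in>bit_lists N - {replicate N False}. uvec N K b x k i * vac i = 0"
      using replicate_eqI[of _ N False] by (force simp: bit_lists_def vac_def)
  qed (simp, simp add: bit_lists_def)
  also have "\<dots> = 1" using uvec_vac[of K "replicate N False" N] K by (auto simp: vac_def)
  finally show ?case by simp
next
  case (Suc l)
  let ?v = "uvec N K b x k" and ?d = "dvec N e (- b) y l"
  let ?P = "\<Prod>i<k. (1 - x i * y l) * (1 + b * x i)" and ?W = "\<Prod>i<k. 1 + b * x i + x i * y l"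
  let ?PP = "\<Prod>j<l. \<Prod>i<k. (1 - x i * y j) * (1 + b * x i)"
  have "(\<Sum>ls\<in>bit_lists N. ?v ls * dvec N e (- b) y (Suc l) ls)
      = (\<Sum>ls\<in>bit_lists N. \<Sum>ns\<in>bit_lists N. ?v ls * drem e (y l) (- b) ls ns * ?d ns)"
    by (simp add: sum_distrib_left mult.assoc)
  also have "\<dots> = (\<Sum>ns\<in>bit_lists N. \<Sum>ls\<in>bit_lists N. ?v ls * drem e (y l) (- b) ls ns * ?d ns)"
    by (rule sum.swap)
  also have "\<dots> = (\<Sum>ns\<in>bit_lists N. rowact N ?v (drem e (y l) (- b)) ns * ?d ns)"
    by (simp add: rowact_def sum_distrib_right)
  finally have eq: "(\<Sum>ls\<in>bit_lists N. ?v ls * dvec N e (- b) y (Suc l) ls)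
      = (\<Sum>ns\<in>bit_lists N. rowact N ?v (drem e (y l) (- b)) ns * ?d ns)" .
  have "cong N (?PP * (\<Sum>ns\<in>bit_lists N. ?P * rowact N ?v (drem e (y l) (- b)) ns * ?d ns))
      (?PP * (\<Sum>ns\<in>bit_lists N. ?W * ?v ns * ?d ns))"
  proof (intro cong_mult_left cong_sum cong_mult_right)
    fix ns assume "ns \<in> bit_lists N"
    then have "length ns = N" by (simp add: bit_lists_def)
    then show "cong N (?P * rowact N ?v (drem e (y l) (- b)) ns) (?W * ?v ns)"
      using uvec_drem[where e = e and K = K and K' = KP and x = x and qi = qi, OF x _ _ qi] uvec_drem[where e = e and K = K and K' = KM and x = x and qi = qi, OF x _ _ qi] K by auto
  qed
  also have "?PP * (\<Sum>ns\<in>bit_lists N. ?W * ?v ns * ?d ns) = ?W * (?PP * (\<Sum>ns\<in>bit_lists N. ?v ns * ?d ns))"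
    unfolding mult.assoc[of ?W] sum_distrib_left[symmetric] by (rule mult.left_commute)
  also have "cong N \<dots> (?W * (\<Prod>j<l. \<Prod>i<k. 1 + b * x i + x i * y j))"
    by (rule cong_mult_left[OF Suc.IH])
  finally have "cong N (?PP * (?P * (\<Sum>ns\<in>bit_lists N. rowact N ?v (drem e (y l) (- b)) ns * ?d ns)))
      (?W * (\<Prod>j<l. \<Prod>i<k. 1 + b * x i + x i * y j))"
    unfolding mult.assoc[of ?P] sum_distrib_left[symmetric] .
  then show ?case
    unfolding eq by (simp add: mult_ac)
qed

end

section \<open>Strict partitions as bit lists\<close>

definition pset :: "strict_partition \<Rightarrow> nat set" where
  "pset lam = set (parts lam)"

text \<open>Equally the number of boxes of content \<open>j\<close>, which are
  \<open>(i, i + j)\<close> for \<open>1 \<le> i \<le> cnt lam j\<close>: the particles above site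
  \<open>j\<close> count the boxes on a diagonal.\<close>

definition cnt :: "strict_partition \<Rightarrow> nat \<Rightarrow> nat" where
  "cnt lam j = card {p \<in> pset lam. j < p}"

abbreviation SD :: "strict_partition \<Rightarrow> (nat \<times> nat) set" where
  "SD \<equiv> shifted_diagram"

lemma parts_strict: "sorted_wrt (>) (parts lam)" "0 \<notin> set (parts lam)"
  using parts[of lam] by auto

lemma finite_pset [simp]: "finite (pset lam)"
  and pset_pos: "p \<in> pset lam \<Longrightarrow> 0 < p"
  using parts_strict(2)[of lam] by (auto simp: pset_def intro: Nat.gr0I)

lemma pset_inject: "pset lam = pset mu \<Longrightarrow> lam = mu"
proof -
  assume "pset lam = pset mu"
  moreover have "sorted_wrt (<) (rev (parts nu))" for nu
    using parts_strict(1)[of nu] by (simp add: sorted_wrt_rev)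
  ultimately have "rev (parts lam) = rev (parts mu)"
    by (metis pset_def set_rev strict_sorted_equal)
  then show "lam = mu" by (simp add: parts_inject)
qed

definition partition_of :: "nat set \<Rightarrow> strict_partition" where
  "partition_of P = Abs_strict_partition (rev (sorted_list_of_set P))"

lemma pset_partition_of: "finite P \<Longrightarrow> 0 \<notin> P \<Longrightarrow> pset (partition_of P) = P"
  unfolding pset_def partition_of_def
  by (subst Abs_strict_partition_inverse)
    (auto simp: sorted_wrt_rev strict_sorted_list_of_set)

lemma cnt_step: "cnt lam j = cnt lam (Suc j) + of_bool (Suc j \<in> pset lam)"
proof -
  have "{p \<in> pset lam. j < p} = {p \<in> pset lam. Suc j < p} \<union> (if Suc j \<in> pset lam then {Suc j} else {})"
    by (auto intro!: Suc_lessI)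
  then show ?thesis by (auto simp: cnt_def)
qed

lemma cnt_antimono: "i \<le> j \<Longrightarrow> cnt lam j \<le> cnt lam i"
proof (induction j rule: dec_induct)
  case (step n)
  then show ?case using cnt_step[of lam n] by linarith
qed simp

lemma cnt_0 [simp]: "(\<And>p. p \<in> pset lam \<Longrightarrow> p \<le> n) \<Longrightarrow> n \<le> j \<Longrightarrow> cnt lam j = 0"
  by (force simp: cnt_def)

lemma nth_gt_iff:
  fixes l :: "nat list"
  assumes "sorted_wrt (>) l"
  shows "i < card {p \<in> set l. j < p} \<longleftrightarrow> i < length l \<and> j < l ! i"
  using assms
proof (induction l arbitrary: i)
  case (Cons a l)
  have fin: "finite {p \<in> set l. j < p}" by simp
  have a: "a \<notin> set l" using Cons.prems by auto
  show ?case
  proof (cases "j < a")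
    case True
    then have "{p \<in> set (a # l). j < p} = insert a {p \<in> set l. j < p}" by auto
    then have "card {p \<in> set (a # l). j < p} = Suc (card {p \<in> set l. j < p})"
      using a by simp
    then show ?thesis using Cons True by (cases i) auto
  next
    case False
    then have "{p \<in> set (a # l). j < p} = {}" using Cons.prems by auto
    moreover have "\<not> j < (a # l) ! i" if "i < length (a # l)"
      using False Cons.prems that by (cases i) (auto dest!: nth_mem bspec)
    ultimately show ?thesis by (metis card.empty less_nat_zero_code)
  qed
qed simp

lemma in_SD: "(i, k) \<in> SD lam \<longleftrightarrow> 1 \<le> i \<and> i \<le> k \<and> i \<le> cnt lam (k - i)"
proof -
  have *: "i \<le> cnt lam c \<longleftrightarrow> i - 1 < length (parts lam) \<and> c < parts lam ! (i - 1)" if "1 \<le> i" for c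
    using nth_gt_iff[OF parts_strict(1), of "i - 1" lam c] that by (auto simp: cnt_def pset_def)
  show ?thesis
  proof
    assume "(i, k) \<in> SD lam"
    then obtain j where "k = i + j - 1" "1 \<le> i" "i \<le> length (parts lam)" "1 \<le> j" "j \<le> parts lam ! (i - 1)"
      by (auto simp: shifted_diagram_def)
    then show "1 \<le> i \<and> i \<le> k \<and> i \<le> cnt lam (k - i)" using *[of "k - i"] by auto
  next
    assume a: "1 \<le> i \<and> i \<le> k \<and> i \<le> cnt lam (k - i)"
    then have "i - 1 < length (parts lam)" "k - i < parts lam ! (i - 1)" using *[of "k - i"] by auto
    with a show "(i, k) \<in> SD lam"
      by (auto simp: shifted_diagram_def intro!: exI[of _ "k - i + 1"])
  qed
qed

lemma in_SD_content: "(i, i + c) \<in> SD lam \<longleftrightarrow> 1 \<le> i \<and> i \<le> cnt lam c"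
  by (simp add: in_SD)

text \<open>The parts are distinct, so consecutive diagonals differ in length by at most
  one.\<close>

lemma SD_up: "(Suc i, k) \<in> SD lam \<Longrightarrow> 1 \<le> i \<Longrightarrow> (i, k) \<in> SD lam"
proof -
  assume a: "(Suc i, k) \<in> SD lam" "1 \<le> i"
  then have "Suc i \<le> k" "Suc i \<le> cnt lam (k - Suc i)" by (auto simp: in_SD)
  moreover have "k - i = Suc (k - Suc i)" using \<open>Suc i \<le> k\<close> by simp
  then have "cnt lam (k - Suc i) \<le> Suc (cnt lam (k - i))" using cnt_step[of lam "k - Suc i"] by simp
  ultimately show "(i, k) \<in> SD lam" using a by (simp add: in_SD)
qed

lemma SD_left: "(i, Suc k) \<in> SD lam \<Longrightarrow> i \<le> k \<Longrightarrow> (i, k) \<in> SD lam"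
  using cnt_antimono[of "k - i" "Suc k - i" lam] by (auto simp: in_SD diff_le_mono)

lemma SD_bounds: "(i, k) \<in> SD lam \<Longrightarrow> 1 \<le> i \<and> i \<le> k"
  by (simp add: in_SD)

lemma finite_SD [simp]: "finite (SD lam)"
proof -
  obtain n where n: "\<And>p. p \<in> pset lam \<Longrightarrow> p \<le> n"
    using finite_pset[of lam] finite_nat_set_iff_bounded_le by auto
  have "i \<le> cnt lam 0" "k \<le> cnt lam 0 + n" if "(i, k) \<in> SD lam" for i k
  proof -
    show "i \<le> cnt lam 0" using that cnt_antimono[of 0 "k - i" lam] by (auto simp: in_SD)
    moreover have "k - i < n" using that cnt_0[OF n, of lam "k - i"] by (force simp: in_SD)
    ultimately show "k \<le> cnt lam 0 + n" by simp
  qed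
  then have "SD lam \<subseteq> {..cnt lam 0} \<times> {..cnt lam 0 + n}" by auto
  then show ?thesis by (rule finite_subset) simp
qed

lemma SD_inject: "SD lam = SD mu \<Longrightarrow> lam = mu"
proof -
  assume eq: "SD lam = SD mu"
  have c: "cnt lam c = cnt mu c" for c
  proof -
    have "i \<le> cnt lam c \<longleftrightarrow> i \<le> cnt mu c" if "1 \<le> i" for i
      using eq in_SD_content[of i c lam] in_SD_content[of i c mu] that by simp
    from this[of "cnt lam c"] this[of "cnt mu c"] show ?thesis
      by (cases "cnt lam c"; cases "cnt mu c") auto
  qed
  have "pset lam = pset mu"
  proof (rule set_eqI)
    fix p
    show "p \<in> pset lam \<longleftrightarrow> p \<in> pset mu"
    proof (cases p)
      case 0
      then show ?thesis using pset_pos by blast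
    next
      case (Suc j)
      then show ?thesis using cnt_step[of lam j] cnt_step[of mu j] c by (auto split: if_splits simp: of_bool_def)
    qed
  qed
  then show "lam = mu" by (rule pset_inject)
qed

text \<open>The diagonals of \<open>D\<close> have lengths \<open>N c\<close> that weakly decrease,
  drop by at most one at a time and end in \<open>0\<close>. Such a sequence is \<open>cnt\<close>
  of the set of places where it drops.\<close>

lemma ideal_is_SD:
  assumes fin: "finite D" and pos: "\<And>i k. (i, k) \<in> D \<Longrightarrow> 1 \<le> i \<and> i \<le> k"
    and up: "\<And>i k. (Suc i, k) \<in> D \<Longrightarrow> 1 \<le> i \<Longrightarrow> (i, k) \<in> D"
    and left: "\<And>i k. (i, Suc k) \<in> D \<Longrightarrow> i \<le> k \<Longrightarrow> (i, k) \<in> D"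
  shows "\<exists>lam. SD lam = D"
proof -
  define N where "N c = card {i. (i, i + c) \<in> D}" for c
  have finc: "finite {i. (i, i + c) \<in> D}" for c
    by (rule finite_subset[OF _ finite_imageI[OF fin, of fst]]) force
  have diag: "(i, i + c) \<in> D" if "(Suc i, Suc i + c) \<in> D" "1 \<le> i" for i c
    using left[of i "i + c"] up[of i "Suc i + c"] that by simp
  have down: "(i', i' + c) \<in> D" if "(i, i + c) \<in> D" "1 \<le> i'" "i' \<le> i" for i i' c
    using that(3,1,2) by (induction i rule: dec_induct) (use diag in auto)
  have inN: "(i, i + c) \<in> D \<longleftrightarrow> 1 \<le> i \<and> i \<le> N c" for i c
  proof
    assume a: "(i, i + c) \<in> D"
    then have "{1..i} \<subseteq> {i. (i, i + c) \<in> D}" using down by auto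
    from card_mono[OF finc this] pos[OF a] show "1 \<le> i \<and> i \<le> N c" by (simp add: N_def)
  next
    assume a: "1 \<le> i \<and> i \<le> N c"
    show "(i, i + c) \<in> D"
    proof (rule ccontr)
      assume n: "(i, i + c) \<notin> D"
      then have "{i. (i, i + c) \<in> D} \<subseteq> {1..<i}"
        using down[of _ c i] a pos by (force simp: not_le[symmetric])
      from card_mono[OF _ this] have "N c \<le> i - 1" by (simp add: N_def)
      with a show False by linarith
    qed
  qed
  have N1: "N (Suc c) \<le> N c" for c
    using inN[of "N (Suc c)" "Suc c"] inN[of "N (Suc c)" c] left[of "N (Suc c)" "N (Suc c) + c"]
    by (cases "N (Suc c)") auto
  have N2: "N c \<le> Suc (N (Suc c))" for c
    using inN[of "N c" c] inN[of "N c - 1" "Suc c"] up[of "N c - 1" "N c + c"]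
    by (cases "N c"; cases "N c - 1") auto
  obtain n where n: "\<And>i k. (i, k) \<in> D \<Longrightarrow> k \<le> n"
    using finite_imageI[OF fin, of snd] by (force simp: finite_nat_set_iff_bounded_le)
  have N0: "N c = 0" if "n \<le> c" for c
    using inN[of "N c" c] n[of "N c" "N c + c"] that by (cases "N c") auto
  define P where "P = {p. 1 \<le> p \<and> N (p - 1) = Suc (N p)}"
  have "P \<subseteq> {..n}"
  proof
    fix p assume "p \<in> P"
    then show "p \<in> {..n}" using N0[of "p - 1"] by (fastforce simp: P_def)
  qed
  then have "finite P" "0 \<notin> P" by (auto simp: P_def dest: finite_subset)
  then have ps: "pset (partition_of P) = P" by (rule pset_partition_of)
  have "cnt (partition_of P) c = N c" for c
  proof (cases "n \<le> c")
    case True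
    then show ?thesis using N0 cnt_0[of "partition_of P" n c] ps \<open>P \<subseteq> {..n}\<close> by auto
  next
    case False
    then have "c \<le> n" by simp
    then show ?thesis
    proof (induction rule: inc_induct)
      case base
      then show ?case using N0 cnt_0[of "partition_of P" n n] ps \<open>P \<subseteq> {..n}\<close> by auto
    next
      case (step c)
      moreover have "Suc c \<in> pset (partition_of P) \<longleftrightarrow> N c = Suc (N (Suc c))"
        by (simp add: ps) (simp add: P_def)
      ultimately show ?case
        using cnt_step[of "partition_of P" c] N1[of c] N2[of c] by auto
    qed
  qed
  then have "(i, k) \<in> SD (partition_of P) \<longleftrightarrow> (i, k) \<in> D" for i k
    using inN[of i "k - i"] pos[of i k] by (auto simp: in_SD)
  then show ?thesis by (intro exI[of _ "partition_of P"]) auto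
qed

definition shape :: "(nat \<times> nat) set \<Rightarrow> strict_partition" where
  "shape D = (THE lam. SD lam = D)"

lemma shape_SD [simp]: "shape (SD lam) = lam"
  unfolding shape_def by (rule the_equality) (auto dest: SD_inject)

section \<open>Configurations on the first \<open>n\<close> sites\<close>

primrec bits :: "nat \<Rightarrow> strict_partition \<Rightarrow> bool list" where
  "bits 0 lam = []"
| "bits (Suc n) lam = (Suc n \<in> pset lam) # bits n lam"

lemma length_bits [simp]: "length (bits n lam) = n"
  by (induction n) auto

definition inside :: "nat \<Rightarrow> strict_partition set" where
  "inside n = {lam. \<forall>p\<in>pset lam. p \<le> n}"

lemma bits_eq_iff: "bits n lam = bits n mu \<longleftrightarrow> (\<forall>p. 1 \<le> p \<longrightarrow> p \<le> n \<longrightarrow> (p \<in> pset lam \<longleftrightarrow> p \<in> pset mu))"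
  by (induction n) (auto simp: le_Suc_eq)

lemma bits_surj: "\<exists>P \<subseteq> {1..length ls}. bits (length ls) (partition_of P) = ls"
proof (induction ls)
  case Nil
  then show ?case by simp
next
  case (Cons l ls)
  then obtain P where P: "P \<subseteq> {1..length ls}" "bits (length ls) (partition_of P) = ls" by blast
  let ?Q = "if l then insert (Suc (length ls)) P else P"
  have Q: "?Q \<subseteq> {1..Suc (length ls)}" using P by auto
  have "pset (partition_of ?Q) = ?Q" "pset (partition_of P) = P"
    using P Q by (auto intro!: pset_partition_of intro: finite_subset)
  then have "bits (length (l # ls)) (partition_of ?Q) = l # ls"
    using P bits_eq_iff[of "length ls" "partition_of ?Q" "partition_of P"] by auto
  with Q show ?case by (metis length_Cons)
qed

lemma bij_bits: "bij_betw (bits n) (inside n) (bit_lists n)"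
  unfolding bij_betw_def
proof
  show "inj_on (bits n) (inside n)"
  proof (rule inj_onI)
    fix lam mu assume "lam \<in> inside n" "mu \<in> inside n" "bits n lam = bits n mu"
    then have "p \<in> pset lam \<longleftrightarrow> p \<in> pset mu" for p
      using pset_pos[of p lam] pset_pos[of p mu]
      by (cases "1 \<le> p \<and> p \<le> n") (auto simp: inside_def bits_eq_iff Suc_le_eq)
    then show "lam = mu" by (intro pset_inject) auto
  qed
  show "bits n ` inside n = bit_lists n"
  proof
    show "bits n ` inside n \<subseteq> bit_lists n" by (auto simp: bit_lists_def)
    show "bit_lists n \<subseteq> bits n ` inside n"
    proof
      fix ls assume "ls \<in> bit_lists n"
      then have n: "length ls = n" by (simp add: bit_lists_def)
      obtain P where P: "P \<subseteq> {1..n}" "bits n (partition_of P) = ls" using bits_surj[of ls] n by auto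
      moreover have "pset (partition_of P) = P"
        using P by (auto intro!: pset_partition_of intro: finite_subset)
      ultimately show "ls \<in> bits n ` inside n"
        by (intro image_eqI[of _ _ "partition_of P"]) (auto simp: inside_def)
    qed
  qed
qed

lemma sum_inside: "(\<Sum>lam\<in>inside n. f (bits n lam)) = (\<Sum>ls\<in>bit_lists n. f ls)"
  using sum.reindex_bij_betw[OF bij_bits] .

lemma finite_inside [simp]: "finite (inside n)"
  using bij_betw_finite[OF bij_bits] by simp

lemma SD_subset_iff: "SD mu \<subseteq> SD lam \<longleftrightarrow> (\<forall>c. cnt mu c \<le> cnt lam c)"
proof
  assume s: "SD mu \<subseteq> SD lam"
  show "\<forall>c. cnt mu c \<le> cnt lam c"
  proof
    fix c show "cnt mu c \<le> cnt lam c"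
      using s in_SD_content[of "cnt mu c" c mu] in_SD_content[of "cnt mu c" c lam]
      by (cases "cnt mu c") auto
  qed
next
  assume le: "\<forall>c. cnt mu c \<le> cnt lam c"
  show "SD mu \<subseteq> SD lam"
  proof clarify
    fix i k assume "(i, k) \<in> SD mu"
    then show "(i, k) \<in> SD lam" using spec[OF le, of "k - i"] by (simp add: in_SD)
  qed
qed

lemma inside_subset: "SD mu \<subseteq> SD lam \<Longrightarrow> lam \<in> inside n \<Longrightarrow> mu \<in> inside n"
proof -
  assume s: "SD mu \<subseteq> SD lam" and l: "lam \<in> inside n"
  have "p \<le> n" if "p \<in> pset mu" for p
  proof (rule ccontr)
    assume "\<not> p \<le> n"
    then have "cnt lam (p - 1) = 0" using l by (intro cnt_0[of _ n]) (auto simp: inside_def)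
    moreover have "cnt mu (p - 1) > 0"
      using that pset_pos[OF that] by (auto simp: cnt_def card_gt_0_iff)
    ultimately show False using s by (auto simp: SD_subset_iff dest: spec[of _ "p - 1"])
  qed
  then show ?thesis by (simp add: inside_def)
qed

lemma SD_eq_Union:
  assumes "lam \<in> inside n"
  shows "SD lam = (\<Union>c<n. (\<lambda>i. (i, i + c)) ` {1..cnt lam c})"
proof -
  have "c < n" if "1 \<le> i" "i \<le> cnt lam c" for i c
    using that cnt_0[of lam n c] assms by (force simp: inside_def)
  note less = this
  show ?thesis
  proof
    show "SD lam \<subseteq> (\<Union>c<n. (\<lambda>i. (i, i + c)) ` {1..cnt lam c})"
    proof clarify
      fix i k assume "(i, k) \<in> SD lam"
      then have "1 \<le> i" "i \<le> k" "i \<le> cnt lam (k - i)" by (auto simp: in_SD)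
      then show "(i, k) \<in> (\<Union>c<n. (\<lambda>i. (i, i + c)) ` {1..cnt lam c})"
        using less[of i "k - i"] by (intro UN_I[of "k - i"] image_eqI[of _ _ i]) auto
    qed
  qed (auto simp: in_SD)
qed

lemma card_SD: "card (SD lam) = psize lam"
proof -
  have "SD lam = (\<Union>i<length (parts lam). (\<lambda>c. (Suc i, Suc i + c)) ` {..<parts lam ! i})"
  proof (intro set_eqI, clarify)
    fix i k
    show "(i, k) \<in> SD lam \<longleftrightarrow> (i, k) \<in> (\<Union>i<length (parts lam). (\<lambda>c. (Suc i, Suc i + c)) ` {..<parts lam ! i})"
      using nth_gt_iff[OF parts_strict(1), of "i - 1" lam "k - i"]
      by (cases i) (auto simp: in_SD cnt_def pset_def Suc_le_eq image_iff intro!: bexI[of _ "k - i"])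
  qed
  also have "card \<dots> = (\<Sum>i<length (parts lam). card ((\<lambda>c. (Suc i, Suc i + c)) ` {..<parts lam ! i}))"
    by (rule card_UN_disjoint) auto
  also have "\<dots> = (\<Sum>i<length (parts lam). parts lam ! i)"
    by (intro sum.cong refl) (auto simp: card_image inj_on_def)
  also have "\<dots> = psize lam"
    by (simp add: psize_def sum_list_sum_nth atLeast0LessThan)
  finally show ?thesis .
qed

lemma bit_weight_bits: "lam \<in> inside n \<Longrightarrow> bit_weight (bits n lam) = psize lam"
proof -
  \<comment> \<open>Subtracting \<open>cnt lam n\<close> discards the parts above \<open>n\<close>,
    so the formula holds for every \<open>n\<close> and is open to induction; for \<open>lam\<close>
    inside \<open>n\<close> nothing is subtracted.\<close>
  have "bit_weight (bits n lam) = (\<Sum>c<n. cnt lam c - cnt lam n)" for n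
  proof (induction n)
    case (Suc n)
    have "(\<Sum>c<n. cnt lam c - cnt lam (Suc n)) = (\<Sum>c<n. (cnt lam c - cnt lam n) + of_bool (Suc n \<in> pset lam))"
      using cnt_step[of lam n] cnt_antimono[of _ n lam] by (intro sum.cong) auto
    then show ?case using Suc cnt_step[of lam n] by (auto simp: sum.distrib)
  qed simp
  moreover assume l: "lam \<in> inside n"
  moreover have "cnt lam n = 0" using l by (intro cnt_0[of _ n]) (auto simp: inside_def)
  moreover have "psize lam = (\<Sum>c<n. cnt lam c)"
    unfolding card_SD[symmetric] SD_eq_Union[OF l]
    by (subst card_UN_disjoint) (auto simp: card_image inj_on_def)
  ultimately show ?thesis by simp
qed

section \<open>Box weights as transfer weights\<close>

lemma psize_eq_sum_cnt: "lam \<in> inside n \<Longrightarrow> psize lam = (\<Sum>c<n. cnt lam c)"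
  unfolding card_SD[symmetric]
  by (subst SD_eq_Union, assumption, subst card_UN_disjoint) (auto simp: card_image inj_on_def)

lemma card_skew:
  assumes "SD mu \<subseteq> SD lam" "lam \<in> inside n"
  shows "card (SD lam - SD mu) = (\<Sum>c<n. cnt lam c - cnt mu c)"
proof -
  have "card (SD lam - SD mu) = psize lam - psize mu"
    using assms(1) by (simp add: card_Diff_subset finite_subset card_SD)
  also have "\<dots> = (\<Sum>c<n. cnt lam c) - (\<Sum>c<n. cnt mu c)"
    using assms inside_subset[OF assms] by (simp add: psize_eq_sum_cnt)
  also have "\<dots> = (\<Sum>c<n. cnt lam c - cnt mu c)"
    using assms by (intro sum_subtractf_nat[symmetric]) (auto simp: SD_subset_iff)
  finally show ?thesis .
qed

lemma in_skew: "(i, i + c) \<in> SD lam - SD mu \<longleftrightarrow> 1 \<le> i \<and> i \<le> cnt lam c \<and> cnt mu c < i"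
  by (auto simp: in_SD)

lemma in_skewE:
  assumes "b \<in> SD lam - SD mu"
  obtains i c where "b = (i, i + c)" "1 \<le> i" "i \<le> cnt lam c" "cnt mu c < i"
proof (cases b)
  case (Pair i k)
  then have "i \<le> k" using assms SD_bounds by blast
  with Pair assms that[of i "k - i"] in_skew[of i "k - i" lam mu] show ?thesis by simp
qed

lemma SD_col_up:
  assumes "(i, k) \<in> SD lam" "1 \<le> i'" "i' \<le> i"
  shows "(i', k) \<in> SD lam"
  using assms(3,1,2) by (induction i rule: dec_induct) (use SD_up in auto)

section \<open>Corners and strips\<close>

definition corner :: "strict_partition \<Rightarrow> nat \<times> nat \<Rightarrow> bool" where
  "corner mu b \<longleftrightarrow> b \<in> SD mu \<and> (Suc (fst b), snd b) \<notin> SD mu \<and> (fst b, Suc (snd b)) \<notin> SD mu"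

text \<open>A removable box belongs to a particle that can step down to an empty site. Site
  \<open>0\<close> is always empty, which covers the corners on the diagonal.\<close>

lemma corner_iff:
  "corner mu b \<longleftrightarrow> (\<exists>c. b = (cnt mu c, cnt mu c + c) \<and> Suc c \<in> pset mu \<and> c \<notin> pset mu)"
proof
  assume a: "corner mu b"
  obtain i k where b: "b = (i, k)" by force
  define c where "c = k - i"
  from a b have ik: "1 \<le> i" "k = i + c" "i \<le> cnt mu c" by (auto simp: corner_def in_SD c_def)
  have "(i, i + Suc c) \<notin> SD mu" using a b ik by (simp add: corner_def)
  then have 1: "cnt mu (Suc c) < i" using ik by (simp only: in_SD_content) simp
  then have 2: "i = cnt mu c" "Suc c \<in> pset mu" using ik cnt_step[of mu c] by (auto split: if_splits simp: of_bool_def)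
  have "c \<notin> pset mu"
  proof
    assume "c \<in> pset mu"
    moreover from this obtain d where d: "c = Suc d" using pset_pos[of c mu] by (cases c) auto
    ultimately have "Suc i \<le> cnt mu d" using cnt_step[of mu d] 2 by simp
    then have "(Suc i, Suc i + d) \<in> SD mu" by (simp only: in_SD_content) simp
    then show False using a b ik d by (simp add: corner_def)
  qed
  with 2 b ik show "\<exists>c. b = (cnt mu c, cnt mu c + c) \<and> Suc c \<in> pset mu \<and> c \<notin> pset mu" by blast
next
  assume "\<exists>c. b = (cnt mu c, cnt mu c + c) \<and> Suc c \<in> pset mu \<and> c \<notin> pset mu"
  then obtain c where c: "b = (cnt mu c, cnt mu c + c)" "Suc c \<in> pset mu" "c \<notin> pset mu" by blast
  let ?i = "cnt mu c"
  have i: "?i = Suc (cnt mu (Suc c))" using cnt_step[of mu c] c by simp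
  have "(?i, ?i + c) \<in> SD mu" using i by (simp only: in_SD_content) simp
  moreover have "(?i, ?i + Suc c) \<notin> SD mu" using i by (simp only: in_SD_content) simp
  moreover have "(Suc ?i, ?i + c) \<notin> SD mu"
  proof (cases c)
    case 0
    then show ?thesis by (simp add: in_SD)
  next
    case (Suc d)
    then have "cnt mu d = ?i" using cnt_step[of mu d] c by simp
    then have "(Suc ?i, Suc ?i + d) \<notin> SD mu" by (simp only: in_SD_content) simp
    then show ?thesis using Suc by simp
  qed
  ultimately show "corner mu b" using c by (simp add: corner_def)
qed

lemma corner_inj:
  "inj_on (\<lambda>c. (cnt mu c, cnt mu c + c)) A"
  by (auto simp: inj_on_def)

text \<open>The boxes outside \<open>mu\<close> must carry the new letter and give \<open>x\<close>
  each. A corner of \<open>mu\<close> may carry it too if its row or column does not have it yet;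
  with \<open>q = 1 + b x\<close> the power of \<open>q\<close> sums over both choices.\<close>

definition stripwt :: "(nat \<times> nat \<Rightarrow> nat) \<Rightarrow> (nat \<times> nat \<Rightarrow> bool) \<Rightarrow> 'a::comm_ring_1 \<Rightarrow> 'a
    \<Rightarrow> strict_partition \<Rightarrow> strict_partition \<Rightarrow> 'a" where
  "stripwt line adm x q mu lam =
    (if SD mu \<subseteq> SD lam \<and> inj_on line (SD lam - SD mu) \<and> (\<forall>b\<in>SD lam - SD mu. adm b)
     then x ^ card (SD lam - SD mu) *
       q ^ card {b. corner mu b \<and> adm b \<and> line b \<notin> line ` (SD lam - SD mu)} else 0)"

text \<open>The boxes of a row of the skew shape have consecutive contents, so a row with two boxes
  has two with contents \<open>c\<close> and \<open>c + 1\<close>.\<close>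

lemma vstrip_iff:
  assumes le: "\<And>c. cnt mu c \<le> cnt lam c"
  shows "inj_on fst (SD lam - SD mu) \<longleftrightarrow> (\<forall>c. cnt lam (Suc c) \<le> cnt mu c)"
proof (intro iffI allI)
  fix c assume inj: "inj_on fst (SD lam - SD mu)"
  show "cnt lam (Suc c) \<le> cnt mu c"
  proof (rule ccontr)
    let ?i = "Suc (cnt mu c)"
    assume "\<not> cnt lam (Suc c) \<le> cnt mu c"
    then have "(?i, ?i + c) \<in> SD lam - SD mu" "(?i, ?i + Suc c) \<in> SD lam - SD mu"
      unfolding in_skew using cnt_antimono[of c "Suc c"] by (auto intro: order_trans simp: le_imp_less_Suc not_le Suc_le_eq intro: less_le_trans)
    from inj_onD[OF inj _ this] show False by simp
  qed
next
  assume H: "\<forall>c. cnt lam (Suc c) \<le> cnt mu c"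
  have F: False if "1 \<le> i" "i \<le> cnt lam c'" "cnt mu c < i" "c < c'" for i c c'
    using that spec[OF H, of c] cnt_antimono[of "Suc c" c' lam] by simp
  show "inj_on fst (SD lam - SD mu)"
  proof (rule inj_onI)
    fix a b assume a: "a \<in> SD lam - SD mu" and b: "b \<in> SD lam - SD mu" and eq: "fst a = fst b"
    show "a = b" using a b eq F
      by (elim in_skewE) (metis fst_conv linorder_neqE_nat)
  qed
qed

lemma hstrip_iff:
  assumes le: "\<And>c. cnt mu c \<le> cnt lam c"
  shows "inj_on snd (SD lam - SD mu) \<longleftrightarrow> (\<forall>c. cnt lam c \<le> Suc (cnt mu (Suc c)))"
proof (intro iffI allI)
  fix c assume inj: "inj_on snd (SD lam - SD mu)"
  show "cnt lam c \<le> Suc (cnt mu (Suc c))"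
  proof (rule ccontr)
    let ?i = "Suc (cnt mu (Suc c))"
    assume a: "\<not> cnt lam c \<le> Suc (cnt mu (Suc c))"
    have "cnt lam c \<le> Suc (cnt lam (Suc c))" "cnt mu c \<le> Suc (cnt mu (Suc c))"
      using cnt_step[of lam c] cnt_step[of mu c] by auto
    with a have "(?i, ?i + Suc c) \<in> SD lam - SD mu" "(Suc ?i, Suc ?i + c) \<in> SD lam - SD mu"
      unfolding in_skew by auto
    from inj_onD[OF inj _ this] show False by simp
  qed
next
  assume H: "\<forall>c. cnt lam c \<le> Suc (cnt mu (Suc c))"
  have F: False if "(i, k) \<in> SD lam - SD mu" "(i', k) \<in> SD lam - SD mu" "i < i'" for i i' k
  proof -
    define c where "c = k - Suc i"
    have "i' \<le> k" using that SD_bounds by blast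
    then have k: "k = Suc i + c" "k = i + Suc c" using that by (auto simp: c_def)
    have "(Suc i, Suc i + c) \<in> SD lam" using SD_col_up[of i' k lam "Suc i"] that k by simp
    then have "Suc i \<le> cnt lam c" by (simp only: in_SD_content)
    moreover have "cnt mu (Suc c) < i" using that(1) unfolding k(2) in_skew by simp
    ultimately show False using spec[OF H, of c] by simp
  qed
  show "inj_on snd (SD lam - SD mu)"
  proof (rule inj_onI)
    fix a b assume "a \<in> SD lam - SD mu" "b \<in> SD lam - SD mu" "snd a = snd b"
    then show "a = b" using F by (cases a; cases b) (metis linorder_neqE_nat snd_conv)
  qed
qed

text \<open>The row of the corner continues with content \<open>c + 1\<close>, so it is free unless
  the diagonal of that content has grown.\<close>

lemma row_free_iff:
  assumes le: "\<And>c. cnt mu c \<le> cnt lam c" and "Suc c \<in> pset mu"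
  shows "cnt mu c \<notin> fst ` (SD lam - SD mu) \<longleftrightarrow> cnt lam (Suc c) = cnt mu (Suc c)"
proof -
  have s: "cnt mu c = Suc (cnt mu (Suc c))" using cnt_step[of mu c] assms by simp
  have "cnt mu c \<in> fst ` (SD lam - SD mu) \<longleftrightarrow> cnt mu c \<le> cnt lam (Suc c)"
  proof
    assume "cnt mu c \<in> fst ` (SD lam - SD mu)"
    then obtain b where b: "b \<in> SD lam - SD mu" "cnt mu c = fst b" by auto
    from b(1) obtain i c' where "b = (i, i + c')" "i \<le> cnt lam c'" "cnt mu c' < i" by (rule in_skewE)
    with b have *: "cnt mu c \<le> cnt lam c'" "cnt mu c' < cnt mu c" by auto
    have "c < c'" using *(2) cnt_antimono[of c' c mu] by (metis not_le)
    then show "cnt mu c \<le> cnt lam (Suc c)" using * cnt_antimono[of "Suc c" c' lam] by simp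
  next
    assume "cnt mu c \<le> cnt lam (Suc c)"
    then have "(cnt mu c, cnt mu c + Suc c) \<in> SD lam - SD mu" unfolding in_skew using s by simp
    then show "cnt mu c \<in> fst ` (SD lam - SD mu)" by force
  qed
  then show ?thesis using s le[of "Suc c"] by auto
qed

text \<open>Below a corner of content \<open>c\<close> lies a box of content \<open>c - 1\<close>.
  Below the diagonal there is no box, so for \<open>c = 0\<close> the column is always free.\<close>

lemma col_free_iff:
  assumes le: "\<And>c. cnt mu c \<le> cnt lam c" and "Suc c \<in> pset mu" and nc: "c \<notin> pset mu"
  shows "cnt mu c + c \<notin> snd ` (SD lam - SD mu) \<longleftrightarrow> c = 0 \<or> cnt lam c = cnt mu c \<and> c \<notin> pset lam"
proof -
  have s: "cnt mu c = Suc (cnt mu (Suc c))" using cnt_step[of mu c] assms by simp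
  let ?k = "cnt mu c + c"
  have "?k \<in> snd ` (SD lam - SD mu) \<longleftrightarrow> (Suc (cnt mu c), ?k) \<in> SD lam"
  proof
    assume "?k \<in> snd ` (SD lam - SD mu)"
    then obtain i where i: "(i, ?k) \<in> SD lam - SD mu" by auto
    have "(cnt mu c, ?k) \<in> SD mu" using s by (simp only: in_SD_content) simp
    then have "cnt mu c < i" using i SD_col_up[of "cnt mu c" ?k mu i] SD_bounds[of i ?k lam] by (metis DiffD1 DiffD2 not_le)
    then show "(Suc (cnt mu c), ?k) \<in> SD lam" using i SD_col_up[of i ?k lam] by simp
  next
    assume a: "(Suc (cnt mu c), ?k) \<in> SD lam"
    have "corner mu (cnt mu c, ?k)" using assms by (auto simp: corner_iff)
    then have "(Suc (cnt mu c), ?k) \<notin> SD mu" by (simp add: corner_def)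
    then show "?k \<in> snd ` (SD lam - SD mu)" using a by force
  qed
  also have "\<dots> \<longleftrightarrow> c \<noteq> 0 \<and> cnt mu c < cnt lam (c - 1)"
    by (cases c) (simp_all add: in_SD Suc_le_eq)
  finally show ?thesis
    using le[of c] cnt_step[of lam "c - 1"] by (cases c) auto
qed


text \<open>Values at the cut below site \<open>1\<close>, which accounts for the diagonal boxes.
  With \<open>d = False\<close> the vertical strip may neither add a diagonal box
  (\<open>AF\<close>) nor put its letter into a diagonal corner (\<open>AC\<close>).\<close>

definition vinit :: "bool \<Rightarrow> 'a::comm_ring_1 \<Rightarrow> 'a \<Rightarrow> astate \<Rightarrow> 'a" where
  "vinit d x q s = (case s of AN \<Rightarrow> 1 | AF \<Rightarrow> (if d then x else 0) | AC \<Rightarrow> (if d then q else 1))"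

definition hinit :: "'a::comm_ring_1 \<Rightarrow> 'a \<Rightarrow> astate \<Rightarrow> 'a" where
  "hinit x q s = (case s of AN \<Rightarrow> 1 | AF \<Rightarrow> x | AC \<Rightarrow> q)"

text \<open>A strip lengthens each diagonal by at most one box, so the state at a cut can be read
  off from the lengths. Diagonal \<open>j\<close> belongs to the cut above the head, hence
  \<open>c \<le> j\<close> in the weight but \<open>c < j\<close> in the conditions.\<close>

lemma vadd_bits:
  fixes mu lam d
  defines "Q \<equiv> \<lambda>c. Suc c \<in> pset mu \<and> cnt lam (Suc c) = cnt mu (Suc c)"
  assumes "cnt mu j \<le> cnt lam j" "cnt lam j \<le> Suc (cnt mu j)"
  shows "vadd x q (vinit d x q) (if cnt lam j = Suc (cnt mu j) then AF else if Q j then AC else AN) (bits j mu) (bits j lam)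
    = (if (\<forall>c<j. cnt mu c \<le> cnt lam c \<and> cnt lam (Suc c) \<le> cnt mu c) \<and> (d \<or> cnt lam 0 = cnt mu 0)
       then x ^ (\<Sum>c\<le>j. cnt lam c - cnt mu c) * q ^ card {c. c \<le> j \<and> Q c \<and> c \<notin> pset mu \<and> (d \<or> c \<noteq> 0)} else 0)"
  using assms(2,3)
proof (induction j)
  case 0
  have "0 \<notin> pset mu" using pset_pos[of 0 mu] by blast
  moreover have "\<not> Q 0" if "cnt lam 0 = Suc (cnt mu 0)"
    using that cnt_step[of lam 0] cnt_step[of mu 0] by (auto simp: Q_def of_bool_def split: if_splits)
  moreover have "{c. c = 0 \<and> Q c \<and> c \<notin> pset mu \<and> (d \<or> c \<noteq> 0)} = (if Q 0 \<and> 0 \<notin> pset mu \<and> d then {0} else {})"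
    by auto
  ultimately show ?case using 0 by (auto simp: vinit_def)
next
  case (Suc j)
  let ?l = "Suc j \<in> pset lam" and ?m = "Suc j \<in> pset mu"
  have g: "cnt lam j = cnt lam (Suc j) + of_bool ?l" and h: "cnt mu j = cnt mu (Suc j) + of_bool ?m"
    by (rule cnt_step)+
  have nQ: "\<not> Q (Suc j)" if "cnt lam (Suc j) = Suc (cnt mu (Suc j))"
    using that cnt_step[of lam "Suc j"] cnt_step[of mu "Suc j"] by (auto simp: Q_def of_bool_def split: if_splits)
  have Qj: "Q j \<longleftrightarrow> ?m \<and> cnt lam (Suc j) = cnt mu (Suc j)" by (simp add: Q_def)
  let ?C = "\<lambda>j. {c. c \<le> j \<and> Q c \<and> c \<notin> pset mu \<and> (d \<or> c \<noteq> 0)}"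
  define N where "N j = card (?C j)" for j
  have "?C (Suc j) = ?C j \<union> (if Q (Suc j) \<and> \<not> ?m then {Suc j} else {})"
    by (auto simp: le_Suc_eq)
  then have C: "N (Suc j) = N j + of_bool (Q (Suc j) \<and> \<not> ?m)" by (auto simp: N_def)
  have all: "(\<forall>c<Suc j. P c) \<longleftrightarrow> (\<forall>c<j. P c) \<and> P j" for P by (auto simp: less_Suc_eq)
  consider "cnt lam (Suc j) = cnt mu (Suc j)" | "cnt lam (Suc j) = Suc (cnt mu (Suc j))"
    using Suc.prems by linarith
  then show ?case
  proof cases
    case 1
    then show ?thesis
      using Suc.IH g h unfolding N_def[symmetric] by (cases ?l; cases ?m) (auto simp: C all Qj)
  next
    case 2
    then show ?thesis
      using Suc.IH g h nQ unfolding N_def[symmetric] by (cases ?l; cases ?m) (auto simp: C all Qj)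
  qed
qed

text \<open>The last hypothesis is the strip condition at the next site: if \<open>Suc j\<close> is
  occupied in \<open>mu\<close>, then \<open>Suc (cnt mu (Suc j))\<close> equals
  \<open>cnt mu j\<close> and bounds \<open>cnt lam j\<close>.\<close>

lemma hadd_bits:
  fixes mu lam
  defines "Q \<equiv> \<lambda>c. Suc c \<in> pset mu \<and> (c = 0 \<or> cnt lam c = cnt mu c \<and> c \<notin> pset lam)"
  assumes "cnt mu j \<le> cnt lam j" "cnt lam j \<le> Suc (cnt mu j)" "Suc j \<in> pset mu \<Longrightarrow> cnt lam j = cnt mu j"
  shows "hadd x q (hinit x q) (if cnt lam j = Suc (cnt mu j) then AF else if Suc j \<in> pset mu then AC else AN) (bits j mu) (bits j lam)
    = (if \<forall>c<j. cnt mu c \<le> cnt lam c \<and> cnt lam c \<le> Suc (cnt mu (Suc c))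
       then x ^ (\<Sum>c\<le>j. cnt lam c - cnt mu c) * q ^ card {c. c \<le> j \<and> Q c} else 0)"
  using assms(2,3,4)
proof (induction j)
  case 0
  have "{c. c = 0 \<and> Q c} = (if Suc 0 \<in> pset mu then {0} else {})"
    by (auto simp: Q_def)
  then show ?case using 0 by (auto simp: hinit_def)
next
  case (Suc j)
  let ?l = "Suc j \<in> pset lam" and ?m = "Suc j \<in> pset mu"
  have g: "cnt lam j = cnt lam (Suc j) + of_bool ?l" and h: "cnt mu j = cnt mu (Suc j) + of_bool ?m"
    by (rule cnt_step)+
  have QS: "Q (Suc j) \<longleftrightarrow> Suc (Suc j) \<in> pset mu \<and> cnt lam (Suc j) = cnt mu (Suc j) \<and> \<not> ?l"
    by (simp add: Q_def)
  have "{c. c \<le> Suc j \<and> Q c} = {c. c \<le> j \<and> Q c} \<union> (if Q (Suc j) then {Suc j} else {})"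
    by (auto simp: le_Suc_eq)
  then have C: "card {c. c \<le> Suc j \<and> Q c} = card {c. c \<le> j \<and> Q c} + of_bool (Q (Suc j))" by auto
  have all: "(\<forall>c<Suc j. P c) \<longleftrightarrow> (\<forall>c<j. P c) \<and> P j" for P by (auto simp: less_Suc_eq)
  consider "cnt lam (Suc j) = cnt mu (Suc j)" | "cnt lam (Suc j) = Suc (cnt mu (Suc j))"
    using Suc.prems by linarith
  then show ?case
  proof cases
    case 1
    then show ?thesis
      using Suc.IH g h by (cases ?l; cases ?m) (auto simp: C all QS)
  next
    case 2
    then show ?thesis
      using Suc.IH Suc.prems g h by (cases ?l; cases ?m) (auto simp: C all QS)
  qed
qed

lemma corner_image:
  "{b. corner mu b \<and> P b} = (\<lambda>c. (cnt mu c, cnt mu c + c)) ` {c. Suc c \<in> pset mu \<and> c \<notin> pset mu \<and> P (cnt mu c, cnt mu c + c)}"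
  by (auto simp: corner_iff)

lemma stripwt_vertical:
  assumes "mu \<in> inside n" "lam \<in> inside n"
  shows "stripwt fst (\<lambda>b. d \<or> fst b \<noteq> snd b) x q mu lam = vadd x q (vinit d x q) AN (bits n mu) (bits n lam)"
proof -
  have 0: "cnt mu c = 0" "cnt lam c = 0" if "n \<le> c" for c
    using assms that by (auto simp: inside_def intro!: cnt_0[of _ n])
  have n: "Suc n \<notin> pset mu" using assms by (auto simp: inside_def)
  let ?Q = "\<lambda>c. Suc c \<in> pset mu \<and> cnt lam (Suc c) = cnt mu (Suc c)"
  have R: "vadd x q (vinit d x q) AN (bits n mu) (bits n lam) =
    (if (\<forall>c<n. cnt mu c \<le> cnt lam c \<and> cnt lam (Suc c) \<le> cnt mu c) \<and> (d \<or> cnt lam 0 = cnt mu 0)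
       then x ^ (\<Sum>c\<le>n. cnt lam c - cnt mu c) * q ^ card {c. c \<le> n \<and> ?Q c \<and> c \<notin> pset mu \<and> (d \<or> c \<noteq> 0)} else 0)"
    using vadd_bits[of mu n lam x q d] 0[of n] n by simp
  have all: "(\<forall>c<n. cnt mu c \<le> cnt lam c \<and> cnt lam (Suc c) \<le> cnt mu c) \<longleftrightarrow>
      (\<forall>c. cnt mu c \<le> cnt lam c) \<and> (\<forall>c. cnt lam (Suc c) \<le> cnt mu c)"
    using 0 by (metis le_Suc_eq le_refl not_less)
  have adm: "(\<forall>b\<in>SD lam - SD mu. d \<or> fst b \<noteq> snd b) \<longleftrightarrow> d \<or> cnt lam 0 = cnt mu 0"
    if le: "\<forall>c. cnt mu c \<le> cnt lam c"
  proof
    assume a: "\<forall>b\<in>SD lam - SD mu. d \<or> fst b \<noteq> snd b"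
    show "d \<or> cnt lam 0 = cnt mu 0"
    proof (rule ccontr)
      assume n: "\<not> (d \<or> cnt lam 0 = cnt mu 0)"
      then have "(cnt lam 0, cnt lam 0 + 0) \<in> SD lam - SD mu" unfolding in_skew using spec[OF le, of 0] by simp
      from bspec[OF a this] n show False by simp
    qed
  next
    assume a: "d \<or> cnt lam 0 = cnt mu 0"
    show "\<forall>b\<in>SD lam - SD mu. d \<or> fst b \<noteq> snd b"
    proof
      fix b assume "b \<in> SD lam - SD mu"
      then show "d \<or> fst b \<noteq> snd b" using a by (elim in_skewE) auto
    qed
  qed
  show ?thesis
  proof (cases "\<forall>c. cnt mu c \<le> cnt lam c")
    case True
    then have sub: "SD mu \<subseteq> SD lam" by (simp add: SD_subset_iff)
    have "{c. Suc c \<in> pset mu \<and> c \<notin> pset mu \<and> (d \<or> cnt mu c \<noteq> cnt mu c + c) \<and> cnt mu c \<notin> fst ` (SD lam - SD mu)}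
        = {c. c \<le> n \<and> ?Q c \<and> c \<notin> pset mu \<and> (d \<or> c \<noteq> 0)}"
      using row_free_iff[of mu lam] True assms(1) by (auto simp: inside_def)
    then have "card {b. corner mu b \<and> (d \<or> fst b \<noteq> snd b) \<and> fst b \<notin> fst ` (SD lam - SD mu)}
        = card {c. c \<le> n \<and> ?Q c \<and> c \<notin> pset mu \<and> (d \<or> c \<noteq> 0)}"
      by (subst corner_image) (simp add: card_image corner_inj)
    moreover have "card (SD lam - SD mu) = (\<Sum>c\<le>n. cnt lam c - cnt mu c)"
      using card_skew[OF sub assms(2)] 0[of n] by (simp add: lessThan_Suc_atMost[symmetric])
    moreover have "inj_on fst (SD lam - SD mu) \<longleftrightarrow> (\<forall>c. cnt lam (Suc c) \<le> cnt mu c)"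
      using vstrip_iff True by blast
    ultimately show ?thesis
      unfolding stripwt_def R all adm[OF True] using sub True by simp
  next
    case False
    then have "\<not> SD mu \<subseteq> SD lam" by (simp add: SD_subset_iff)
    then show ?thesis unfolding stripwt_def R all using False by auto
  qed
qed

lemma stripwt_horizontal:
  assumes "mu \<in> inside n" "lam \<in> inside n"
  shows "stripwt snd (\<lambda>b. True) x q mu lam = hadd x q (hinit x q) AN (bits n mu) (bits n lam)"
proof -
  have 0: "cnt mu c = 0" "cnt lam c = 0" if "n \<le> c" for c
    using assms that by (auto simp: inside_def intro!: cnt_0[of _ n])
  have n: "Suc n \<notin> pset mu" using assms by (auto simp: inside_def)
  let ?Q = "\<lambda>c. Suc c \<in> pset mu \<and> (c = 0 \<or> cnt lam c = cnt mu c \<and> c \<notin> pset lam)"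
  have R: "hadd x q (hinit x q) AN (bits n mu) (bits n lam) =
    (if \<forall>c<n. cnt mu c \<le> cnt lam c \<and> cnt lam c \<le> Suc (cnt mu (Suc c))
       then x ^ (\<Sum>c\<le>n. cnt lam c - cnt mu c) * q ^ card {c. c \<le> n \<and> ?Q c} else 0)"
    using hadd_bits[of mu n lam x q] 0[of n] n by simp
  have all: "(\<forall>c<n. cnt mu c \<le> cnt lam c \<and> cnt lam c \<le> Suc (cnt mu (Suc c))) \<longleftrightarrow>
      (\<forall>c. cnt mu c \<le> cnt lam c) \<and> (\<forall>c. cnt lam c \<le> Suc (cnt mu (Suc c)))"
    using 0 by (metis le0 le_refl not_less)
  show ?thesis
  proof (cases "\<forall>c. cnt mu c \<le> cnt lam c")
    case True
    then have sub: "SD mu \<subseteq> SD lam" by (simp add: SD_subset_iff)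
    have S: "{c. Suc c \<in> pset mu \<and> c \<notin> pset mu \<and> cnt mu c + c \<notin> snd ` (SD lam - SD mu)}
        = {c. c \<le> n \<and> ?Q c}" if H: "\<forall>c. cnt lam c \<le> Suc (cnt mu (Suc c))"
    proof -
      \<comment> \<open>For \<open>c > 0\<close> site \<open>c\<close> is empty in
        \<open>lam\<close> by \<open>?Q\<close>. Were it occupied in \<open>mu\<close>, equal
        diagonals at \<open>c\<close> would make \<open>lam\<close> shorter than \<open>mu\<close>
        at \<open>c - 1\<close>.\<close>
      have "c \<notin> pset mu" if "?Q c" for c
      proof (cases c)
        case (Suc d)
        then show ?thesis
          using that cnt_step[of lam d] cnt_step[of mu d] spec[OF True, of d] by (auto split: if_splits)
      qed (use pset_pos[of 0 mu] in auto)
      moreover have "c \<le> n" if "Suc c \<in> pset mu" for c using that assms(1) by (auto simp: inside_def)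
      ultimately show ?thesis using col_free_iff[of mu lam] True by blast
    qed
    have "card {b. corner mu b \<and> True \<and> snd b \<notin> snd ` (SD lam - SD mu)}
        = card {c. c \<le> n \<and> ?Q c}" if H: "\<forall>c. cnt lam c \<le> Suc (cnt mu (Suc c))"
      unfolding S[OF H, symmetric] by (subst corner_image) (simp add: card_image corner_inj)
    moreover have "card (SD lam - SD mu) = (\<Sum>c\<le>n. cnt lam c - cnt mu c)"
      using card_skew[OF sub assms(2)] 0[of n] by (simp add: lessThan_Suc_atMost[symmetric])
    moreover have "inj_on snd (SD lam - SD mu) \<longleftrightarrow> (\<forall>c. cnt lam c \<le> Suc (cnt mu (Suc c)))"
      using hstrip_iff True by blast
    ultimately show ?thesis
      unfolding stripwt_def R all using sub True by auto
  next
    case False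
    then have "\<not> SD mu \<subseteq> SD lam" by (simp add: SD_subset_iff)
    then show ?thesis unfolding stripwt_def R all using False by auto
  qed
qed

section \<open>Skew shapes weighted by rows or columns\<close>

definition skewwt :: "(nat \<times> nat \<Rightarrow> nat) \<Rightarrow> (nat \<times> nat \<Rightarrow> bool) \<Rightarrow> 'a::comm_ring_1 \<Rightarrow> 'a
    \<Rightarrow> strict_partition \<Rightarrow> strict_partition \<Rightarrow> 'a" where
  "skewwt line adm y t lam mu =
    (if SD mu \<subseteq> SD lam \<and> (\<forall>b\<in>SD lam - SD mu. adm b)
     then y ^ card (line ` (SD lam - SD mu)) * t ^ (card (SD lam - SD mu) - card (line ` (SD lam - SD mu))) else 0)"

lemma skewrem_bits:
  assumes "cnt mu j \<le> cnt lam j"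
  shows "skewrem g e (cnt lam j - cnt mu j) (bits j lam) (bits j mu) =
    (if \<forall>c<j. cnt mu c \<le> cnt lam c
     then (\<Prod>c<j. g (Suc c \<in> pset lam) (Suc c \<in> pset mu) (cnt lam c - cnt mu c)) * e ^ (cnt lam 0 - cnt mu 0) else 0)"
  using assms
proof (induction j)
  case 0
  then show ?case by simp
next
  case (Suc j)
  let ?l = "Suc j \<in> pset lam" and ?m = "Suc j \<in> pset mu"
  have g: "cnt lam j = cnt lam (Suc j) + of_bool ?l" and h: "cnt mu j = cnt mu (Suc j) + of_bool ?m"
    by (rule cnt_step)+
  have f: "cnt lam (Suc j) - cnt mu (Suc j) + of_bool ?l - of_bool ?m = cnt lam j - cnt mu j"
    using Suc.prems g h by simp
  have v: "of_bool ?m \<le> cnt lam (Suc j) - cnt mu (Suc j) + of_bool ?l \<longleftrightarrow> cnt mu j \<le> cnt lam j"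
    using Suc.prems g h by (cases ?l; cases ?m) auto
  have all: "(\<forall>c<Suc j. P c) \<longleftrightarrow> (\<forall>c<j. P c) \<and> P j" for P by (auto simp: less_Suc_eq)
  show ?case
    using Suc.IH by (auto simp: f v all mult_ac)
qed

text \<open>The bound is proved along with the formula because it keeps the truncated difference in
  the exponent of \<open>t\<close> additive.\<close>

lemma prod_cutwt:
  fixes n :: nat
  shows
  "(\<Prod>c<n. cutwt y t (P c) (f c)) =
    y ^ card {c. c < n \<and> P c \<and> f c > 0} * t ^ ((\<Sum>c<n. f c) - card {c. c < n \<and> P c \<and> f c > (0::nat)})
    \<and> card {c. c < n \<and> P c \<and> f c > 0} \<le> (\<Sum>c<n. f c)"
proof (induction n)
  case (Suc n)
  have "{c. c < Suc n \<and> P c \<and> f c > 0} = {c. c < n \<and> P c \<and> f c > 0} \<union> (if P n \<and> f n > 0 then {n} else {})"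
    by (auto simp: less_Suc_eq)
  then have C: "card {c. c < Suc n \<and> P c \<and> f c > 0} = card {c. c < n \<and> P c \<and> f c > 0} + of_bool (P n \<and> f n > 0)"
    by auto
  obtain e where e: "(\<Sum>c<n. f c) = card {c. c < n \<and> P c \<and> f c > 0} + e"
    using Suc.IH le_Suc_ex by blast
  show ?case
  proof (cases "P n \<and> f n > 0")
    case True
    then obtain m where "f n = Suc m" by (cases "f n") auto
    with True Suc.IH show ?thesis by (simp add: C e cutwt_def power_add mult_ac)
  next
    case False
    with Suc.IH show ?thesis by (auto simp: C e cutwt_def power_add mult_ac)
  qed
qed simp

text \<open>Every row is counted at its last box: if that box has content \<open>c\<close>, the row
  belongs to the part \<open>Suc c\<close> of \<open>lam\<close>.\<close>

lemma rows_image: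
  assumes le: "\<And>c. cnt mu c \<le> cnt lam c" and n: "lam \<in> inside n"
  shows "card (fst ` (SD lam - SD mu)) = card {c. c < n \<and> Suc c \<in> pset lam \<and> cnt lam c - cnt mu c > 0}"
proof -
  let ?A = "{c. c < n \<and> Suc c \<in> pset lam \<and> cnt lam c - cnt mu c > 0}"
  have 0: "cnt lam c = 0" if "n \<le> c" for c
    using n that by (auto simp: inside_def intro!: cnt_0[of _ n])
  have "fst ` (SD lam - SD mu) = cnt lam ` ?A"
  proof
    show "cnt lam ` ?A \<subseteq> fst ` (SD lam - SD mu)"
    proof clarify
      fix c assume "0 < cnt lam c - cnt mu c"
      then have "(cnt lam c, cnt lam c + c) \<in> SD lam - SD mu" unfolding in_skew by auto
      then show "cnt lam c \<in> fst ` (SD lam - SD mu)" by force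
    qed
    show "fst ` (SD lam - SD mu) \<subseteq> cnt lam ` ?A"
    proof
      fix i assume "i \<in> fst ` (SD lam - SD mu)"
      then obtain b where b: "b \<in> SD lam - SD mu" "i = fst b" by auto
      from b(1) obtain i' c where "b = (i', i' + c)" "1 \<le> i'" "i' \<le> cnt lam c" "cnt mu c < i'" by (rule in_skewE)
      with b(2) have c: "1 \<le> i" "i \<le> cnt lam c" "cnt mu c < i" by simp_all
      \<comment> \<open>The content of the last box of row \<open>i\<close> in
        \<open>lam\<close>.\<close>
      define d where "d = (GREATEST c. i \<le> cnt lam c)"
      have bd: "k \<le> n" if "i \<le> cnt lam k" for k using 0[of k] c(1) that by (cases "n \<le> k") auto
      have d: "i \<le> cnt lam d" unfolding d_def by (rule GreatestI_nat[where P = "\<lambda>c. i \<le> cnt lam c", OF c(2) bd])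
      have cd: "c \<le> d" unfolding d_def by (rule Greatest_le_nat[where P = "\<lambda>c. i \<le> cnt lam c", OF c(2) bd])
      have "\<not> i \<le> cnt lam (Suc d)"
        using Greatest_le_nat[of "\<lambda>c. i \<le> cnt lam c" "Suc d" n] bd unfolding d_def by auto
      then have s: "i = cnt lam d" "Suc d \<in> pset lam" using d cnt_step[of lam d] by (auto split: if_splits simp: of_bool_def)
      moreover have "cnt mu d < i" using c cnt_antimono[OF cd, of mu] by simp
      moreover have "d < n" using s c 0[of d] by (cases "d < n") auto
      ultimately show "i \<in> cnt lam ` ?A" by auto
    qed
  qed
  moreover have "inj_on (cnt lam) ?A"
  proof (rule linorder_inj_onI)
    fix c d assume "c < d" "c \<in> ?A" "d \<in> ?A"
    then show "cnt lam c \<noteq> cnt lam d" using cnt_step[of lam c] cnt_antimono[of "Suc c" d lam] by simp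
  qed auto
  ultimately show ?thesis by (simp add: card_image)
qed

text \<open>Every column is counted at its top box. The first new box of content \<open>c\<close>
  has above it a position of content \<open>c + 1\<close>, which lies in \<open>mu\<close> or
  outside the diagram just when site \<open>Suc c\<close> is empty in \<open>mu\<close>.\<close>

lemma cols_image:
  assumes le: "\<And>c. cnt mu c \<le> cnt lam c" and n: "lam \<in> inside n"
  shows "card (snd ` (SD lam - SD mu)) = card {c. c < n \<and> Suc c \<notin> pset mu \<and> cnt lam c - cnt mu c > 0}"
proof -
  let ?A = "{c. c < n \<and> Suc c \<notin> pset mu \<and> cnt lam c - cnt mu c > 0}"
  let ?f = "\<lambda>c. Suc (cnt mu c) + c"
  have 0: "cnt lam c = 0" if "n \<le> c" for c
    using n that by (auto simp: inside_def intro!: cnt_0[of _ n])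
  have "snd ` (SD lam - SD mu) = ?f ` ?A"
  proof
    show "?f ` ?A \<subseteq> snd ` (SD lam - SD mu)"
    proof clarify
      fix c assume "0 < cnt lam c - cnt mu c"
      then have "(Suc (cnt mu c), Suc (cnt mu c) + c) \<in> SD lam - SD mu" unfolding in_skew by auto
      then show "Suc (cnt mu c) + c \<in> snd ` (SD lam - SD mu)" by force
    qed
    show "snd ` (SD lam - SD mu) \<subseteq> ?f ` ?A"
    proof
      fix k assume "k \<in> snd ` (SD lam - SD mu)"
      then obtain i where i: "(i, k) \<in> SD lam" "(i, k) \<notin> SD mu" by auto
      define i' where "i' = (LEAST i. 1 \<le> i \<and> (i, k) \<notin> SD mu)"
      have ex: "1 \<le> i \<and> (i, k) \<notin> SD mu" using i SD_bounds by blast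
      have i': "1 \<le> i'" "(i', k) \<notin> SD mu" using LeastI[of "\<lambda>i. 1 \<le> i \<and> (i, k) \<notin> SD mu", OF ex] by (auto simp: i'_def)
      have ii: "i' \<le> i" unfolding i'_def by (rule Least_le[of "\<lambda>i. 1 \<le> i \<and> (i, k) \<notin> SD mu", OF ex])
      have l: "(i', k) \<in> SD lam" by (rule SD_col_up[OF i(1) i'(1) ii])
      define c where "c = k - i'"
      have k: "k = i' + c" using SD_bounds[OF l] by (simp add: c_def)
      have c1: "i' \<le> cnt lam c" "cnt mu c < i'" using l i' unfolding k in_SD_content by auto
      have "i' - 1 \<le> cnt mu (Suc c)"
      proof (cases "i' = 1")
        case False
        then have "(i' - 1, k) \<in> SD mu"
          using not_less_Least[of "i' - 1" "\<lambda>i. 1 \<le> i \<and> (i, k) \<notin> SD mu"] i'(1)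
          unfolding i'_def[symmetric] by auto
        moreover have "k = (i' - 1) + Suc c" using k i'(1) by simp
        ultimately show ?thesis by (simp only: in_SD_content)
      qed simp
      then have "i' = Suc (cnt mu c)" "Suc c \<notin> pset mu"
        using c1 cnt_step[of mu c] by (auto split: if_splits simp: of_bool_def)
      moreover have "c < n" using c1 0[of c] by (cases "c < n") auto
      ultimately show "k \<in> ?f ` ?A" using k c1 by (intro image_eqI[of _ _ c]) auto
    qed
  qed
  moreover have "inj_on ?f ?A"
  proof (rule linorder_inj_onI)
    fix c d assume a: "c < d" "c \<in> ?A" "d \<in> ?A"
    have "Suc c + cnt mu (Suc c) \<le> d + cnt mu d"
    proof -
      have "Suc c \<le> d" using a by simp
      then show ?thesis
      proof (induction d rule: dec_induct)
        case (step m)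
        then show ?case using cnt_step[of mu m] by (auto split: if_splits simp: of_bool_def)
      qed simp
    qed
    then show "?f c \<noteq> ?f d" using cnt_step[of mu c] a by simp
  qed auto
  ultimately show ?thesis by (simp add: card_image)
qed

lemma skewwt_rows:
  assumes "mu \<in> inside n" "lam \<in> inside n"
  shows "skewwt fst (\<lambda>b. True) y t lam mu = rrem y t 1 0 (bits n lam) (bits n mu)"
proof -
  have 0: "cnt mu c = 0" "cnt lam c = 0" if "n \<le> c" for c
    using assms that by (auto simp: inside_def intro!: cnt_0[of _ n])
  have all: "(\<forall>c<n. cnt mu c \<le> cnt lam c) \<longleftrightarrow> SD mu \<subseteq> SD lam"
    unfolding SD_subset_iff using 0 by (metis le_refl not_less)
  show ?thesis
    using skewrem_bits[of mu n lam "\<lambda>l n. cutwt y t l" 1] 0[of n]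
      conjunct1[OF prod_cutwt[of y t "\<lambda>c. Suc c \<in> pset lam" "\<lambda>c. cnt lam c - cnt mu c" n]]
      card_skew[of mu lam n] rows_image[of mu lam n] assms
    by (auto simp: skewwt_def rrem_def all SD_subset_iff)
qed

lemma skewwt_cols:
  assumes "mu \<in> inside n" "lam \<in> inside n"
  shows "skewwt snd (\<lambda>b. d \<or> fst b \<noteq> snd b) y t lam mu = crem y t (of_bool d) 0 (bits n lam) (bits n mu)"
proof -
  have 0: "cnt mu c = 0" "cnt lam c = 0" if "n \<le> c" for c
    using assms that by (auto simp: inside_def intro!: cnt_0[of _ n])
  have all: "(\<forall>c<n. cnt mu c \<le> cnt lam c) \<longleftrightarrow> SD mu \<subseteq> SD lam"
    unfolding SD_subset_iff using 0 by (metis le_refl not_less)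
  have adm: "(\<forall>b\<in>SD lam - SD mu. d \<or> fst b \<noteq> snd b) \<longleftrightarrow> d \<or> cnt lam 0 - cnt mu 0 = 0"
  proof
    assume a: "\<forall>b\<in>SD lam - SD mu. d \<or> fst b \<noteq> snd b"
    show "d \<or> cnt lam 0 - cnt mu 0 = 0"
    proof (rule ccontr)
      assume n: "\<not> (d \<or> cnt lam 0 - cnt mu 0 = 0)"
      then have "(cnt lam 0, cnt lam 0 + 0) \<in> SD lam - SD mu" unfolding in_skew by simp
      from bspec[OF a this] n show False by simp
    qed
  next
    assume a: "d \<or> cnt lam 0 - cnt mu 0 = 0"
    show "\<forall>b\<in>SD lam - SD mu. d \<or> fst b \<noteq> snd b"
    proof
      fix b assume "b \<in> SD lam - SD mu"
      then show "d \<or> fst b \<noteq> snd b" using a by (elim in_skewE) auto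
    qed
  qed
  show ?thesis
    unfolding skewwt_def adm
    using skewrem_bits[of mu n lam "\<lambda>l n. cutwt y t (\<not> n)" "of_bool d"] 0[of n]
      conjunct1[OF prod_cutwt[of y t "\<lambda>c. Suc c \<notin> pset mu" "\<lambda>c. cnt lam c - cnt mu c" n]]
      card_skew[of mu lam n] cols_image[of mu lam n] assms
    by (auto simp: crem_def all SD_subset_iff of_bool_def power_0_left)
qed

section \<open>Removing the largest letter of a set-valued tableau\<close>

declare split_paired_All [simp del] split_paired_Ex [simp del]

text \<open>Numbers the alphabet \<open>1' < 1 < 2' < 2 < ...\<close> by
  \<open>1, 2, 3, 4, ...\<close>, so that removing the largest letter becomes induction on a natural
  number.\<close>

definition letter :: "nat \<Rightarrow> rat" where
  "letter a = of_nat a / 2"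

lemma letter_le [simp]: "letter a \<le> letter c \<longleftrightarrow> a \<le> c"
  and letter_eq [simp]: "letter a = letter c \<longleftrightarrow> a = c"
  by (auto simp: letter_def divide_le_cancel)

lemma unprimed_letter: "unprimed k = letter (2 * k)"
  by (simp add: unprimed_def letter_def)

lemma primed_letter: "1 \<le> k \<Longrightarrow> primed k = letter (2 * k - 1)"
  by (simp add: primed_def letter_def of_nat_diff field_simps)

lemma letters_eq: "letters = letter ` {1..}"
proof
  show "letters \<subseteq> letter ` {1..}"
  proof
    fix v assume "v \<in> letters"
    then obtain k where "1 \<le> k" "v = unprimed k \<or> v = primed k" by (auto simp: letters_def)
    then have "v = letter (2 * k) \<or> v = letter (2 * k - 1)" "1 \<le> 2 * k - 1" by (auto simp: unprimed_letter primed_letter)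
    then show "v \<in> letter ` {1..}" by auto
  qed
  show "letter ` {1..} \<subseteq> letters"
  proof clarify
    fix a :: nat assume "1 \<le> a"
    show "letter a \<in> letters"
    proof (cases "even a")
      case True
      then obtain k where "a = 2 * k" by blast
      with \<open>1 \<le> a\<close> show ?thesis by (auto simp: letters_def unprimed_letter[symmetric])
    next
      case False
      then obtain k where "a = 2 * k + 1" by (elim oddE)
      then have "letter a = primed (Suc k)" using primed_letter[of "Suc k"] by simp
      then show ?thesis by (auto simp: letters_def)
    qed
  qed
qed

lemma lettersE:
  assumes "v \<in> letters" obtains a where "v = letter a" "1 \<le> a"
  using assms by (auto simp: letters_eq)

text \<open>The odd letters are the primed ones, which do not repeat in rows; the even ones do not repeat in columns.\<close>

definition line :: "nat \<Rightarrow> nat \<times> nat \<Rightarrow> nat" where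
  "line a = (if even a then snd else fst)"

definition svt_admissible :: "bool \<Rightarrow> nat \<Rightarrow> nat \<times> nat \<Rightarrow> bool" where
  "svt_admissible d a b \<longleftrightarrow> d \<or> even a \<or> fst b \<noteq> snd b"

definition pp_admissible :: "bool \<Rightarrow> nat \<Rightarrow> nat \<times> nat \<Rightarrow> bool" where
  "pp_admissible d a b \<longleftrightarrow> d \<or> odd a \<or> fst b \<noteq> snd b"

definition svt :: "bool \<Rightarrow> strict_partition \<Rightarrow> (nat \<times> nat \<Rightarrow> rat set) set" where
  "svt d lam = (if d then ShSVT_Q lam else ShSVT_P lam)"

lemma all_letters_iff:
  "(\<forall>k\<ge>1. P (unprimed k)) \<and> (\<forall>k\<ge>1. R (primed k)) \<longleftrightarrow> (\<forall>a\<ge>1. if even a then P (letter a) else R (letter a))"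
proof
  assume H: "(\<forall>k\<ge>1. P (unprimed k)) \<and> (\<forall>k\<ge>1. R (primed k))"
  show "\<forall>a\<ge>1. if even a then P (letter a) else R (letter a)"
  proof (intro allI impI)
    fix a :: nat assume "1 \<le> a"
    show "if even a then P (letter a) else R (letter a)"
    proof (cases "even a")
      case True
      then obtain k where "a = 2 * k" by blast
      then show ?thesis using H \<open>1 \<le> a\<close> by (auto simp: unprimed_letter)
    next
      case False
      then obtain k where "a = 2 * k + 1" by (elim oddE)
      then show ?thesis using H primed_letter[of "Suc k"] by (auto dest!: spec[of _ "Suc k"])
    qed
  qed
next
  assume H: "\<forall>a\<ge>1. if even a then P (letter a) else R (letter a)"
  show "(\<forall>k\<ge>1. P (unprimed k)) \<and> (\<forall>k\<ge>1. R (primed k))"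
  proof (intro conjI allI impI)
    fix k :: nat assume "1 \<le> k"
    then show "P (unprimed k)" using H by (auto simp: unprimed_letter dest!: spec[of _ "2 * k"])
    show "R (primed k)" using H \<open>1 \<le> k\<close> by (auto simp: primed_letter dest!: spec[of _ "2 * k - 1"])
  qed
qed

text \<open>\<open>T\<close> is empty off the shape, so neighbours can be compared element by
  element without any membership in the shape; both repetition rules become injectivity of
  \<open>line\<close>.\<close>

lemma svt_iff:
  "T \<in> svt d lam \<longleftrightarrow>
    (\<forall>b\<in>SD lam. T b \<noteq> {} \<and> finite (T b) \<and> T b \<subseteq> letters) \<and> (\<forall>b. b \<notin> SD lam \<longrightarrow> T b = {}) \<and>
    (\<forall>i j u v. u \<in> T (i, j) \<longrightarrow> v \<in> T (Suc i, j) \<longrightarrow> u \<le> v) \<and>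
    (\<forall>i j u v. u \<in> T (i, j) \<longrightarrow> v \<in> T (i, Suc j) \<longrightarrow> u \<le> v) \<and>
    (\<forall>a\<ge>1. inj_on (line a) {b. letter a \<in> T b} \<and> (\<forall>b. letter a \<in> T b \<longrightarrow> svt_admissible d a b))"
proof -
  define G where "G \<longleftrightarrow> (\<forall>b\<in>SD lam. T b \<noteq> {} \<and> finite (T b) \<and> T b \<subseteq> letters) \<and> (\<forall>b. b \<notin> SD lam \<longrightarrow> T b = {})"
  have nb: "((i, j) \<in> SD lam \<longrightarrow> (i', j') \<in> SD lam \<longrightarrow> Max (T (i, j)) \<le> Min (T (i', j'))) \<longleftrightarrow>
      (\<forall>u v. u \<in> T (i, j) \<longrightarrow> v \<in> T (i', j') \<longrightarrow> u \<le> v)" if G for i j i' j'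
  proof (cases "(i, j) \<in> SD lam \<and> (i', j') \<in> SD lam")
    case True
    with that have "finite (T (i, j))" "T (i, j) \<noteq> {}" "finite (T (i', j'))" "T (i', j') \<noteq> {}"
      by (auto simp: G_def)
    with True show ?thesis by auto
  next
    case False
    with that show ?thesis by (auto simp: G_def)
  qed
  let ?U = "\<lambda>v. \<forall>i i' j. v \<in> T (i, j) \<longrightarrow> v \<in> T (i', j) \<longrightarrow> i = i'"
  let ?R = "\<lambda>v. \<forall>i j j'. v \<in> T (i, j) \<longrightarrow> v \<in> T (i, j') \<longrightarrow> j = j'"
  let ?D = "\<lambda>v. \<forall>i. (i, i) \<in> SD lam \<longrightarrow> v \<notin> T (i, i)"
  have 1: "(\<forall>k\<ge>1. ?U (unprimed k)) \<and> (\<forall>k\<ge>1. ?R (primed k)) \<longleftrightarrow> (\<forall>a\<ge>1. inj_on (line a) {b. letter a \<in> T b})"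
    unfolding all_letters_iff[of ?U ?R] by (intro all_cong imp_cong refl) (auto simp: line_def inj_on_def split_paired_All)
  have 2: "(\<forall>i. \<forall>k\<ge>1. (i, i) \<in> SD lam \<longrightarrow> primed k \<notin> T (i, i)) \<longleftrightarrow> (\<forall>a\<ge>1. \<forall>b. letter a \<in> T b \<longrightarrow> svt_admissible False a b)" if G
  proof -
    have "(\<forall>i. \<forall>k\<ge>1. (i, i) \<in> SD lam \<longrightarrow> primed k \<notin> T (i, i)) \<longleftrightarrow> (\<forall>k\<ge>1. (\<lambda>_. True) (unprimed k)) \<and> (\<forall>k\<ge>1. ?D (primed k))"
      by blast
    also have "\<dots> \<longleftrightarrow> (\<forall>a\<ge>1. \<forall>b. letter a \<in> T b \<longrightarrow> svt_admissible False a b)"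
    proof -
      have "(i, i) \<in> SD lam" if "u \<in> T (i, i)" for i u using that \<open>G\<close> by (auto simp: G_def)
      then show ?thesis
        unfolding all_letters_iff[of "\<lambda>_. True" ?D]
        by (intro all_cong imp_cong refl) (auto simp: svt_admissible_def split_paired_All)
    qed
    finally show ?thesis .
  qed
  have Q: "T \<in> ShSVT_Q lam \<longleftrightarrow> G \<and> (\<forall>i j u v. u \<in> T (i, j) \<longrightarrow> v \<in> T (Suc i, j) \<longrightarrow> u \<le> v) \<and>
    (\<forall>i j u v. u \<in> T (i, j) \<longrightarrow> v \<in> T (i, Suc j) \<longrightarrow> u \<le> v) \<and> (\<forall>a\<ge>1. inj_on (line a) {b. letter a \<in> T b})"
    unfolding 1[symmetric] ShSVT_Q_def mem_Collect_eq G_def[symmetric] conj_assoc[symmetric]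
    using nb by (auto simp: G_def)
  show ?thesis
  proof (cases d)
    case True
    then show ?thesis unfolding svt_def using Q by (auto simp: G_def svt_admissible_def)
  next
    case False
    then show ?thesis unfolding svt_def ShSVT_P_def using Q 2 by (auto simp: G_def)
  qed
qed

definition svt_upto :: "bool \<Rightarrow> nat \<Rightarrow> strict_partition \<Rightarrow> (nat \<times> nat \<Rightarrow> rat set) set" where
  "svt_upto d m lam = {T \<in> svt d lam. \<forall>b. T b \<subseteq> letter ` {1..m}}"

lemma svt_upto_sub: "T \<in> svt_upto d m lam \<Longrightarrow> v \<in> T b \<Longrightarrow> \<exists>a. v = letter a \<and> 1 \<le> a \<and> a \<le> m"
proof -
  assume "T \<in> svt_upto d m lam" "v \<in> T b"
  then have "v \<in> letter ` {1..m}" unfolding svt_upto_def by blast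
  then show ?thesis by auto
qed

lemma svt_upto_svt: "T \<in> svt_upto d m lam \<Longrightarrow> T \<in> svt d lam"
  by (simp add: svt_upto_def)

lemma finite_svt_upto [simp]: "finite (svt_upto d m lam)"
proof (rule finite_subset)
  show "svt_upto d m lam \<subseteq> {T. \<forall>b. (b \<in> SD lam \<longrightarrow> T b \<in> Pow (letter ` {1..m})) \<and> (b \<notin> SD lam \<longrightarrow> T b = {})}"
    by (auto simp: svt_upto_def svt_iff)
  show "finite {T. \<forall>b. (b \<in> SD lam \<longrightarrow> T b \<in> Pow (letter ` {1..m})) \<and> (b \<notin> SD lam \<longrightarrow> T b = {})}"
    by (rule finite_set_of_finite_funs) auto
qed

text \<open>Primed and unprimed letters have separate weights \<open>X\<close>, so that one letter
  can be removed at a time; later \<open>X a\<close> is the variable of index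
  \<open>a div 2\<close>.\<close>

definition svtwt :: "'a::comm_ring_1 \<Rightarrow> (nat \<Rightarrow> 'a) \<Rightarrow> nat \<Rightarrow> strict_partition \<Rightarrow> (nat \<times> nat \<Rightarrow> rat set) \<Rightarrow> 'a" where
  "svtwt b X m lam T = b ^ (svt_size lam T - psize lam) * (\<Prod>a<m. X a ^ svt_occ lam T (letter (Suc a)))"

definition svt_sum :: "bool \<Rightarrow> 'a::comm_ring_1 \<Rightarrow> (nat \<Rightarrow> 'a) \<Rightarrow> nat \<Rightarrow> strict_partition \<Rightarrow> 'a" where
  "svt_sum d b X m lam = (\<Sum>T\<in>svt_upto d m lam. svtwt b X m lam T)"

lemma psize_le_svt_size:
  assumes "T \<in> svt d lam"
  shows "psize lam \<le> svt_size lam T"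
proof -
  have "(\<Sum>b\<in>SD lam. 1) \<le> (\<Sum>b\<in>SD lam. card (T b))"
    using assms by (intro sum_mono) (auto simp: svt_iff Suc_le_eq card_gt_0_iff)
  then show ?thesis by (simp add: card_SD svt_size_def)
qed

text \<open>If two corners shared a row or column, the boxes between them would lie in
  \<open>mu\<close>, against the corner condition for the first.\<close>

lemma corner_inj_line: "inj_on (line a) {b. corner mu b}"
proof -
  have rowdown: "(i, k') \<in> SD mu" if "(i, k) \<in> SD mu" "i \<le> k'" "k' \<le> k" for i k k'
    using that(3,1,2)
  proof (induction k rule: dec_induct)
    case (step n)
    then show ?case using SD_left[of i n mu] by simp
  qed simp
  have R: False if "corner mu (i, k)" "corner mu (i, k')" "k < k'" for i k k'
    using that rowdown[of i k' "Suc k"] SD_bounds[of i k mu] by (auto simp: corner_def)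
  have C: False if "corner mu (i, k)" "corner mu (i', k)" "i < i'" for i i' k
    using that SD_col_up[of i' k mu "Suc i"] by (auto simp: corner_def)
  show ?thesis
  proof (rule inj_onI)
    fix p r assume "p \<in> {b. corner mu b}" "r \<in> {b. corner mu b}" and eq: "line a p = line a r"
    then have pr: "corner mu (fst p, snd p)" "corner mu (fst r, snd r)" by simp_all
    show "p = r"
    proof (cases "even a")
      case True
      then have k: "snd p = snd r" using eq by (simp add: line_def)
      then have "fst p = fst r"
        using C[of "fst p" "snd p" "fst r"] C[of "fst r" "snd p" "fst p"] pr by (metis linorder_neqE_nat)
      with k show ?thesis by (simp add: prod_eq_iff)
    next
      case False
      then have k: "fst p = fst r" using eq by (simp add: line_def)
      then have "snd p = snd r"
        using R[of "fst p" "snd p" "snd r"] R[of "fst p" "snd r" "snd p"] pr by (metis linorder_neqE_nat)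
      with k show ?thesis by (simp add: prod_eq_iff)
    qed
  qed
qed

lemma sum_Pow_power:
  fixes z :: "'a::comm_ring_1"
  assumes "finite S"
  shows "(\<Sum>A\<in>Pow S. z ^ card A) = (1 + z) ^ card S"
  using assms
proof (induction S)
  case (insert s S)
  have fin: "finite A" if "A \<in> Pow S" for A using that insert.hyps finite_subset by auto
  have "(\<Sum>A\<in>insert s ` Pow S. z ^ card A) = (\<Sum>A\<in>Pow S. z ^ card (insert s A))"
    using insert.hyps by (subst sum.reindex) (auto simp: inj_on_def)
  also have "\<dots> = (\<Sum>A\<in>Pow S. z * z ^ card A)"
    using insert.hyps fin by (intro sum.cong refl) (metis PowD card_insert_disjoint power_Suc subsetD)
  finally show ?case
    using insert by (subst Pow_insert, subst sum.union_disjoint)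
      (auto simp: sum_distrib_left[symmetric] algebra_simps)
qed simp

text \<open>The sets of boxes on which the largest letter \<open>a\<close> can sit when the smaller
  letters occupy exactly \<open>mu\<close>.\<close>

definition letter_boxes :: "bool \<Rightarrow> nat \<Rightarrow> strict_partition \<Rightarrow> strict_partition \<Rightarrow> (nat \<times> nat) set set" where
  "letter_boxes d a lam mu = {B. SD lam - SD mu \<subseteq> B \<and> B \<subseteq> (SD lam - SD mu) \<union> {c. corner mu c} \<and>
     inj_on (line a) B \<and> (\<forall>b\<in>B. svt_admissible d a b)}"

text \<open>Such a set consists of the skew shape and an arbitrary set of free corners, since
  distinct corners never share a row or column. Each corner taken contributes \<open>b * x\<close>,
  so each free corner gives a factor \<open>1 + b * x\<close>.\<close>

lemma sum_letter_boxes: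
  fixes b x :: "'a::comm_ring_1"
  assumes "SD mu \<subseteq> SD lam"
  shows "(\<Sum>B\<in>letter_boxes d a lam mu. x ^ card B * b ^ (card B - card (SD lam - SD mu))) =
    stripwt (line a) (svt_admissible d a) x (1 + b * x) mu lam"
proof (cases "inj_on (line a) (SD lam - SD mu) \<and> (\<forall>b\<in>SD lam - SD mu. svt_admissible d a b)")
  case True
  let ?D = "SD lam - SD mu"
  define S where "S = {b. corner mu b \<and> svt_admissible d a b \<and> line a b \<notin> line a ` ?D}"
  have cSD: "c \<in> SD mu" if "corner mu c" for c using that by (simp add: corner_def)
  have finS: "finite S" by (rule finite_subset[OF _ finite_SD[of mu]]) (auto simp: S_def cSD)
  have SD: "S \<inter> ?D = {}" using cSD by (auto simp: S_def)
  have letter_boxes: "letter_boxes d a lam mu = (\<lambda>A. ?D \<union> A) ` Pow S"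
  proof
    show "letter_boxes d a lam mu \<subseteq> (\<lambda>A. ?D \<union> A) ` Pow S"
    proof
      fix B assume B: "B \<in> letter_boxes d a lam mu"
      have "B - ?D \<subseteq> S"
      proof
        fix c assume c: "c \<in> B - ?D"
        have "line a c \<notin> line a ` ?D"
        proof
          assume "line a c \<in> line a ` ?D"
          then obtain e where e: "e \<in> ?D" "line a c = line a e" by auto
          then have "c = e" using B c by (auto simp: letter_boxes_def dest: inj_onD)
          then show False using c e by simp
        qed
        then show "c \<in> S" using B c by (auto simp: letter_boxes_def S_def)
      qed
      moreover have "B = ?D \<union> (B - ?D)" using B by (auto simp: letter_boxes_def)
      ultimately show "B \<in> (\<lambda>A. ?D \<union> A) ` Pow S" by blast
    qed
    show "(\<lambda>A. ?D \<union> A) ` Pow S \<subseteq> letter_boxes d a lam mu"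
    proof
      fix B assume "B \<in> (\<lambda>A. ?D \<union> A) ` Pow S"
      then obtain A where A: "A \<subseteq> S" "B = ?D \<union> A" by auto
      have "inj_on (line a) A"
        using A by (intro inj_on_subset[OF corner_inj_line[of a mu]]) (auto simp: S_def)
      moreover have "line a ` (?D - A) \<inter> line a ` (A - ?D) = {}"
      proof (rule equals0I)
        fix v assume "v \<in> line a ` (?D - A) \<inter> line a ` (A - ?D)"
        then obtain c e where "c \<in> A" "v = line a c" "e \<in> ?D" "v = line a e" by (elim IntE imageE DiffE) simp
        moreover from this have "c \<in> S" using A(1) by (simp only: subsetD)
        ultimately show False unfolding S_def mem_Collect_eq by (metis imageI)
      qed
      ultimately have "inj_on (line a) B"
        unfolding A(2) inj_on_Un using True by (simp only: simp_thms)
      moreover have "\<forall>c\<in>A. corner mu c \<and> svt_admissible d a c" using A(1) by (auto simp: S_def)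
      ultimately show "B \<in> letter_boxes d a lam mu" using A True by (auto simp: letter_boxes_def)
    qed
  qed
  have inj: "inj_on (\<lambda>A. ?D \<union> A) (Pow S)" using SD by (auto simp: inj_on_def)
  have card: "card (?D \<union> A) = card ?D + card A" if "A \<in> Pow S" for A
    using that SD finS by (intro card_Un_disjoint) (auto intro: finite_subset)
  have "(\<Sum>B\<in>letter_boxes d a lam mu. x ^ card B * b ^ (card B - card ?D)) = (\<Sum>A\<in>Pow S. x ^ card ?D * (b * x) ^ card A)"
    unfolding letter_boxes sum.reindex[OF inj]
    by (intro sum.cong refl) (simp add: card power_add power_mult_distrib mult_ac)
  also have "\<dots> = x ^ card ?D * (1 + b * x) ^ card S"
    by (simp add: sum_distrib_left[symmetric] sum_Pow_power[OF finS])
  finally show ?thesis using True assms by (simp add: stripwt_def S_def)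
next
  case False
  have "letter_boxes d a lam mu = {}"
  proof (rule ccontr)
    assume "letter_boxes d a lam mu \<noteq> {}"
    then obtain B where "SD lam - SD mu \<subseteq> B" "inj_on (line a) B" "\<forall>b\<in>B. svt_admissible d a b" by (auto simp: letter_boxes_def)
    with False show False by (meson inj_on_subset subsetD)
  qed
  with False show ?thesis by (auto simp: stripwt_def)
qed

lemma finite_sub_shapes [simp]: "finite {mu. SD mu \<subseteq> SD lam}"
proof -
  obtain n where "lam \<in> inside n"
    using finite_pset[of lam] by (auto simp: inside_def finite_nat_set_iff_bounded_le)
  then have "{mu. SD mu \<subseteq> SD lam} \<subseteq> inside n" using inside_subset by blast
  then show ?thesis by (rule finite_subset) simp
qed

lemma svt_nonempty_iff: "T \<in> svt d lam \<Longrightarrow> b \<in> SD lam \<longleftrightarrow> T b \<noteq> {}"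
  by (auto simp: svt_iff)

text \<open>Deleting the largest letter leaves a tableau on the boxes that do not become empty; they
  form a shifted shape because entries increase weakly. The excess of entries over boxes is
  additive, so the weight factors.\<close>

lemma svt_sum_Suc:
  "svt_sum d b X (Suc m) lam = (\<Sum>mu\<in>{mu. SD mu \<subseteq> SD lam}.
     svt_sum d b X m mu * stripwt (line (Suc m)) (svt_admissible d (Suc m)) (X m) (1 + b * X m) mu lam)"
proof -
  let ?a = "letter (Suc m)" and ?I = "SIGMA mu:{mu. SD mu \<subseteq> SD lam}. letter_boxes d (Suc m) lam mu \<times> svt_upto d m mu"
  let ?i = "\<lambda>(mu, B, T') b. T' b \<union> (if b \<in> B then {?a} else {})"
  let ?D = "\<lambda>T. {b. T b - {?a} \<noteq> {}}"
  let ?j = "\<lambda>T. (shape (?D T), {b. ?a \<in> T b}, \<lambda>b. T b - {?a})"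
  let ?w = "\<lambda>(mu, B, T'). svtwt b X m mu T' * (X m ^ card B * b ^ (card B - card (SD lam - SD mu)))"
  have finB: "finite (letter_boxes d (Suc m) lam mu)" for mu
    by (rule finite_subset[of _ "Pow (SD lam \<union> SD mu)"]) (auto simp: letter_boxes_def corner_def)
  have "svt_sum d b X (Suc m) lam = (\<Sum>s\<in>?I. ?w s)"
    unfolding svt_sum_def
  proof (rule sum.reindex_bij_witness[where i = ?i and j = ?j])
    fix T assume T: "T \<in> svt_upto d (Suc m) lam"
    note Ts = svt_upto_svt[OF T]
    have small: "\<exists>c. v = letter c \<and> 1 \<le> c \<and> c \<le> m" if "v \<in> T b" "v \<noteq> ?a" for v b
      using svt_upto_sub[OF T that(1)] that(2) by (auto simp: le_Suc_eq)
    have lt_a: "v < ?a" if "v \<in> T b" "v \<noteq> ?a" for v b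
      using small[OF that] letter_le[of "Suc m"] by (metis Suc_n_not_le_n le_trans not_le)
    have down: "\<And>i k u v. u \<in> T (i, k) \<Longrightarrow> v \<in> T (Suc i, k) \<Longrightarrow> u \<le> v"
      and right: "\<And>i k u v. u \<in> T (i, k) \<Longrightarrow> v \<in> T (i, Suc k) \<Longrightarrow> u \<le> v"
      using Ts by (auto simp: svt_iff)
    have DSD: "?D T \<subseteq> SD lam" using svt_nonempty_iff[OF Ts] by auto
    have "\<exists>mu. SD mu = ?D T"
    proof (rule ideal_is_SD)
      show "finite (?D T)" using DSD finite_SD finite_subset by blast
      show "1 \<le> i \<and> i \<le> k" if "(i, k) \<in> ?D T" for i k using that DSD SD_bounds by blast
      show "(i, k) \<in> ?D T" if "(Suc i, k) \<in> ?D T" "1 \<le> i" for i k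
      proof -
        from that obtain v where v: "v \<in> T (Suc i, k)" "v \<noteq> ?a" by auto
        have "(i, k) \<in> SD lam" using SD_up that DSD by blast
        then obtain u where "u \<in> T (i, k)" using svt_nonempty_iff[OF Ts] by auto
        with down[OF this v(1)] lt_a[OF v] show ?thesis by auto
      qed
      show "(i, k) \<in> ?D T" if "(i, Suc k) \<in> ?D T" "i \<le> k" for i k
      proof -
        from that obtain v where v: "v \<in> T (i, Suc k)" "v \<noteq> ?a" by auto
        have "(i, k) \<in> SD lam" using SD_left that DSD by blast
        then obtain u where "u \<in> T (i, k)" using svt_nonempty_iff[OF Ts] by auto
        with right[OF this v(1)] lt_a[OF v] show ?thesis by auto
      qed
    qed
    then obtain mu where mu: "SD mu = ?D T" by blast
    have sh: "shape (?D T) = mu" unfolding mu[symmetric] by simp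
    show "?i (?j T) = T" by (auto simp: fun_eq_iff)
    have B: "{b. ?a \<in> T b} \<in> letter_boxes d (Suc m) lam mu"
    proof -
      have "SD lam - SD mu \<subseteq> {b. ?a \<in> T b}" using svt_nonempty_iff[OF Ts] by (auto simp: mu)
      \<comment> \<open>A box to the right of or below one with the largest letter contains nothing
        else, hence has been emptied.\<close>
      moreover have "{b. ?a \<in> T b} \<subseteq> (SD lam - SD mu) \<union> {c. corner mu c}"
      proof
        fix c assume c: "c \<in> {b. ?a \<in> T b}"
        obtain i k where ik: "c = (i, k)" by force
        have "(Suc i, k) \<notin> SD mu" using c down lt_a unfolding ik mu by fastforce
        moreover have "(i, Suc k) \<notin> SD mu" using c right lt_a unfolding ik mu by fastforce
        moreover have "c \<in> SD lam" using c svt_nonempty_iff[OF Ts] by auto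
        ultimately show "c \<in> (SD lam - SD mu) \<union> {c. corner mu c}" by (auto simp: corner_def ik)
      qed
      ultimately show ?thesis using Ts unfolding svt_iff letter_boxes_def by (auto dest!: spec[of _ "Suc m"])
    qed
    have T': "(\<lambda>b. T b - {?a}) \<in> svt_upto d m mu"
    proof -
      have "(\<lambda>b. T b - {?a}) \<in> svt d mu"
        unfolding svt_iff mu
      proof (intro conjI allI impI)
        show "\<forall>b\<in>?D T. T b - {?a} \<noteq> {} \<and> finite (T b - {?a}) \<and> T b - {?a} \<subseteq> letters"
          using Ts DSD by (auto simp: svt_iff)
        fix a :: nat assume "1 \<le> a"
        then have "inj_on (line a) {b. letter a \<in> T b}" using Ts by (simp add: svt_iff)
        then show "inj_on (line a) {b. letter a \<in> T b - {?a}}" by (rule inj_on_subset) auto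
      qed (use Ts in \<open>auto simp: svt_iff\<close>)
      then show ?thesis using small by (force simp: svt_upto_def)
    qed
    show "?j T \<in> ?I" unfolding sh using B T' DSD mu by simp
    show "?w (?j T) = svtwt b X (Suc m) lam T"
    proof -
      let ?B = "{b. ?a \<in> T b}" and ?T = "\<lambda>b. T b - {?a}"
      have sub: "SD mu \<subseteq> SD lam" using DSD mu by simp
      have BS: "?B \<subseteq> SD lam" using svt_nonempty_iff[OF Ts] by auto
      then have finB: "finite ?B" using finite_SD finite_subset by blast
      have "svt_size lam T = (\<Sum>b\<in>SD lam. card (?T b) + of_bool (b \<in> ?B))"
        unfolding svt_size_def
      proof (rule sum.cong[OF refl])
        fix c assume "c \<in> SD lam"
        then have "finite (T c)" using Ts by (simp add: svt_iff)
        then have "card (T c) = Suc (card (?T c))" if "?a \<in> T c" by (rule card.remove[OF _ that])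
        then show "card (T c) = card (?T c) + of_bool (c \<in> ?B)"
          by (cases "?a \<in> T c") (simp_all only: mem_Collect_eq of_bool_eq Diff_insert0 Diff_empty simp_thms add_0_right add_Suc_right One_nat_def)
      qed
      also have "\<dots> = (\<Sum>b\<in>SD lam. card (?T b)) + card ?B"
        using BS by (simp add: sum.distrib Int_absorb1 sum_of_bool_eq Int_def[symmetric] Collect_conj_eq)
      also have "(\<Sum>b\<in>SD lam. card (?T b)) = svt_size mu ?T"
        unfolding svt_size_def
      proof (rule sum.mono_neutral_right)
        show "\<forall>c\<in>SD lam - SD mu. card (?T c) = 0"
        proof
          fix c assume "c \<in> SD lam - SD mu"
          then have "?T c = {}" unfolding mu by blast
          then show "card (?T c) = 0" by (simp only: card.empty)
        qed
      qed (use sub in auto)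
      finally have size: "svt_size lam T = svt_size mu ?T + card ?B" .
      have ps: "psize lam = psize mu + card (SD lam - SD mu)"
        unfolding card_SD[symmetric] using sub by (simp add: card_Diff_subset finite_subset card_mono)
      have le: "card (SD lam - SD mu) \<le> card ?B" using B finB by (auto simp: letter_boxes_def intro: card_mono)
      have le': "psize mu \<le> svt_size mu ?T" using T' psize_le_svt_size svt_upto_svt by blast
      have e: "svt_size lam T - psize lam = (svt_size mu ?T - psize mu) + (card ?B - card (SD lam - SD mu))"
        using size ps le le' by simp
      have "svt_occ lam T ?a = card ?B" unfolding svt_occ_def using BS by (intro arg_cong[where f = card]) auto
      moreover have "svt_occ lam T (letter (Suc a)) = svt_occ mu ?T (letter (Suc a))" if "a < m" for a
        unfolding svt_occ_def using that DSD mu by (intro arg_cong[where f = card]) auto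
      ultimately show ?thesis unfolding sh by (simp add: svtwt_def e power_add mult_ac)
    qed
  next
    fix s assume s: "s \<in> ?I"
    obtain mu B T' where smu: "s = (mu, B, T')" by (cases s) auto
    from s smu have mu: "SD mu \<subseteq> SD lam" and B: "B \<in> letter_boxes d (Suc m) lam mu" and T': "T' \<in> svt_upto d m mu" by auto
    note Ts' = svt_upto_svt[OF T']
    have na: "?a \<notin> T' b" for b using svt_upto_sub[OF T', of ?a b] by auto
    have ne: "b \<in> SD mu \<longleftrightarrow> T' b \<noteq> {}" for b by (rule svt_nonempty_iff[OF Ts'])
    have BS: "B \<subseteq> SD lam" "SD lam - SD mu \<subseteq> B" using B mu by (auto simp: letter_boxes_def corner_def)
    define T where "T = (\<lambda>b. T' b \<union> (if b \<in> B then {?a} else {}))"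
    have iT: "?i s = T" by (simp add: smu T_def)
    have T1: "{b. ?a \<in> T b} = B" and T2: "(\<lambda>b. T b - {?a}) = T'" using na by (auto simp: T_def fun_eq_iff)
    have "{b. T b - {?a} \<noteq> {}} = SD mu" using T2 ne by (auto simp: fun_eq_iff)
    then show "?j (?i s) = s" unfolding iT T1 T2 by (simp add: smu)
    have le_a: "u \<le> ?a" if "u \<in> T' b" for u b using svt_upto_sub[OF T' that] by auto
    have nb: "u \<le> v" if uv: "u \<in> T (i, k)" "v \<in> T (i', k')"
      and nb: "(i', k') = (Suc i, k) \<or> (i', k') = (i, Suc k)" for u v i k i' k'
    proof -
      have ik: "(i, k) \<in> SD lam" using that(1) BS ne[of "(i, k)"] mu by (auto simp: T_def split: if_splits)
      then have ik': "1 \<le> i" "i \<le> k" using SD_bounds by auto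
      consider "u \<in> T' (i, k)" "v \<in> T' (i', k')" | "v = ?a" "u \<in> T (i, k)" | "u = ?a" "(i, k) \<in> B" "v \<in> T' (i', k')"
        using uv by (auto simp: T_def split: if_splits)
      then show ?thesis
      proof cases
        case 1
        then show ?thesis using Ts' nb by (auto simp: svt_iff)
      next
        case 2
        then show ?thesis using le_a by (auto simp: T_def split: if_splits)
      next
        \<comment> \<open>The neighbour still belongs to \<open>mu\<close>, hence so does
          \<open>(i, k)\<close>; but a box of \<open>mu\<close> with the new letter is a corner and
          has no such neighbour.\<close>
        case 3
        then have "(i', k') \<in> SD mu" using ne[of "(i', k')"] by auto
        then have "(i, k) \<in> SD mu" using nb SD_up[of i k mu] SD_left[of i k mu] ik' by auto
        moreover have "corner mu (i, k)" using 3 B \<open>(i, k) \<in> SD mu\<close> by (auto simp: letter_boxes_def)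
        ultimately show ?thesis using nb \<open>(i', k') \<in> SD mu\<close> by (auto simp: corner_def)
      qed
    qed
    have "T \<in> svt d lam"
      unfolding svt_iff
    proof (intro conjI allI impI)
      show "\<forall>b\<in>SD lam. T b \<noteq> {} \<and> finite (T b) \<and> T b \<subseteq> letters"
      proof
        fix c assume c: "c \<in> SD lam"
        have "T' c \<subseteq> letters" "finite (T' c)" using Ts' by (cases "c \<in> SD mu"; auto simp: svt_iff)+
        moreover have "?a \<in> letters" by (auto simp: letters_eq)
        moreover have "T c \<noteq> {}" using c BS ne[of c] by (cases "c \<in> SD mu") (auto simp: T_def)
        ultimately show "T c \<noteq> {} \<and> finite (T c) \<and> T c \<subseteq> letters" by (auto simp: T_def)
      qed
      show "T b = {}" if "b \<notin> SD lam" for b using that BS mu ne[of b] by (auto simp: T_def)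
      show "u \<le> v" if "u \<in> T (i, k)" "v \<in> T (Suc i, k)" for i k u v using nb that by blast
      show "u \<le> v" if "u \<in> T (i, k)" "v \<in> T (i, Suc k)" for i k u v using nb that by blast
      fix a :: nat assume a: "1 \<le> a"
      have "{b. letter a \<in> T b} = (if a = Suc m then B else {b. letter a \<in> T' b})" using na by (auto simp: T_def)
      then show "inj_on (line a) {b. letter a \<in> T b}" using a B Ts' by (auto simp: letter_boxes_def svt_iff)
      show "svt_admissible d a b" if "letter a \<in> T b" for b
        using that a B Ts' na by (auto simp: letter_boxes_def svt_iff T_def split: if_splits)
    qed
    moreover have "T b \<subseteq> letter ` {1..Suc m}" for b
    proof -
      have "T' b \<subseteq> letter ` {1..m}" using T' unfolding svt_upto_def by blast
      moreover have "letter ` {1..m} \<subseteq> letter ` {1..Suc m}" by (rule image_mono) auto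
      moreover have "?a \<in> letter ` {1..Suc m}" by (rule imageI) auto
      ultimately show ?thesis by (auto simp: T_def)
    qed
    ultimately show "?i s \<in> svt_upto d (Suc m) lam" unfolding iT by (simp add: svt_upto_def)
  qed
  also have "\<dots> = (\<Sum>mu\<in>{mu. SD mu \<subseteq> SD lam}. \<Sum>(B, T')\<in>letter_boxes d (Suc m) lam mu \<times> svt_upto d m mu.
      svtwt b X m mu T' * (X m ^ card B * b ^ (card B - card (SD lam - SD mu))))"
    by (subst sum.Sigma) (auto simp: finB intro!: sum.cong)
  also have "\<dots> = (\<Sum>mu\<in>{mu. SD mu \<subseteq> SD lam}. svt_sum d b X m mu *
      (\<Sum>B\<in>letter_boxes d (Suc m) lam mu. X m ^ card B * b ^ (card B - card (SD lam - SD mu))))"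
    by (intro sum.cong refl)
      (simp add: svt_sum_def sum.cartesian_product[symmetric] sum_distrib_left[symmetric] sum_distrib_right[symmetric] mult.commute)
  finally show ?thesis by (simp add: sum_letter_boxes)
qed

section \<open>Removing the largest letter of a plane partition\<close>

definition pp :: "bool \<Rightarrow> strict_partition \<Rightarrow> (nat \<times> nat \<Rightarrow> rat) set" where
  "pp d lam = (if d then ShPP_Q lam else ShPP_P lam)"

lemma pp_iff:
  "T \<in> pp d lam \<longleftrightarrow> T \<in> SD lam \<rightarrow>\<^sub>E letters \<and>
    (\<forall>i j. (i, j) \<in> SD lam \<longrightarrow> (Suc i, j) \<in> SD lam \<longrightarrow> T (i, j) \<le> T (Suc i, j)) \<and>
    (\<forall>i j. (i, j) \<in> SD lam \<longrightarrow> (i, Suc j) \<in> SD lam \<longrightarrow> T (i, j) \<le> T (i, Suc j)) \<and>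
    (\<forall>a\<ge>1. \<forall>b\<in>SD lam. T b = letter a \<longrightarrow> pp_admissible d a b)"
proof -
  let ?D = "\<lambda>v. \<forall>i. (i, i) \<in> SD lam \<longrightarrow> T (i, i) \<noteq> v"
  have "(\<forall>i. \<forall>k\<ge>1. (i, i) \<in> SD lam \<longrightarrow> T (i, i) \<noteq> unprimed k) \<longleftrightarrow>
      (\<forall>k\<ge>1. ?D (unprimed k)) \<and> (\<forall>k\<ge>1. (\<lambda>_. True) (primed k))"
    by blast
  also have "\<dots> \<longleftrightarrow> (\<forall>a\<ge>1. \<forall>b\<in>SD lam. T b = letter a \<longrightarrow> pp_admissible False a b)"
    unfolding all_letters_iff[of ?D "\<lambda>_. True"]
    by (intro all_cong imp_cong refl) (auto simp: pp_admissible_def)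
  finally have P: "(\<forall>i. \<forall>k\<ge>1. (i, i) \<in> SD lam \<longrightarrow> T (i, i) \<noteq> unprimed k) \<longleftrightarrow>
      (\<forall>a\<ge>1. \<forall>b\<in>SD lam. T b = letter a \<longrightarrow> pp_admissible False a b)" .
  show ?thesis
  proof (cases d)
    case True
    then show ?thesis by (simp add: pp_def ShPP_Q_def pp_admissible_def)
  next
    case False
    then show ?thesis unfolding pp_def ShPP_P_def using P by (simp add: ShPP_Q_def)
  qed
qed

definition pp_upto :: "bool \<Rightarrow> nat \<Rightarrow> strict_partition \<Rightarrow> (nat \<times> nat \<Rightarrow> rat) set" where
  "pp_upto d m lam = {T \<in> pp d lam. \<forall>b\<in>SD lam. T b \<in> letter ` {1..m}}"

lemma finite_pp_upto [simp]: "finite (pp_upto d m lam)"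
proof (rule finite_subset)
  show "pp_upto d m lam \<subseteq> SD lam \<rightarrow>\<^sub>E letter ` {1..m}"
    by (auto simp: pp_upto_def pp_iff PiE_def Pi_def)
  show "finite (SD lam \<rightarrow>\<^sub>E letter ` {1..m})" by (rule finite_PiE) auto
qed

definition pplines :: "strict_partition \<Rightarrow> (nat \<times> nat \<Rightarrow> rat) \<Rightarrow> nat \<Rightarrow> nat" where
  "pplines lam T a = card (line a ` {b \<in> SD lam. T b = letter a})"

definition ppwt :: "'a::comm_ring_1 \<Rightarrow> (nat \<Rightarrow> 'a) \<Rightarrow> nat \<Rightarrow> strict_partition \<Rightarrow> (nat \<times> nat \<Rightarrow> rat) \<Rightarrow> 'a" where
  "ppwt t Y m lam T = t ^ (psize lam - (\<Sum>a<m. pplines lam T (Suc a))) * (\<Prod>a<m. Y a ^ pplines lam T (Suc a))"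

definition pp_sum :: "bool \<Rightarrow> 'a::comm_ring_1 \<Rightarrow> (nat \<Rightarrow> 'a) \<Rightarrow> nat \<Rightarrow> strict_partition \<Rightarrow> 'a" where
  "pp_sum d t Y m lam = (\<Sum>T\<in>pp_upto d m lam. ppwt t Y m lam T)"

text \<open>Ensures that the exponent of \<open>t\<close> in \<open>ppwt\<close> is a true
  difference.\<close>

lemma sum_pplines_le: "(\<Sum>a<m. pplines lam T (Suc a)) \<le> psize lam"
proof -
  have "(\<Sum>a<m. pplines lam T (Suc a)) \<le> (\<Sum>a<m. card {b \<in> SD lam. T b = letter (Suc a)})"
    unfolding pplines_def by (intro sum_mono card_image_le) simp
  also have "\<dots> = card (\<Union>a<m. {b \<in> SD lam. T b = letter (Suc a)})"
    by (rule card_UN_disjoint[symmetric]) auto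
  also have "\<dots> \<le> card (SD lam)" by (rule card_mono) auto
  finally show ?thesis by (simp add: card_SD)
qed

text \<open>The largest letter fills the whole complement of a smaller shape, so a tableau amounts
  to that shape and its restriction to it; in contrast to the set-valued case there is no choice at
  the corners.\<close>

lemma pp_sum_Suc:
  "pp_sum d t Y (Suc m) lam = (\<Sum>mu\<in>{mu. SD mu \<subseteq> SD lam}.
     skewwt (line (Suc m)) (pp_admissible d (Suc m)) (Y m) t lam mu * pp_sum d t Y m mu)"
proof -
  let ?a = "letter (Suc m)"
  let ?M = "{mu. SD mu \<subseteq> SD lam \<and> (\<forall>b\<in>SD lam - SD mu. pp_admissible d (Suc m) b)}"
  let ?i = "\<lambda>(mu, T') b. if b \<in> SD mu then T' b else if b \<in> SD lam then ?a else undefined"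
  let ?D = "\<lambda>T. {b \<in> SD lam. T b \<noteq> ?a}"
  let ?j = "\<lambda>T. (shape (?D T), restrict T (?D T))"
  let ?sk = "skewwt (line (Suc m)) (pp_admissible d (Suc m)) (Y m) t lam"
  let ?w = "\<lambda>(mu, T'). ?sk mu * ppwt t Y m mu T'"
  have "pp_sum d t Y (Suc m) lam = (\<Sum>s\<in>(SIGMA mu:?M. pp_upto d m mu). ?w s)"
    unfolding pp_sum_def
  proof (rule sum.reindex_bij_witness[where i = ?i and j = ?j])
    fix T assume T: "T \<in> pp_upto d (Suc m) lam"
    then have Tp: "T \<in> pp d lam" by (simp add: pp_upto_def)
    have small: "T b \<in> letter ` {1..m}" if "b \<in> ?D T" for b
    proof -
      have "T b \<in> letter ` {1..Suc m}" using T that by (simp add: pp_upto_def)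
      then obtain c where "T b = letter c" "1 \<le> c" "c \<le> Suc m" by auto
      with that show ?thesis by (auto simp: le_Suc_eq)
    qed
    have lt_a: "T b < ?a" if "b \<in> ?D T" for b
    proof -
      obtain c where "T b = letter c" "c \<le> m" using small[OF \<open>b \<in> ?D T\<close>] by auto
      then show ?thesis by (simp add: letter_def)
    qed
    have "\<exists>mu. SD mu = ?D T"
    proof (rule ideal_is_SD)
      show "finite (?D T)" by simp
      show "1 \<le> i \<and> i \<le> k" if "(i, k) \<in> ?D T" for i k using that SD_bounds by blast
      show "(i, k) \<in> ?D T" if h: "(Suc i, k) \<in> ?D T" "1 \<le> i" for i k
      proof -
        have ik: "(i, k) \<in> SD lam" using h SD_up[of i k lam] by simp
        then have "T (i, k) \<le> T (Suc i, k)" using Tp h unfolding pp_iff by blast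
        with lt_a[OF h(1)] ik show ?thesis by auto
      qed
      show "(i, k) \<in> ?D T" if h: "(i, Suc k) \<in> ?D T" "i \<le> k" for i k
      proof -
        have ik: "(i, k) \<in> SD lam" using h SD_left[of i k lam] by simp
        then have "T (i, k) \<le> T (i, Suc k)" using Tp h unfolding pp_iff by blast
        with lt_a[OF h(1)] ik show ?thesis by auto
      qed
    qed
    then obtain mu where mu: "SD mu = ?D T" by blast
    have sh: "shape (?D T) = mu" unfolding mu[symmetric] by simp
    let ?T = "restrict T (?D T)"
    have sub: "SD mu \<subseteq> SD lam" unfolding mu by auto
    have Tmu: "?T b = T b" if "b \<in> SD mu" for b using that by (simp add: mu)
    have ext: "T b = undefined" if "b \<notin> SD lam" for b
      using Tp that unfolding pp_iff by (auto simp: PiE_def extensional_def)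
    show "?i (?j T) = T"
      unfolding sh prod.case mu using ext by (auto simp: fun_eq_iff)
    have adm: "\<forall>b\<in>SD lam - SD mu. pp_admissible d (Suc m) b"
    proof
      fix b assume "b \<in> SD lam - SD mu"
      then have "b \<in> SD lam" "T b = ?a" by (auto simp: mu)
      then show "pp_admissible d (Suc m) b" using Tp unfolding pp_iff by auto
    qed
    have T': "?T \<in> pp_upto d m mu"
      unfolding pp_upto_def mem_Collect_eq
    proof (intro conjI)
      have "?T \<in> SD mu \<rightarrow>\<^sub>E letters"
        using Tp sub unfolding pp_iff by (auto simp: mu PiE_def Pi_def)
      moreover have "pp_admissible d a b" if "1 \<le> a" "b \<in> SD mu" "?T b = letter a" for a b
      proof -
        have "b \<in> SD lam" "T b = letter a" using that(2,3) sub Tmu[OF that(2)] by auto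
        with Tp that(1) show ?thesis unfolding pp_iff by blast
      qed
      moreover have "?T (i, j) \<le> ?T (Suc i, j)" if h: "(i, j) \<in> SD mu" "(Suc i, j) \<in> SD mu" for i j
      proof -
        have "T (i, j) \<le> T (Suc i, j)" using Tp h sub unfolding pp_iff by blast
        then show ?thesis unfolding Tmu[OF h(1)] Tmu[OF h(2)] .
      qed
      moreover have "?T (i, j) \<le> ?T (i, Suc j)" if h: "(i, j) \<in> SD mu" "(i, Suc j) \<in> SD mu" for i j
      proof -
        have "T (i, j) \<le> T (i, Suc j)" using Tp h sub unfolding pp_iff by blast
        then show ?thesis unfolding Tmu[OF h(1)] Tmu[OF h(2)] .
      qed
      ultimately show "?T \<in> pp d mu" unfolding pp_iff by blast
      show "\<forall>b\<in>SD mu. ?T b \<in> letter ` {1..m}"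
      proof
        fix b assume "b \<in> SD mu"
        then show "?T b \<in> letter ` {1..m}" using small[of b] Tmu[of b] by (simp only: mu)
      qed
    qed
    show "?j T \<in> (SIGMA mu:?M. pp_upto d m mu)" unfolding sh using sub adm T' by blast
    show "?w (?j T) = ppwt t Y (Suc m) lam T"
    proof -
      have ls: "pplines lam T (Suc a) = pplines mu ?T (Suc a)" if "a < m" for a
      proof -
        have "{b \<in> SD lam. T b = letter (Suc a)} = {b \<in> SD mu. ?T b = letter (Suc a)}"
          using that sub Tmu by (auto simp: mu)
        then show ?thesis by (simp only: pplines_def)
      qed
      have la: "pplines lam T (Suc m) = card (line (Suc m) ` (SD lam - SD mu))"
        unfolding pplines_def by (intro arg_cong[where f = card] arg_cong2[where f = image] refl) (auto simp: mu)
      have le: "card (line (Suc m) ` (SD lam - SD mu)) \<le> card (SD lam - SD mu)"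
        by (rule card_image_le) simp
      have ps: "psize lam = psize mu + card (SD lam - SD mu)"
        unfolding card_SD[symmetric] using sub by (simp add: card_Diff_subset finite_subset card_mono)
      have "psize lam - (\<Sum>a<Suc m. pplines lam T (Suc a)) =
          (psize mu - (\<Sum>a<m. pplines mu ?T (Suc a))) + (card (SD lam - SD mu) - card (line (Suc m) ` (SD lam - SD mu)))"
        using le ps sum_pplines_le[of mu ?T m] by (simp add: ls la)
      then show ?thesis
        unfolding sh prod.case ppwt_def skewwt_def using sub adm
        by (simp add: ls la power_add mult_ac)
    qed
  next
    fix s assume s: "s \<in> (SIGMA mu:?M. pp_upto d m mu)"
    obtain mu T' where smu: "s = (mu, T')" by (cases s) auto
    from s smu have mu: "SD mu \<subseteq> SD lam" and adm: "\<forall>b\<in>SD lam - SD mu. pp_admissible d (Suc m) b" and T': "T' \<in> pp_upto d m mu" by auto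
    have Tp': "T' \<in> pp d mu" using T' by (simp add: pp_upto_def)
    define T where "T = (\<lambda>b. if b \<in> SD mu then T' b else if b \<in> SD lam then ?a else undefined)"
    have iT: "?i s = T" by (simp add: smu T_def)
    have val: "\<exists>c. T' b = letter c \<and> 1 \<le> c \<and> c \<le> m" if "b \<in> SD mu" for b
      using T' that unfolding pp_upto_def by auto
    have na: "T' b \<noteq> ?a" if "b \<in> SD mu" for b using val[OF that] by auto
    have D: "?D T = SD mu" using mu na by (auto simp: T_def)
    have "restrict T (SD mu) = T'"
    proof
      fix b
      show "restrict T (SD mu) b = T' b"
      proof (cases "b \<in> SD mu")
        case False
        then have "T' b = undefined" using Tp' unfolding pp_iff by (auto simp: PiE_def extensional_def)
        then show ?thesis using False by simp
      qed (simp add: T_def)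
    qed
    then show "?j (?i s) = s" unfolding iT D by (simp add: smu)
    have le_a: "T b \<le> ?a" if "b \<in> SD lam" for b using val[of b] that by (auto simp: T_def)
    have "T \<in> pp d lam"
      unfolding pp_iff
    proof (intro conjI allI impI ballI)
      have "?a \<in> letters" by (auto simp: letters_eq)
      moreover have "T' b \<in> letters" if "b \<in> SD mu" for b using val[OF that] by (auto simp: letters_eq)
      ultimately show "T \<in> SD lam \<rightarrow>\<^sub>E letters" using mu by (auto simp: T_def)
    next
      fix i j assume ij: "(i, j) \<in> SD lam" "(Suc i, j) \<in> SD lam"
      show "T (i, j) \<le> T (Suc i, j)"
      proof (cases "(Suc i, j) \<in> SD mu")
        case True
        then have "(i, j) \<in> SD mu" using SD_up[of i j mu] SD_bounds[OF ij(1)] by simp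
        with True Tp' show ?thesis unfolding pp_iff by (simp add: T_def)
      next
        case False
        then have "T (Suc i, j) = ?a" using ij by (simp add: T_def)
        then show ?thesis using le_a[OF ij(1)] by simp
      qed
    next
      fix i j assume ij: "(i, j) \<in> SD lam" "(i, Suc j) \<in> SD lam"
      show "T (i, j) \<le> T (i, Suc j)"
      proof (cases "(i, Suc j) \<in> SD mu")
        case True
        then have "(i, j) \<in> SD mu" using SD_left[of i j mu] SD_bounds[OF ij(1)] by simp
        with True Tp' show ?thesis unfolding pp_iff by (simp add: T_def)
      next
        case False
        then have "T (i, Suc j) = ?a" using ij by (simp add: T_def)
        then show ?thesis using le_a[OF ij(1)] by simp
      qed
    next
      fix a b assume a: "1 \<le> a" "b \<in> SD lam" "T b = letter a"
      show "pp_admissible d a b"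
      proof (cases "b \<in> SD mu")
        case True
        then have "T' b = letter a" using a by (simp add: T_def)
        then show ?thesis using Tp' True a unfolding pp_iff by blast
      next
        case False
        then have "a = Suc m" using a by (simp add: T_def)
        then show ?thesis using adm a False by blast
      qed
    qed
    moreover have "T b \<in> letter ` {1..Suc m}" if "b \<in> SD lam" for b
      using val[of b] that by (auto simp: T_def)
    ultimately show "?i s \<in> pp_upto d (Suc m) lam" unfolding iT pp_upto_def by blast
  qed
  also have "\<dots> = (\<Sum>mu\<in>?M. \<Sum>T'\<in>pp_upto d m mu. ?sk mu * ppwt t Y m mu T')"
    by (rule sum.Sigma[symmetric]) auto
  also have "\<dots> = (\<Sum>mu\<in>?M. ?sk mu * pp_sum d t Y m mu)"
    by (simp add: pp_sum_def sum_distrib_left)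
  \<comment> \<open>Shapes with an inadmissible complement can be added because their
    \<open>skewwt\<close> is \<open>0\<close>.\<close>
  also have "\<dots> = (\<Sum>mu\<in>{mu. SD mu \<subseteq> SD lam}. ?sk mu * pp_sum d t Y m mu)"
  proof (rule sum.mono_neutral_left)
    show "\<forall>mu\<in>{mu. SD mu \<subseteq> SD lam} - ?M. ?sk mu * pp_sum d t Y m mu = 0"
      by (auto simp: skewwt_def)
  qed auto
  finally show ?thesis .
qed

section \<open>Tableau sums as transfer vectors\<close>

lemma SD_empty_iff: "SD lam = {} \<longleftrightarrow> pset lam = {}"
proof
  assume "SD lam = {}"
  then have "cnt lam 0 = 0" using in_SD_content[of "cnt lam 0" 0 lam] by (cases "cnt lam 0") auto
  then have "\<forall>p\<in>pset lam. \<not> 0 < p" by (simp add: cnt_def)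
  then show "pset lam = {}" using pset_pos by fastforce
qed (auto simp: in_SD cnt_def)

lemma vac_bits:
  assumes "lam \<in> inside n"
  shows "vac (bits n lam) = (if SD lam = {} then 1 else 0)"
proof -
  have "True \<in> set (bits n lam) \<longleftrightarrow> (\<exists>p\<in>pset lam. p \<le> n)" for n
  proof (induction n)
    case 0
    then show ?case using pset_pos[of 0 lam] by (auto dest: pset_pos)
  qed (auto simp: le_Suc_eq)
  then show ?thesis using assms by (auto simp: vac_def SD_empty_iff inside_def)
qed

lemma svt_sum_0: "svt_sum d b X 0 lam = (if SD lam = {} then 1 else 0)"
proof (cases "SD lam = {}")
  case True
  have "svt_upto d 0 lam = {\<lambda>_. {}}" using True by (auto simp: svt_upto_def svt_iff fun_eq_iff)
  moreover have "psize lam = 0" using True card_SD[of lam] by simp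
  ultimately show ?thesis using True by (simp add: svt_sum_def svtwt_def svt_size_def)
next
  case False
  then have "svt_upto d 0 lam = {}" by (auto simp: svt_upto_def svt_iff)
  then show ?thesis using False by (simp add: svt_sum_def)
qed

lemma pp_sum_0: "pp_sum d t Y 0 lam = (if SD lam = {} then 1 else 0)"
proof (cases "SD lam = {}")
  case True
  have "pp_upto d 0 lam = {\<lambda>_. undefined}" using True by (auto simp: pp_upto_def pp_iff)
  moreover have "psize lam = 0" using True card_SD[of lam] by simp
  ultimately show ?thesis using True by (simp add: pp_sum_def ppwt_def)
next
  case False
  then have "pp_upto d 0 lam = {}" by (auto simp: pp_upto_def)
  then show ?thesis using False by (simp add: pp_sum_def)
qed

lemma sum_sub_shapes:
  assumes "lam \<in> inside n" "\<And>mu. \<not> SD mu \<subseteq> SD lam \<Longrightarrow> f mu = 0"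
  shows "(\<Sum>mu\<in>{mu. SD mu \<subseteq> SD lam}. f mu) = (\<Sum>mu\<in>inside n. f mu)"
  by (rule sum.mono_neutral_left) (use assms inside_subset in auto)

text \<open>The letters \<open>Suc (2 * k)\<close> and \<open>Suc (Suc (2 * k))\<close> share the
  variable \<open>x k\<close>; the boxes of the first form a vertical strip, those of the second a
  horizontal one. Every \<open>n\<close> that bounds the parts of \<open>lam\<close> will do, since
  shapes only shrink.\<close>

theorem svt_sum_eq_uvec:
  fixes b :: "'a::comm_ring_1"
  assumes "lam \<in> inside n"
  shows "svt_sum d b (\<lambda>a. x (a div 2)) (2 * k) lam = uvec n (if d then KQ else KP) b x k (bits n lam)"
  using assms
proof (induction k arbitrary: lam)
  case 0
  then show ?case by (simp add: svt_sum_0 uvec_0 vac_bits)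
next
  case (Suc k)
  let ?X = "\<lambda>a. x (a div 2)" and ?q = "1 + b * x k" and ?K = "if d then KQ else KP"
  let ?V = "vadd (x k) ?q (vinit d (x k) ?q) AN" and ?H = "hadd (x k) ?q (hinit (x k) ?q) AN"
  have odd: "svt_sum d b ?X (Suc (2 * k)) kap = rowact n (uvec n ?K b x k) ?V (bits n kap)" if kap: "kap \<in> inside n" for kap
  proof -
    have line: "line (Suc (2 * k)) = fst" "svt_admissible d (Suc (2 * k)) = (\<lambda>b. d \<or> fst b \<noteq> snd b)"
      by (auto simp: line_def svt_admissible_def fun_eq_iff)
    have "svt_sum d b ?X (Suc (2 * k)) kap = (\<Sum>mu\<in>inside n. svt_sum d b ?X (2 * k) mu *
        stripwt fst (\<lambda>b. d \<or> fst b \<noteq> snd b) (x k) ?q mu kap)"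
      unfolding svt_sum_Suc line by (subst sum_sub_shapes[OF kap]) (auto simp: stripwt_def)
    also have "\<dots> = (\<Sum>mu\<in>inside n. uvec n ?K b x k (bits n mu) * ?V (bits n mu) (bits n kap))"
      by (intro sum.cong refl) (simp only: Suc.IH stripwt_vertical[OF _ kap])
    also have "\<dots> = rowact n (uvec n ?K b x k) ?V (bits n kap)"
      unfolding rowact_def by (rule sum_inside)
    finally show ?thesis .
  qed
  have line: "line (Suc (Suc (2 * k))) = snd" "svt_admissible d (Suc (Suc (2 * k))) = (\<lambda>b. True)"
    by (auto simp: line_def svt_admissible_def fun_eq_iff)
  have "svt_sum d b ?X (2 * Suc k) lam = (\<Sum>kap\<in>inside n. svt_sum d b ?X (Suc (2 * k)) kap * stripwt snd (\<lambda>b. True) (x k) ?q kap lam)"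
  proof -
    have "2 * Suc k = Suc (Suc (2 * k))" "Suc (2 * k) div 2 = k" by simp_all
    then show ?thesis
      by (simp only: svt_sum_Suc[of d b ?X "Suc (2 * k)"] line)
        (subst sum_sub_shapes[OF Suc.prems], auto simp: stripwt_def)
  qed
  also have "\<dots> = (\<Sum>kap\<in>inside n. rowact n (uvec n ?K b x k) ?V (bits n kap) * ?H (bits n kap) (bits n lam))"
    by (intro sum.cong refl) (simp only: odd stripwt_horizontal[OF _ Suc.prems])
  also have "\<dots> = rowact n (rowact n (uvec n ?K b x k) ?V) ?H (bits n lam)"
    unfolding rowact_def[of n "rowact n (uvec n ?K b x k) ?V"] by (rule sum_inside)
  also have "\<dots> = rowact n (uvec n ?K b x k) (list_comp ?V ?H) (bits n lam)"
    by (simp add: rowact_list_comp)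
  also have "\<dots> = rowact n (uvec n ?K b x k) (uadd b (x k) (?K b (x k)) UA) (bits n lam)"
  proof (rule rowact_cong[OF refl])
    fix ls :: "bool list" assume "length ls = n"
    then have "length ls = length (bits n lam)" by simp
    from uadd_eq_list_comp[OF this, of "?K b (x k)" "vinit d (x k) ?q" "hinit (x k) ?q" b "x k"]
    show "list_comp ?V ?H ls (bits n lam) = uadd b (x k) (?K b (x k)) UA ls (bits n lam)"
      by (auto simp: vinit_def hinit_def KP_def KQ_def power2_eq_square algebra_simps)
  qed
  finally show ?case by (simp add: uvec_Suc)
qed

text \<open>Dual to \<open>svt_sum_eq_uvec\<close>: the sum is a column vector, and the operator of
  the largest letter, which is removed first, stands on the left.\<close>

theorem pp_sum_eq_dvec:
  fixes t :: "'a::comm_ring_1"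
  assumes "lam \<in> inside n"
  shows "pp_sum d t (\<lambda>a. y (a div 2)) (2 * k) lam = dvec n (of_bool d) t y k (bits n lam)"
  using assms
proof (induction k arbitrary: lam)
  case 0
  then show ?case by (simp add: pp_sum_0 vac_bits)
next
  case (Suc k)
  let ?Y = "\<lambda>a. y (a div 2)" and ?C = "crem (y k) t (of_bool d) 0" and ?R = "rrem (y k) t 1 0"
  let ?dv = "dvec n (of_bool d) t y k"
  have odd: "pp_sum d t ?Y (Suc (2 * k)) kap = (\<Sum>ns\<in>bit_lists n. ?R (bits n kap) ns * ?dv ns)" if kap: "kap \<in> inside n" for kap
  proof -
    have line: "line (Suc (2 * k)) = fst" "pp_admissible d (Suc (2 * k)) = (\<lambda>b. True)"
      by (auto simp: line_def pp_admissible_def fun_eq_iff)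
    have "pp_sum d t ?Y (Suc (2 * k)) kap = (\<Sum>mu\<in>inside n. skewwt fst (\<lambda>b. True) (y k) t kap mu * pp_sum d t ?Y (2 * k) mu)"
      unfolding pp_sum_Suc line by (subst sum_sub_shapes[OF kap]) (auto simp: skewwt_def)
    also have "\<dots> = (\<Sum>mu\<in>inside n. ?R (bits n kap) (bits n mu) * ?dv (bits n mu))"
      by (intro sum.cong refl) (simp only: Suc.IH skewwt_rows[OF _ kap])
    also have "\<dots> = (\<Sum>ns\<in>bit_lists n. ?R (bits n kap) ns * ?dv ns)"
      by (rule sum_inside)
    finally show ?thesis .
  qed
  have line: "line (Suc (Suc (2 * k))) = snd" "pp_admissible d (Suc (Suc (2 * k))) = (\<lambda>b. d \<or> fst b \<noteq> snd b)"
    by (auto simp: line_def pp_admissible_def fun_eq_iff)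
  have "pp_sum d t ?Y (2 * Suc k) lam =
      (\<Sum>kap\<in>inside n. skewwt snd (\<lambda>b. d \<or> fst b \<noteq> snd b) (y k) t lam kap * pp_sum d t ?Y (Suc (2 * k)) kap)"
  proof -
    have "2 * Suc k = Suc (Suc (2 * k))" "Suc (2 * k) div 2 = k" by simp_all
    then show ?thesis
      by (simp only: pp_sum_Suc[of d t ?Y "Suc (2 * k)"] line)
        (subst sum_sub_shapes[OF Suc.prems], auto simp: skewwt_def)
  qed
  also have "\<dots> = (\<Sum>kap\<in>inside n. ?C (bits n lam) (bits n kap) * (\<Sum>ns\<in>bit_lists n. ?R (bits n kap) ns * ?dv ns))"
    by (intro sum.cong refl) (simp only: odd skewwt_cols[OF _ Suc.prems])
  also have "\<dots> = (\<Sum>ks\<in>bit_lists n. ?C (bits n lam) ks * (\<Sum>ns\<in>bit_lists n. ?R ks ns * ?dv ns))"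
    by (rule sum_inside)
  also have "\<dots> = (\<Sum>ks\<in>bit_lists n. \<Sum>ns\<in>bit_lists n. ?C (bits n lam) ks * ?R ks ns * ?dv ns)"
    by (simp add: sum_distrib_left mult.assoc)
  also have "\<dots> = (\<Sum>ns\<in>bit_lists n. \<Sum>ks\<in>bit_lists n. ?C (bits n lam) ks * ?R ks ns * ?dv ns)"
    by (rule sum.swap)
  also have "\<dots> = (\<Sum>ns\<in>bit_lists n. drem (of_bool d) (y k) t (bits n lam) ns * ?dv ns)"
    by (simp add: drem_def list_comp_def sum_distrib_right)
  finally show ?case by simp
qed

section \<open>Formal power series\<close>

lemma coeff_simps [simp]:
  "mps_coeff (0 :: ('v, 'a::comm_ring_1) mps) m = 0"
  "mps_coeff (1 :: ('v, 'a::comm_ring_1) mps) m = (if m = 0 then 1 else 0)"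
  "mps_coeff (f + g) m = mps_coeff f m + mps_coeff (g :: ('v, 'a::comm_ring_1) mps) m"
  "mps_coeff (f - g) m = mps_coeff f m - mps_coeff (g :: ('v, 'a::comm_ring_1) mps) m"
  "mps_coeff (- g) m = - mps_coeff (g :: ('v, 'a::comm_ring_1) mps) m"
  by (simp_all add: zero_mps_def one_mps_def plus_mps_def minus_mps_def uminus_mps_def)

lemma coeff_mult:
  "mps_coeff (f * g) m = (\<Sum>(a, c)\<in>{(a, c). a + c = m}. mps_coeff f a * mps_coeff (g :: ('v, 'a::comm_ring_1) mps) c)"
  by (simp add: times_mps_def)

lemma coeff_sum: "mps_coeff (sum f A) m = (\<Sum>i\<in>A. mps_coeff (f i :: ('v, 'a::comm_ring_1) mps) m)"
  by (induction A rule: infinite_finite_induct) auto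

lemma coeff_const_mult:
  fixes f :: "('v, 'a::comm_ring_1) mps"
  shows "mps_coeff (mps_const c * f) m = c * mps_coeff f m"
proof -
  have "mps_coeff (mps_const c * f) m = (\<Sum>(a, d)\<in>{(0, m)}. mps_coeff (mps_const c :: ('v, 'a) mps) a * mps_coeff f d)"
    unfolding coeff_mult
    by (rule sum.mono_neutral_right) (auto simp: mps_const_def split: if_splits)
  then show ?thesis by (simp add: mps_const_def)
qed

lemma mps_const_mult: "mps_const c * mps_const d = mps_const (c * d)"
  by (rule mps_eqI) (simp add: coeff_const_mult, simp add: mps_const_def)

lemma mps_const_power: "mps_const c ^ k = mps_const (c ^ k)"
  by (induction k) (simp_all add: mps_const_mult, simp add: mps_const_def one_mps_def)

definition mps_monom :: "('v \<Rightarrow>\<^sub>0 nat) \<Rightarrow> ('v, 'a::comm_ring_1) mps" where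
  "mps_monom e = Abs_mps (\<lambda>m. if m = e then 1 else 0)"

lemma coeff_monom [simp]: "mps_coeff (mps_monom e) m = (if m = e then 1 else 0)"
  by (simp add: mps_monom_def)

lemma mps_monom_mult: "mps_monom e * mps_monom e' = mps_monom (e + e')"
proof (rule mps_eqI)
  fix m
  have "mps_coeff (mps_monom e * mps_monom e' :: ('a, 'b) mps) m
      = (\<Sum>(a, c)\<in>(if e + e' = m then {(e, e')} else {}). mps_coeff (mps_monom e :: ('a, 'b) mps) a * mps_coeff (mps_monom e' :: ('a, 'b) mps) c)"
    unfolding coeff_mult by (rule sum.mono_neutral_right) (auto split: if_splits)
  then show "mps_coeff (mps_monom e * mps_monom e' :: ('a, 'b) mps) m = mps_coeff (mps_monom (e + e') :: ('a, 'b) mps) m"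
    by (auto split: if_splits)
qed

lemma mps_monom_0: "mps_monom 0 = 1"
  by (rule mps_eqI) simp

lemma mps_var_power: "mps_var v ^ k = mps_monom (Poly_Mapping.single v k)"
proof (induction k)
  case (Suc k)
  have v: "mps_var v = mps_monom (Poly_Mapping.single v 1)" by (simp add: mps_var_def mps_monom_def)
  show ?case unfolding power_Suc Suc unfolding v mps_monom_mult single_add[symmetric] by simp
qed (simp add: mps_monom_0)

lemma prod_mps_var_power:
  "finite A \<Longrightarrow> (\<Prod>k\<in>A. mps_var (h k) ^ e k) = mps_monom (\<Sum>k\<in>A. Poly_Mapping.single (h k) (e k))"
  by (induction A rule: finite_induct) (simp_all add: mps_monom_0 mps_var_power mps_monom_mult)

lemma tendsto_mpsI:
  assumes "\<And>m. eventually (\<lambda>s. mps_coeff (f s) m = mps_coeff L m) F"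
  shows "(f \<longlongrightarrow> L) F"
proof (rule topological_tendstoI)
  fix S assume "open S" "L \<in> S"
  then obtain M where M: "finite M" "\<forall>g. (\<forall>m\<in>M. mps_coeff g m = mps_coeff L m) \<longrightarrow> g \<in> S"
    by (auto simp: open_mps_def)
  have "eventually (\<lambda>s. \<forall>m\<in>M. mps_coeff (f s) m = mps_coeff L m) F"
    using M(1) assms by (intro eventually_ball_finite) auto
  then show "eventually (\<lambda>s. f s \<in> S) F" by eventually_elim (use M in blast)
qed

lemma has_sum_mps:
  fixes f :: "'i \<Rightarrow> ('v, 'a::comm_ring_1) mps"
  assumes "\<And>m. finite {i \<in> A. mps_coeff (f i) m \<noteq> 0}"
  shows "(f has_sum Abs_mps (\<lambda>m. \<Sum>i\<in>{i \<in> A. mps_coeff (f i) m \<noteq> 0}. mps_coeff (f i) m)) A"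
  unfolding has_sum_def
proof (rule tendsto_mpsI)
  fix m
  let ?B = "{i \<in> A. mps_coeff (f i) m \<noteq> 0}"
  have "eventually (\<lambda>S. finite S \<and> ?B \<subseteq> S \<and> S \<subseteq> A) (finite_subsets_at_top A)"
    unfolding eventually_finite_subsets_at_top using assms by (intro exI[of _ ?B]) auto
  then show "eventually (\<lambda>S. mps_coeff (sum f S) m = mps_coeff (Abs_mps (\<lambda>m. \<Sum>i\<in>{i \<in> A. mps_coeff (f i) m \<noteq> 0}. mps_coeff (f i) m)) m)
    (finite_subsets_at_top A)"
  proof eventually_elim
    case (elim S)
    then have "(\<Sum>i\<in>S. mps_coeff (f i) m) = (\<Sum>i\<in>?B. mps_coeff (f i) m)"
      by (intro sum.mono_neutral_right) auto
    then show ?case by (simp add: coeff_sum)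
  qed
qed

lemma coeff_infsum:
  fixes f :: "'i \<Rightarrow> ('v, 'a::comm_ring_1) mps"
  assumes fin: "\<And>m. finite {i \<in> A. mps_coeff (f i) m \<noteq> 0}"
    and "finite B" "B \<subseteq> A" "\<And>i. i \<in> A - B \<Longrightarrow> mps_coeff (f i) m = 0"
  shows "mps_coeff (infsum f A) m = (\<Sum>i\<in>B. mps_coeff (f i) m)"
proof -
  have "mps_coeff (infsum f A) m = (\<Sum>i\<in>{i \<in> A. mps_coeff (f i) m \<noteq> 0}. mps_coeff (f i) m)"
    using infsumI[OF has_sum_mps[OF fin]] by simp
  also have "\<dots> = (\<Sum>i\<in>B. mps_coeff (f i) m)"
    using assms by (intro sum.mono_neutral_left) auto
  finally show ?thesis .
qed

section \<open>Agreement on sets of monomials, inverses and renaming of variables\<close>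

text \<open>A ring congruence if \<open>S\<close> is closed under divisors.\<close>

definition agree :: "('v \<Rightarrow>\<^sub>0 nat) set \<Rightarrow> ('v, 'a::comm_ring_1) mps \<Rightarrow> ('v, 'a) mps \<Rightarrow> bool" where
  "agree S f g \<longleftrightarrow> (\<forall>m\<in>S. mps_coeff f m = mps_coeff g m)"

lemma agree_refl [simp]: "agree S f f"
  by (simp add: agree_def)

lemma agree_mult:
  assumes "\<And>a c. a + c \<in> S \<Longrightarrow> a \<in> S \<and> c \<in> S" "agree S f f'" "agree S g g'"
  shows "agree S (f * g) (f' * g')"
  unfolding agree_def coeff_mult
proof
  fix m assume m: "m \<in> S"
  show "(\<Sum>(a, c)\<in>{(a, c). a + c = m}. mps_coeff f a * mps_coeff g c) =
      (\<Sum>(a, c)\<in>{(a, c). a + c = m}. mps_coeff f' a * mps_coeff g' c)"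
  proof (rule sum.cong[OF refl])
    fix p assume "p \<in> {(a, c). a + c = m}"
    then obtain a c where p: "p = (a, c)" "a + c = m" by auto
    then have "a \<in> S \<and> c \<in> S" using assms(1)[of a c] m by simp
    then show "(case p of (a, c) \<Rightarrow> mps_coeff f a * mps_coeff g c) = (case p of (a, c) \<Rightarrow> mps_coeff f' a * mps_coeff g' c)"
      using assms(2,3) p by (simp add: agree_def)
  qed
qed

lemma agree_prod:
  assumes "\<And>a c. a + c \<in> S \<Longrightarrow> a \<in> S \<and> c \<in> S" "\<And>i. i \<in> A \<Longrightarrow> agree S (f i) (g i)"
  shows "agree S (prod f A) (prod g A)"
  using assms(2)
proof (induction A rule: infinite_finite_induct)
  case (insert i A)
  then have "agree S (f i * prod f A) (g i * prod g A)" by (intro agree_mult[OF assms(1)]) auto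
  with insert show ?case by simp
qed auto

definition keyset :: "'v set \<Rightarrow> ('v \<Rightarrow>\<^sub>0 nat) set" where
  "keyset V = {m. Poly_Mapping.keys m \<subseteq> V}"

lemma keyset_down: "a + c \<in> keyset V \<Longrightarrow> a \<in> keyset V \<and> c \<in> keyset V"
proof -
  have "Poly_Mapping.keys a \<subseteq> Poly_Mapping.keys (a + c)" "Poly_Mapping.keys c \<subseteq> Poly_Mapping.keys (a + c)"
    by (auto simp: in_keys_iff lookup_add)
  moreover assume "a + c \<in> keyset V"
  ultimately show ?thesis by (auto simp: keyset_def)
qed

lemma agree_var_0: "v \<notin> V \<Longrightarrow> agree (keyset V) (mps_var v) 0"
  by (auto simp: agree_def mps_var_def keyset_def)

definition mdeg :: "('v \<Rightarrow>\<^sub>0 nat) \<Rightarrow> nat" where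
  "mdeg m = (\<Sum>v\<in>Poly_Mapping.keys m. Poly_Mapping.lookup m v)"

lemma mdeg_add: "mdeg (a + c) = mdeg a + mdeg c"
proof -
  let ?K = "Poly_Mapping.keys a \<union> Poly_Mapping.keys c"
  have e: "mdeg m = (\<Sum>v\<in>?K. Poly_Mapping.lookup m v)" if "Poly_Mapping.keys m \<subseteq> ?K" for m :: "'a \<Rightarrow>\<^sub>0 nat"
    unfolding mdeg_def using that by (intro sum.mono_neutral_left) (auto simp: in_keys_iff)
  have "Poly_Mapping.keys (a + c) \<subseteq> ?K" by (rule Poly_Mapping.keys_add)
  then show ?thesis by (simp add: e lookup_add sum.distrib)
qed

lemma mdeg_0_iff: "mdeg m = 0 \<longleftrightarrow> m = 0"
  by (auto simp: mdeg_def in_keys_iff intro!: poly_mapping_eqI)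

text \<open>Geometric series: \<open>f ^ k\<close> has no terms of degree below \<open>k\<close>, so
  the coefficient at \<open>m\<close> needs only the powers up to \<open>mdeg m\<close>. The
  exponents of at most that degree are closed under divisors, which allows \<open>g\<close> to be
  replaced by a single partial sum.\<close>

lemma unit_one_minus:
  fixes f :: "('v, 'a::comm_ring_1) mps"
  assumes "mps_coeff f 0 = 0"
  shows "(1 - f) dvd 1"
proof -
  have pw: "mps_coeff (f ^ k) m = 0" if "mdeg m < k" for k m
    using that
  proof (induction k arbitrary: m)
    case (Suc k)
    have "mps_coeff f a * mps_coeff (f ^ k) c = 0" if "a + c = m" for a c
    proof (cases "a = 0")
      case False
      then have "mdeg c < k" using mdeg_add[of a c] mdeg_0_iff[of a] Suc.prems that by simp
      then show ?thesis using Suc.IH by simp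
    qed (use assms in simp)
    then show ?case unfolding power_Suc coeff_mult by (intro sum.neutral) auto
  qed simp
  define g where "g = Abs_mps (\<lambda>m. mps_coeff (\<Sum>k\<le>mdeg m. f ^ k) m)"
  have "(1 - f) * g = 1"
  proof (rule mps_eqI)
    fix m :: "'v \<Rightarrow>\<^sub>0 nat"
    let ?S = "{a :: 'v \<Rightarrow>\<^sub>0 nat. mdeg a \<le> mdeg m}" and ?G = "\<Sum>k\<le>mdeg m. f ^ k"
    have "agree ?S g ?G"
      unfolding agree_def
    proof
      fix a assume "a \<in> ?S"
      then have "(\<Sum>k\<le>mdeg m. mps_coeff (f ^ k) a) = (\<Sum>k\<le>mdeg a. mps_coeff (f ^ k) a)"
        by (intro sum.mono_neutral_right) (auto intro: pw)
      then show "mps_coeff g a = mps_coeff ?G a" by (simp add: g_def coeff_sum)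
    qed
    then have "agree ?S ((1 - f) * g) ((1 - f) * ?G)"
      by (intro agree_mult) (auto simp: mdeg_add)
    then have "mps_coeff ((1 - f) * g) m = mps_coeff ((1 - f) * ?G) m" by (simp add: agree_def)
    also have "(1 - f) * ?G = 1 - f ^ Suc (mdeg m)"
      using one_diff_power_eq[of f "Suc (mdeg m)"] by (simp add: lessThan_Suc_atMost)
    also have "mps_coeff (1 - f ^ Suc (mdeg m)) m = mps_coeff 1 m" using pw[of m "Suc (mdeg m)"] by (simp del: power_Suc)
    finally show "mps_coeff ((1 - f) * g) m = mps_coeff 1 m" .
  qed
  then show ?thesis by (metis dvd_triv_left)
qed

lemma mult_inverse_mps:
  fixes f :: "('v, 'a::comm_ring_1) mps"
  assumes "f dvd 1"
  shows "f * inverse f = 1"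
proof -
  obtain g where g: "f * g = 1" using assms by (metis dvdE)
  have "(THE g. f * g = 1) = g"
  proof (rule the_equality[of _ g])
    fix g' assume "f * g' = 1"
    then have "g' = g' * (f * g)" using g by simp
    also have "\<dots> = g" using \<open>f * g' = 1\<close> by (metis mult.assoc mult.commute mult.right_neutral)
    finally show "g' = g" .
  qed (rule g)
  then show ?thesis using g assms by (simp add: inverse_mps_def)
qed

lemma lookup_map_key: "inj h \<Longrightarrow> Poly_Mapping.lookup (Poly_Mapping.map_key h m) k = Poly_Mapping.lookup m (h k)"
  by (simp add: map_key.rep_eq)

lemma coeff_rename:
  "mps_coeff (mps_rename h f) M = (if Poly_Mapping.keys M \<subseteq> range h then mps_coeff f (Poly_Mapping.map_key h M) else 0)"
  by (simp add: mps_rename_def)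

lemma lookup_sum_single:
  assumes "finite A" "inj h"
  shows "Poly_Mapping.lookup (\<Sum>k\<in>A. Poly_Mapping.single (h k) (e k)) (h j) = (if j \<in> A then e j else (0::nat))"
proof -
  have "Poly_Mapping.lookup (\<Sum>k\<in>A. Poly_Mapping.single (h k) (e k)) (h j) = (\<Sum>k\<in>A. if k = j then e j else 0)"
    unfolding lookup_sum using assms(2) by (intro sum.cong refl) (auto simp: lookup_single when_def inj_eq)
  then show ?thesis using assms(1) by simp
qed

lemma lookup_sum_single_other:
  assumes "v \<notin> range h"
  shows "Poly_Mapping.lookup (\<Sum>k\<in>A. Poly_Mapping.single (h k) (e k)) v = (0::nat)"
  unfolding lookup_sum using assms by (intro sum.neutral) (auto simp: lookup_single when_def)

lemma Prod_any_monom: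
  fixes e :: "nat \<Rightarrow> nat"
  assumes "finite {k. e k \<noteq> 0}"
  obtains E where "Prod_any (\<lambda>k. mps_var k ^ e k :: (nat, 'a::comm_ring_1) mps) = mps_monom E" "\<And>k. Poly_Mapping.lookup E k = e k"
proof
  let ?E = "\<Sum>k\<in>{k. e k \<noteq> 0}. Poly_Mapping.single (id k) (e k)"
  have "Prod_any (\<lambda>k. mps_var k ^ e k :: (nat, 'a) mps) = (\<Prod>k\<in>{k. e k \<noteq> 0}. mps_var k ^ e k)"
    by (rule Prod_any.expand_superset) (use assms in \<open>auto intro: ccontr\<close>)
  also have "\<dots> = mps_monom ?E" using prod_mps_var_power[OF assms, of id] by simp
  finally show "Prod_any (\<lambda>k. mps_var k ^ e k :: (nat, 'a) mps) = mps_monom ?E" .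
  show "Poly_Mapping.lookup ?E k = e k" for k
    using lookup_sum_single[OF assms, of id e k] by simp
qed

text \<open>Condition \<open>fin\<close> gives summability, because a single exponent involves only
  variables below some \<open>n\<close>.\<close>

lemma coeff_infsum_monomials:
  fixes c :: "'i \<Rightarrow> 'a::comm_ring_1" and oc :: "'i \<Rightarrow> nat \<Rightarrow> nat"
  assumes supp: "\<And>T. T \<in> A \<Longrightarrow> finite {k. oc T k \<noteq> 0}"
    and fin: "\<And>n. finite {T \<in> A. \<forall>k\<ge>n. oc T k = 0}"
  shows "mps_coeff (\<Sum>\<^sub>\<infinity>T\<in>A. mps_const (c T) * Prod_any (\<lambda>k. mps_var k ^ oc T k)) m
    = (\<Sum>T\<in>{T \<in> A. \<forall>k. Poly_Mapping.lookup m k = oc T k}. c T)"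
proof -
  let ?f = "\<lambda>T. mps_const (c T) * Prod_any (\<lambda>k. mps_var k ^ oc T k) :: (nat, 'a) mps"
  let ?B = "\<lambda>m. {T \<in> A. \<forall>k. Poly_Mapping.lookup m k = oc T k}"
  have co: "mps_coeff (?f T) m = (if \<forall>k. Poly_Mapping.lookup m k = oc T k then c T else 0)" if T: "T \<in> A" for T m
  proof -
    obtain E where E: "Prod_any (\<lambda>k. mps_var k ^ oc T k :: (nat, 'a) mps) = mps_monom E"
      and lE: "\<And>k. Poly_Mapping.lookup E k = oc T k"
      by (rule Prod_any_monom[OF supp[OF T]]) blast
    have "m = E \<longleftrightarrow> (\<forall>k. Poly_Mapping.lookup m k = oc T k)"
      by (auto simp: lE intro!: poly_mapping_eqI)
    then show ?thesis by (simp add: E coeff_const_mult)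
  qed
  have finB: "finite (?B m)" for m
  proof -
    obtain n where n: "\<And>k. k \<in> Poly_Mapping.keys m \<Longrightarrow> k < n"
      using finite_keys[of m] unfolding finite_nat_set_iff_bounded by auto
    have "?B m \<subseteq> {T \<in> A. \<forall>k\<ge>n. oc T k = 0}"
    proof clarify
      fix T k assume "T \<in> A" "\<forall>k. Poly_Mapping.lookup m k = oc T k" "n \<le> k"
      moreover have "Poly_Mapping.lookup m k = 0" using n[of k] \<open>n \<le> k\<close> by (auto simp: in_keys_iff)
      ultimately show "oc T k = 0" by simp
    qed
    then show ?thesis using fin by (rule finite_subset)
  qed
  have "mps_coeff (infsum ?f A) m = (\<Sum>T\<in>?B m. mps_coeff (?f T) m)"
  proof (rule coeff_infsum)
    show "finite {i \<in> A. mps_coeff (?f i) m \<noteq> 0}" for m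
      by (rule finite_subset[OF _ finB[of m]]) (auto simp: co split: if_splits)
    show "finite (?B m)" by (rule finB)
    show "?B m \<subseteq> A" by auto
    show "mps_coeff (?f i) m = 0" if i: "i \<in> A - ?B m" for i
    proof -
      have "i \<in> A" "\<not> (\<forall>k. Poly_Mapping.lookup m k = oc i k)" using i by auto
      then show ?thesis by (auto simp: co)
    qed
  qed
  also have "\<dots> = (\<Sum>T\<in>?B m. c T)" by (intro sum.cong refl) (simp add: co)
  finally show ?thesis .
qed

text \<open>Passage from the infinite sum to a polynomial: all variables of \<open>M\<close> in the
  range of \<open>h\<close> have index below \<open>n\<close>, so terms with a variable of index at
  least \<open>n\<close> contribute nothing at \<open>M\<close>.\<close>

lemma coeff_rename_truncate:
  fixes c :: "'i \<Rightarrow> 'a::comm_ring_1" and oc :: "'i \<Rightarrow> nat \<Rightarrow> nat" and h :: "nat \<Rightarrow> 'v"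
  assumes supp: "\<And>T. T \<in> A \<Longrightarrow> finite {k. oc T k \<noteq> 0}"
    and fin: "\<And>n. finite {T \<in> A. \<forall>k\<ge>n. oc T k = 0}"
    and h: "inj h" and M: "\<And>k. h k \<in> Poly_Mapping.keys M \<Longrightarrow> k < n"
  shows "mps_coeff (mps_rename h (\<Sum>\<^sub>\<infinity>T\<in>A. mps_const (c T) * Prod_any (\<lambda>k. mps_var k ^ oc T k))) M
    = mps_coeff (\<Sum>T\<in>{T \<in> A. \<forall>k\<ge>n. oc T k = 0}. mps_const (c T) * (\<Prod>k<n. mps_var (h k) ^ oc T k)) M"
proof -
  let ?A = "{T \<in> A. \<forall>k\<ge>n. oc T k = 0}"
  let ?C = "\<lambda>T. Poly_Mapping.keys M \<subseteq> range h \<and> (\<forall>k. Poly_Mapping.lookup M (h k) = oc T k)"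
  have E: "M = (\<Sum>k<n. Poly_Mapping.single (h k) (oc T k)) \<longleftrightarrow> ?C T" if T: "T \<in> ?A" for T
  proof
    assume eq: "M = (\<Sum>k<n. Poly_Mapping.single (h k) (oc T k))"
    have "Poly_Mapping.lookup M (h k) = oc T k" for k
      unfolding eq using lookup_sum_single[OF _ h, of "{..<n}" "oc T" k] T by auto
    moreover have "Poly_Mapping.keys M \<subseteq> range h"
      unfolding eq using lookup_sum_single_other[of _ h "oc T" "{..<n}"] by (auto simp: in_keys_iff)
    ultimately show "?C T" by simp
  next
    assume C: "?C T"
    show "M = (\<Sum>k<n. Poly_Mapping.single (h k) (oc T k))"
    proof (rule poly_mapping_eqI)
      fix v
      show "Poly_Mapping.lookup M v = Poly_Mapping.lookup (\<Sum>k<n. Poly_Mapping.single (h k) (oc T k)) v"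
      proof (cases "v \<in> range h")
        case True
        then obtain k where "v = h k" by blast
        then show ?thesis using C lookup_sum_single[OF _ h, of "{..<n}" "oc T" k] T by auto
      next
        case False
        then have "v \<notin> Poly_Mapping.keys M" using C by blast
        then show ?thesis using lookup_sum_single_other[OF False, of "oc T" "{..<n}"] by (simp add: in_keys_iff)
      qed
    qed
  qed
  have "mps_coeff (\<Sum>T\<in>?A. mps_const (c T) * (\<Prod>k<n. mps_var (h k) ^ oc T k)) M = (\<Sum>T\<in>?A. if ?C T then c T else 0)"
    unfolding coeff_sum by (intro sum.cong refl) (simp add: coeff_const_mult prod_mps_var_power E)
  also have "\<dots> = (\<Sum>T\<in>{T \<in> ?A. ?C T}. c T)"
    by (rule sum.inter_filter[OF fin[of n], symmetric])
  also have "{T \<in> ?A. ?C T} = {T \<in> A. ?C T}"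
  proof -
    have "oc T k = 0" if "?C T" "n \<le> k" for T k
    proof -
      have "h k \<notin> Poly_Mapping.keys M" using M[of k] that(2) by auto
      then show ?thesis using that(1) by (metis in_keys_iff)
    qed
    then show ?thesis by blast
  qed
  also have "(\<Sum>T\<in>{T \<in> A. ?C T}. c T) =
      mps_coeff (mps_rename h (\<Sum>\<^sub>\<infinity>T\<in>A. mps_const (c T) * Prod_any (\<lambda>k. mps_var k ^ oc T k))) M"
  proof -
    have "mps_coeff (\<Sum>\<^sub>\<infinity>T\<in>A. mps_const (c T) * Prod_any (\<lambda>k. mps_var k ^ oc T k)) m
      = (\<Sum>T\<in>{T \<in> A. \<forall>k. Poly_Mapping.lookup m k = oc T k}. c T)" for m
      by (rule coeff_infsum_monomials) (use supp fin in auto)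
    then show ?thesis by (auto simp: coeff_rename lookup_map_key[OF h])
  qed
  finally show ?thesis by simp
qed

section \<open>The Cauchy identity\<close>

lemma prod_pairs:
  fixes g :: "nat \<Rightarrow> 'a::comm_monoid_mult"
  shows "(\<Prod>a<2 * n. g (a div 2) ^ o' a) = (\<Prod>k<n. g k ^ (o' (Suc (2 * k)) + o' (2 * k)))"
  by (induction n) (simp_all add: power_add mult_ac)

lemma sum_pairs: "(\<Sum>a<2 * n. f a) = (\<Sum>k<n. f (Suc (2 * k)) + f (2 * k :: nat) :: nat)"
  by (induction n) (simp_all add: add_ac)

lemma unprimed_Suc: "unprimed (Suc k) = letter (Suc (Suc (2 * k)))"
  by (simp add: unprimed_letter)

lemma primed_Suc: "primed (Suc k) = letter (Suc (2 * k))"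
  using primed_letter[of "Suc k"] by simp

lemma \<beta>_power: "\<beta> ^ k = mps_const ([:0, 1:] ^ k)"
  by (simp add: \<beta>_def mps_const_power)

lemma neg_\<beta>_power: "(- \<beta> :: ('v, int poly) mps) ^ k = mps_const ((- [:0, 1:]) ^ k)"
proof -
  have "(- \<beta> :: ('v, int poly) mps) = mps_const (- [:0, 1:])"
    by (rule mps_eqI) (simp add: \<beta>_def mps_const_def)
  then show ?thesis by (simp only: mps_const_power)
qed

lemma svt_upto_mono: "m \<le> m' \<Longrightarrow> svt_upto d m lam \<subseteq> svt_upto d m' lam"
proof
  fix T assume "m \<le> m'" "T \<in> svt_upto d m lam"
  moreover have "letter ` {1..m} \<subseteq> letter ` {1..m'}" using \<open>m \<le> m'\<close> by (intro image_mono) auto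
  ultimately show "T \<in> svt_upto d m' lam" unfolding svt_upto_def by blast
qed

lemma svt_bounded: "T \<in> svt d lam \<Longrightarrow> \<exists>n. T \<in> svt_upto d (2 * n) lam"
proof -
  assume T: "T \<in> svt d lam"
  have "\<forall>b\<in>SD lam. finite (T b)" using T unfolding svt_iff by blast
  then have "finite (\<Union>b\<in>SD lam. T b)" by simp
  moreover have "(\<Union>b\<in>SD lam. T b) \<subseteq> letter ` {1..}" using T unfolding svt_iff letters_eq by blast
  ultimately obtain A where A: "A \<subseteq> {1..}" "finite A" "(\<Union>b\<in>SD lam. T b) = letter ` A"
    by (meson finite_subset_image)
  obtain n where n: "\<And>a. a \<in> A \<Longrightarrow> a \<le> n" using A(2) unfolding finite_nat_set_iff_bounded_le by auto
  have "T b \<subseteq> letter ` {1..2 * n}" for b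
  proof (cases "b \<in> SD lam")
    case True
    then have "T b \<subseteq> letter ` A" using A(3) by blast
    also have "\<dots> \<subseteq> letter ` {1..2 * n}"
    proof (rule image_mono, rule subsetI)
      fix a assume "a \<in> A"
      then show "a \<in> {1..2 * n}" using n[of a] A(1) by auto
    qed
    finally show ?thesis .
  next
    case False
    then have "T b = {}" using T unfolding svt_iff by blast
    then show ?thesis by simp
  qed
  then show ?thesis using T unfolding svt_upto_def by blast
qed

definition svt_exponent :: "strict_partition \<Rightarrow> (nat \<times> nat \<Rightarrow> rat set) \<Rightarrow> nat \<Rightarrow> nat" where
  "svt_exponent lam T k = svt_occ lam T (unprimed (Suc k)) + svt_occ lam T (primed (Suc k))"

lemma svt_occ_0_iff: "svt_occ lam T v = 0 \<longleftrightarrow> (\<forall>b\<in>SD lam. v \<notin> T b)"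
  by (auto simp: svt_occ_def)

lemma svt_upto_even: "svt_upto d (2 * n) lam = {T \<in> svt d lam. \<forall>k\<ge>n. svt_exponent lam T k = 0}"
proof (intro set_eqI iffI)
  fix T assume T: "T \<in> svt_upto d (2 * n) lam"
  have "v \<notin> T b" if "v = letter a" "2 * n < a" for v a b
    using svt_upto_sub[OF T, of v b] that by auto
  then have "svt_exponent lam T k = 0" if "n \<le> k" for k
    using that by (simp add: svt_exponent_def svt_occ_0_iff unprimed_Suc primed_Suc)
  then show "T \<in> {T \<in> svt d lam. \<forall>k\<ge>n. svt_exponent lam T k = 0}" using svt_upto_svt[OF T] by simp
next
  fix T assume T: "T \<in> {T \<in> svt d lam. \<forall>k\<ge>n. svt_exponent lam T k = 0}"
  have "T b \<subseteq> letter ` {1..2 * n}" for b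
  proof
    fix v assume v: "v \<in> T b"
    have b: "b \<in> SD lam" "v \<in> letters" using T v unfolding svt_iff mem_Collect_eq by blast+
    then obtain a where a: "v = letter a" "1 \<le> a" by (auto elim: lettersE)
    have "a \<le> 2 * n"
    proof (rule ccontr)
      assume "\<not> a \<le> 2 * n"
      define k where "k = (a - 1) div 2"
      have "n \<le> k" using \<open>\<not> a \<le> 2 * n\<close> by (simp add: k_def)
      then have "svt_exponent lam T k = 0" using T by blast
      moreover have "a = Suc (2 * k) \<or> a = Suc (Suc (2 * k))" using a(2) by (simp add: k_def) presburger
      ultimately show False using v b(1) a(1)
        by (auto simp: svt_exponent_def svt_occ_0_iff unprimed_Suc primed_Suc)
    qed
    then show "v \<in> letter ` {1..2 * n}" using a by auto
  qed
  then show "T \<in> svt_upto d (2 * n) lam" using T unfolding svt_upto_def by blast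
qed

definition GPQ :: "bool \<Rightarrow> strict_partition \<Rightarrow> xseries" where
  "GPQ d lam = (if d then GQ lam else GP lam)"

lemma GPQ_eq: "GPQ d lam = (\<Sum>\<^sub>\<infinity>T\<in>svt d lam. mps_const ([:0, 1:] ^ (svt_size lam T - psize lam)) *
    Prod_any (\<lambda>k. mps_var k ^ svt_exponent lam T k))"
  by (simp add: GPQ_def GP_def GQ_def svt_def svt_monomial_def svt_exponent_def \<beta>_power)

lemma svt_exponent_supp: "T \<in> svt d lam \<Longrightarrow> finite {k. svt_exponent lam T k \<noteq> 0}"
proof -
  assume "T \<in> svt d lam"
  then obtain n where "T \<in> svt_upto d (2 * n) lam" by (elim svt_bounded[THEN exE])
  then have n: "\<forall>k\<ge>n. svt_exponent lam T k = 0" unfolding svt_upto_even by simp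
  have "{k. svt_exponent lam T k \<noteq> 0} \<subseteq> {..<n}"
  proof
    fix k assume "k \<in> {k. svt_exponent lam T k \<noteq> 0}"
    then show "k \<in> {..<n}" using n by (cases "n \<le> k") auto
  qed
  then show ?thesis by (rule finite_subset) simp
qed

lemma finite_svt_exponent: "finite {T \<in> svt d lam. \<forall>k\<ge>n. svt_exponent lam T k = 0}"
  unfolding svt_upto_even[symmetric] by simp

lemma coeff_rename_GPQ:
  assumes "inj h" "\<And>k. h k \<in> Poly_Mapping.keys M \<Longrightarrow> k < n"
  shows "mps_coeff (mps_rename h (GPQ d lam)) M = mps_coeff (svt_sum d \<beta> (\<lambda>a. mps_var (h (a div 2))) (2 * n) lam) M"
proof -
  have "mps_coeff (mps_rename h (GPQ d lam)) M = mps_coeff (\<Sum>T\<in>svt_upto d (2 * n) lam.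
      mps_const ([:0, 1:] ^ (svt_size lam T - psize lam)) * (\<Prod>k<n. mps_var (h k) ^ svt_exponent lam T k)) M"
    unfolding GPQ_eq svt_upto_even
    by (rule coeff_rename_truncate) (use assms svt_exponent_supp finite_svt_exponent in auto)
  also have "(\<Sum>T\<in>svt_upto d (2 * n) lam. mps_const ([:0, 1:] ^ (svt_size lam T - psize lam)) * (\<Prod>k<n. mps_var (h k) ^ svt_exponent lam T k))
      = svt_sum d \<beta> (\<lambda>a. mps_var (h (a div 2))) (2 * n) lam"
    unfolding svt_sum_def svtwt_def
    by (intro sum.cong refl) (simp add: prod_pairs[of "\<lambda>k. mps_var (h k)"] \<beta>_power svt_exponent_def unprimed_Suc primed_Suc)
  finally show ?thesis .
qed

text \<open>Here \<open>d = True\<close> allows unprimed diagonal entries and gives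
  \<open>gq\<close>, so the partner of \<open>GPQ d\<close> is
  \<open>dual_GPQ (\<not> d)\<close>.\<close>

definition dual_GPQ :: "bool \<Rightarrow> strict_partition \<Rightarrow> xseries" where
  "dual_GPQ d lam = (\<Sum>\<^sub>\<infinity>T\<in>pp d lam. (- \<beta>) ^ (psize lam - pp_wt_size lam T) * pp_monomial lam T)"

definition pp_exponent :: "strict_partition \<Rightarrow> (nat \<times> nat \<Rightarrow> rat) \<Rightarrow> nat \<Rightarrow> nat" where
  "pp_exponent lam T k = pp_cols lam T (Suc k) + pp_rows lam T (Suc k)"

lemma pp_exponent_pplines: "pp_exponent lam T k = pplines lam T (Suc (Suc (2 * k))) + pplines lam T (Suc (2 * k))"
proof -
  have "{j. \<exists>i. (i, j) \<in> SD lam \<and> T (i, j) = v} = snd ` {b \<in> SD lam. T b = v}"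
    "{i. \<exists>j. (i, j) \<in> SD lam \<and> T (i, j) = v} = fst ` {b \<in> SD lam. T b = v}" for v
    by force+
  then show ?thesis
    by (simp add: pp_exponent_def pp_cols_def pp_rows_def pplines_def line_def unprimed_Suc primed_Suc)
qed

lemma pplines_0_iff: "pplines lam T a = 0 \<longleftrightarrow> (\<forall>b\<in>SD lam. T b \<noteq> letter a)"
  by (auto simp: pplines_def)

lemma pp_upto_even: "pp_upto d (2 * n) lam = {T \<in> pp d lam. \<forall>k\<ge>n. pp_exponent lam T k = 0}"
proof (intro set_eqI iffI)
  fix T assume T: "T \<in> pp_upto d (2 * n) lam"
  have "T b \<noteq> letter a" if "b \<in> SD lam" "2 * n < a" for a b
  proof
    assume "T b = letter a"
    moreover have "T b \<in> letter ` {1..2 * n}" using T that(1) unfolding pp_upto_def by blast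
    ultimately show False using that(2) by auto
  qed
  then have "pp_exponent lam T k = 0" if "n \<le> k" for k
    using that by (simp add: pp_exponent_pplines pplines_0_iff)
  then show "T \<in> {T \<in> pp d lam. \<forall>k\<ge>n. pp_exponent lam T k = 0}" using T by (simp add: pp_upto_def)
next
  fix T assume T: "T \<in> {T \<in> pp d lam. \<forall>k\<ge>n. pp_exponent lam T k = 0}"
  have "T b \<in> letter ` {1..2 * n}" if b: "b \<in> SD lam" for b
  proof -
    have "T b \<in> letters" using T b unfolding pp_iff mem_Collect_eq by blast
    then obtain a where a: "T b = letter a" "1 \<le> a" by (auto elim: lettersE)
    have "a \<le> 2 * n"
    proof (rule ccontr)
      assume "\<not> a \<le> 2 * n"
      define k where "k = (a - 1) div 2"
      have "n \<le> k" using \<open>\<not> a \<le> 2 * n\<close> by (simp add: k_def)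
      then have "pp_exponent lam T k = 0" using T by blast
      moreover have "a = Suc (2 * k) \<or> a = Suc (Suc (2 * k))" using a(2) by (simp add: k_def) presburger
      ultimately show False using b a(1) by (auto simp: pp_exponent_pplines pplines_0_iff)
    qed
    then show ?thesis using a by auto
  qed
  then show "T \<in> pp_upto d (2 * n) lam" using T unfolding pp_upto_def by blast
qed

lemma pp_bounded: "T \<in> pp d lam \<Longrightarrow> \<exists>n. T \<in> pp_upto d (2 * n) lam"
proof -
  assume T: "T \<in> pp d lam"
  have "T ` SD lam \<subseteq> letter ` {1..}" using T unfolding pp_iff letters_eq by auto
  then obtain A where A: "A \<subseteq> {1..}" "finite A" "T ` SD lam = letter ` A"
    using finite_subset_image[of "T ` SD lam" letter "{1..}"] by auto
  obtain n where n: "\<And>a. a \<in> A \<Longrightarrow> a \<le> n" using A(2) unfolding finite_nat_set_iff_bounded_le by auto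
  have "T b \<in> letter ` {1..2 * n}" if "b \<in> SD lam" for b
  proof -
    have "T b \<in> letter ` A" using A(3) that by blast
    then obtain a where "a \<in> A" "T b = letter a" by blast
    then show ?thesis using n[of a] A(1) by auto
  qed
  then show ?thesis using T unfolding pp_upto_def by blast
qed

lemma pp_exponent_supp: "T \<in> pp d lam \<Longrightarrow> finite {k. pp_exponent lam T k \<noteq> 0}"
proof -
  assume "T \<in> pp d lam"
  then obtain n where "T \<in> pp_upto d (2 * n) lam" by (elim pp_bounded[THEN exE])
  then have n: "\<forall>k\<ge>n. pp_exponent lam T k = 0" unfolding pp_upto_even by simp
  have "{k. pp_exponent lam T k \<noteq> 0} \<subseteq> {..<n}"
  proof
    fix k assume "k \<in> {k. pp_exponent lam T k \<noteq> 0}"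
    then show "k \<in> {..<n}" using n by (cases "n \<le> k") auto
  qed
  then show ?thesis by (rule finite_subset) simp
qed

lemma finite_pp_exponent: "finite {T \<in> pp d lam. \<forall>k\<ge>n. pp_exponent lam T k = 0}"
  unfolding pp_upto_even[symmetric] by simp

lemma pp_wt_size_eq:
  assumes "T \<in> pp_upto d (2 * n) lam"
  shows "pp_wt_size lam T = (\<Sum>a<2 * n. pplines lam T (Suc a))"
proof -
  have n: "\<forall>k\<ge>n. pp_exponent lam T k = 0" using assms unfolding pp_upto_even by simp
  have "{k. pp_exponent lam T k \<noteq> 0} \<subseteq> {..<n}"
  proof
    fix k assume "k \<in> {k. pp_exponent lam T k \<noteq> 0}"
    then show "k \<in> {..<n}" using n by (cases "n \<le> k") auto
  qed
  then have "pp_wt_size lam T = (\<Sum>k<n. pp_exponent lam T k)"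
    unfolding pp_wt_size_def pp_exponent_def[symmetric] by (intro Sum_any.expand_superset) auto
  then show ?thesis by (simp add: sum_pairs pp_exponent_pplines)
qed

lemma coeff_rename_dual_GPQ:
  assumes "inj h" "\<And>k. h k \<in> Poly_Mapping.keys M \<Longrightarrow> k < n"
  shows "mps_coeff (mps_rename h (dual_GPQ d lam)) M = mps_coeff (pp_sum d (- \<beta>) (\<lambda>a. mps_var (h (a div 2))) (2 * n) lam) M"
proof -
  have "mps_coeff (mps_rename h (dual_GPQ d lam)) M = mps_coeff (\<Sum>T\<in>pp_upto d (2 * n) lam.
      mps_const ((- [:0, 1:]) ^ (psize lam - pp_wt_size lam T)) * (\<Prod>k<n. mps_var (h k) ^ pp_exponent lam T k)) M"
    unfolding dual_GPQ_def pp_monomial_def pp_exponent_def[symmetric] neg_\<beta>_power pp_upto_even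
    by (rule coeff_rename_truncate) (use assms pp_exponent_supp finite_pp_exponent in auto)
  also have "(\<Sum>T\<in>pp_upto d (2 * n) lam. mps_const ((- [:0, 1:]) ^ (psize lam - pp_wt_size lam T)) * (\<Prod>k<n. mps_var (h k) ^ pp_exponent lam T k))
      = pp_sum d (- \<beta>) (\<lambda>a. mps_var (h (a div 2))) (2 * n) lam"
    unfolding pp_sum_def ppwt_def
  proof (intro sum.cong refl)
    fix T assume T: "T \<in> pp_upto d (2 * n) lam"
    show "mps_const ((- [:0, 1:]) ^ (psize lam - pp_wt_size lam T)) * (\<Prod>k<n. mps_var (h k) ^ pp_exponent lam T k) =
      (- \<beta>) ^ (psize lam - (\<Sum>a<2 * n. pplines lam T (Suc a))) * (\<Prod>a<2 * n. mps_var (h (a div 2)) ^ pplines lam T (Suc a))"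
      using prod_pairs[of "\<lambda>k. mps_var (h k) :: (_, int poly) mps" "\<lambda>a. pplines lam T (Suc a)" n]
      by (simp only: neg_\<beta>_power pp_wt_size_eq[OF T] pp_exponent_pplines)
  qed
  finally show ?thesis .
qed

section \<open>Order in the variables \<open>x\<close>\<close>

definition xdeg :: "(nat + nat \<Rightarrow>\<^sub>0 nat) \<Rightarrow> nat" where
  "xdeg M = (\<Sum>v\<in>Poly_Mapping.keys M. if isl v then Poly_Mapping.lookup M v else 0)"

lemma xdeg_add: "xdeg (a + c) = xdeg a + xdeg c"
proof -
  let ?K = "Poly_Mapping.keys a \<union> Poly_Mapping.keys c"
  have e: "xdeg m = (\<Sum>v\<in>?K. if isl v then Poly_Mapping.lookup m v else 0)" if "Poly_Mapping.keys m \<subseteq> ?K" for m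
    unfolding xdeg_def using that by (intro sum.mono_neutral_left) (auto simp: in_keys_iff)
  have "Poly_Mapping.keys (a + c) \<subseteq> ?K" by (rule Poly_Mapping.keys_add)
  then show ?thesis by (simp add: e) (simp add: sum.distrib[symmetric] lookup_add if_distrib cong: if_cong)
qed

definition xfilt :: "nat \<Rightarrow> xyseries set" where
  "xfilt d = {f. \<forall>M. xdeg M < d \<longrightarrow> mps_coeff f M = 0}"

interpretation xfilt: filtered_ring xfilt
proof
  show "xfilt 0 = UNIV" "xfilt (Suc d) \<subseteq> xfilt d" "0 \<in> xfilt d" for d by (auto simp: xfilt_def)
  show "f + g \<in> xfilt d" if "f \<in> xfilt d" "g \<in> xfilt d" for f g d using that by (auto simp: xfilt_def)
  show "f * g \<in> xfilt (c + d)" if fg: "f \<in> xfilt c" "g \<in> xfilt d" for f g c d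
    unfolding xfilt_def mem_Collect_eq
  proof (intro allI impI)
    fix M assume M: "xdeg M < c + d"
    show "mps_coeff (f * g) M = 0"
      unfolding coeff_mult
    proof (rule sum.neutral, clarify)
      fix a e assume "M = a + e"
      then have "xdeg a + xdeg e < c + d" using M xdeg_add[of a e] by simp
      then have "xdeg a < c \<or> xdeg e < d" by linarith
      then show "mps_coeff f a * mps_coeff g e = 0" using fg by (auto simp: xfilt_def)
    qed
  qed
qed

lemma xfilt_var: "mps_var (Inl i) \<in> xfilt 1"
  by (auto simp: xfilt_def mps_var_def xdeg_def)

lemma psize_ge: "lam \<in> inside (psize lam)"
  by (auto simp: inside_def pset_def psize_def intro: member_le_sum_list)

lemma finite_psize: "finite {lam. psize lam \<le> n}"
proof (rule finite_subset)
  show "{lam. psize lam \<le> n} \<subseteq> inside n"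
    using psize_ge by (fastforce simp: inside_def)
qed simp

lemma bound_keys:
  fixes M :: "nat + nat \<Rightarrow>\<^sub>0 nat"
  shows "\<exists>n. \<forall>k. Inl k \<in> Poly_Mapping.keys M \<or> Inr k \<in> Poly_Mapping.keys M \<longrightarrow> k < (n::nat)"
proof -
  have "finite ((\<lambda>v. case v of Inl k \<Rightarrow> k | Inr k \<Rightarrow> k) ` Poly_Mapping.keys M)" by simp
  then obtain n where n: "\<forall>x\<in>(\<lambda>v. case v of Inl k \<Rightarrow> k | Inr k \<Rightarrow> k) ` Poly_Mapping.keys M. x < n"
    unfolding finite_nat_set_iff_bounded by blast
  have "k < n" if "Inl k \<in> Poly_Mapping.keys M \<or> Inr k \<in> Poly_Mapping.keys M" for k
    using that
  proof
    assume "Inl k \<in> Poly_Mapping.keys M"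
    from imageI[OF this, of "\<lambda>v. case v of Inl k \<Rightarrow> k | Inr k \<Rightarrow> k"] n show ?thesis by auto
  next
    assume "Inr k \<in> Poly_Mapping.keys M"
    from imageI[OF this, of "\<lambda>v. case v of Inl k \<Rightarrow> k | Inr k \<Rightarrow> k"] n show ?thesis by auto
  qed
  then show ?thesis by blast
qed

lemma inj_Inl_Inr: "inj Inl" "inj Inr"
  by (auto simp: inj_def)

text \<open>Makes the sum over all shapes locally finite: at a given monomial only shapes of size at
  most its degree in \<open>x\<close> contribute.\<close>

lemma in_x_GPQ_order: "in_x (GPQ d lam) \<in> xfilt (psize lam)"
  unfolding xfilt_def mem_Collect_eq
proof (intro allI impI)
  fix M assume M: "xdeg M < psize lam"
  obtain n where n: "\<And>k. Inl k \<in> Poly_Mapping.keys M \<Longrightarrow> k < n" using bound_keys[of M] by blast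
  let ?N = "psize lam"
  have "mps_coeff (in_x (GPQ d lam)) M = mps_coeff (svt_sum d \<beta> (\<lambda>a. mps_var (Inl (a div 2))) (2 * n) lam) M"
    unfolding in_x_def by (rule coeff_rename_GPQ[OF inj_Inl_Inr(1) n])
  also have "svt_sum d \<beta> (\<lambda>a. mps_var (Inl (a div 2))) (2 * n) lam = uvec ?N (if d then KQ else KP) \<beta> (\<lambda>i. mps_var (Inl i)) n (bits ?N lam)"
    using svt_sum_eq_uvec[OF psize_ge, of d \<beta> "\<lambda>i. mps_var (Inl i)" n lam] .
  also have "\<dots> \<in> xfilt (bit_weight (bits ?N lam))"
    by (rule xfilt.uvec_order) (use xfilt_var in auto)
  then have "mps_coeff (uvec ?N (if d then KQ else KP) \<beta> (\<lambda>i. mps_var (Inl i)) n (bits ?N lam)) M = 0"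
    using M by (simp add: bit_weight_bits[OF psize_ge] xfilt_def)
  finally show "mps_coeff (in_x (GPQ d lam)) M = 0" .
qed

lemma coeff_in_x_GPQ_mult_0: "xdeg M < psize lam \<Longrightarrow> mps_coeff (in_x (GPQ d lam) * f) M = 0"
  using xfilt.F_mult_right[OF in_x_GPQ_order[of d lam], of f] by (simp add: xfilt_def)

lemma finite_GPQ_terms: "finite {lam \<in> UNIV. mps_coeff (in_x (GPQ d lam) * f lam) M \<noteq> 0}"
proof (rule finite_subset[OF _ finite_psize[of "xdeg M"]], safe)
  fix lam assume "mps_coeff (in_x (GPQ d lam) * f lam) M \<noteq> 0"
  then show "psize lam \<le> xdeg M" using coeff_in_x_GPQ_mult_0[of M lam d "f lam"] by (meson not_le)
qed

lemma coeff_infsum_GPQ: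
  assumes "xdeg M \<le> n"
  shows "mps_coeff (\<Sum>\<^sub>\<infinity>lam\<in>UNIV. in_x (GPQ d lam) * f lam) M = (\<Sum>lam\<in>inside n. mps_coeff (in_x (GPQ d lam) * f lam) M)"
proof (rule coeff_infsum[OF finite_GPQ_terms])
  show "mps_coeff (in_x (GPQ d lam) * f lam) M = 0" if "lam \<in> UNIV - inside n" for lam
  proof (rule coeff_in_x_GPQ_mult_0)
    show "xdeg M < psize lam" using psize_ge[of lam] that assms by (force simp: inside_def)
  qed
qed auto

section \<open>The Cauchy kernel\<close>

abbreviation xv :: "nat \<Rightarrow> xyseries" where "xv i \<equiv> mps_var (Inl i)"
abbreviation yv :: "nat \<Rightarrow> xyseries" where "yv j \<equiv> mps_var (Inr j)"

definition kernel_factor :: "nat \<Rightarrow> nat \<Rightarrow> xyseries" where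
  "kernel_factor i j = (1 - conj_var (xv i) * yv j) / (1 - xv i * yv j)"

lemma coeff_var_mult_0:
  fixes f :: "('v, 'a::comm_ring_1) mps"
  shows "mps_coeff (mps_var v * f) 0 = 0"
  unfolding coeff_mult
proof (rule sum.neutral, clarify)
  fix a c :: "'v \<Rightarrow>\<^sub>0 nat" assume "a + c = 0"
  then have "a = 0" using mdeg_add[of a c] mdeg_0_iff[of a] mdeg_0_iff[of "a + c"] by simp
  moreover have "Poly_Mapping.single v (1::nat) \<noteq> 0"
    by (metis lookup_single_eq lookup_zero one_neq_zero)
  ultimately show "mps_coeff (mps_var v) a * mps_coeff f c = 0" by (simp add: mps_var_def)
qed

lemma unit_x: "(1 + \<beta> * xv i) * inverse (1 + \<beta> * xv i) = 1"
proof -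
  have "1 + \<beta> * xv i = 1 - xv i * (- \<beta>)" by (simp add: mult.commute)
  then show ?thesis using unit_one_minus[OF coeff_var_mult_0[of "Inl i" "- \<beta>"]] mult_inverse_mps by metis
qed

lemma unit_xy: "(1 - xv i * yv j) * inverse (1 - xv i * yv j) = 1"
  using unit_one_minus[OF coeff_var_mult_0[of "Inl i" "yv j"]] mult_inverse_mps by blast

text \<open>This comes from
  \<open>1 - conj_var x * y = (1 + \<beta> x + x y) / (1 + \<beta> x)\<close>.\<close>

lemma kernel_factor_mult: "kernel_factor i j * ((1 - xv i * yv j) * (1 + \<beta> * xv i)) = 1 + \<beta> * xv i + xv i * yv j"
proof -
  let ?q = "1 + \<beta> * xv i" and ?u = "1 - xv i * yv j"
  have "kernel_factor i j * (?u * ?q) = (1 - (- xv i * inverse ?q) * yv j) * (?u * inverse ?u) * ?q"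
    by (simp add: kernel_factor_def divide_mps_def conj_var_def mult_ac)
  also have "\<dots> = ?q + xv i * yv j * (?q * inverse ?q)"
    unfolding unit_xy by (simp add: algebra_simps)
  finally show ?thesis unfolding unit_x by simp
qed

text \<open>Displays each factor as \<open>1\<close> plus a multiple of \<open>xv i * yv j\<close>,
  so that a factor is invisible at monomials free of one of these variables.\<close>

lemma kernel_factor_minus_1: "kernel_factor i j = 1 + xv i * (yv j * (inverse (1 + \<beta> * xv i) + kernel_factor i j))"
proof -
  let ?q = "1 + \<beta> * xv i" and ?u = "1 - xv i * yv j"
  have "kernel_factor i j * ?u = kernel_factor i j * (?u * ?q) * inverse ?q"
    using unit_x[of i] by (simp add: mult.assoc)
  also have "\<dots> = (?q + xv i * yv j) * inverse ?q" by (simp only: kernel_factor_mult)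
  also have "\<dots> = 1 + xv i * yv j * inverse ?q"
    using unit_x[of i] by (simp add: distrib_right)
  finally have "kernel_factor i j * ?u = 1 + xv i * yv j * inverse ?q" .
  then show ?thesis by (simp add: algebra_simps)
qed

definition box :: "nat \<Rightarrow> (nat + nat \<Rightarrow>\<^sub>0 nat) set" where
  "box n = keyset (Inl ` {..<n} \<union> Inr ` {..<n})"

lemma box_down: "a + c \<in> box n \<Longrightarrow> a \<in> box n \<and> c \<in> box n"
  unfolding box_def by (rule keyset_down)

lemma kernel_factor_agree:
  assumes "n \<le> i \<or> n \<le> j"
  shows "agree (box n) (kernel_factor i j) 1"
proof -
  have "agree (box n) (xv i * (yv j * (inverse (1 + \<beta> * xv i) + kernel_factor i j))) 0"
  proof (cases "n \<le> i")
    case True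
    then have "agree (box n) (xv i) 0" unfolding box_def by (intro agree_var_0) auto
    from agree_mult[OF box_down this agree_refl] show ?thesis by simp
  next
    case False
    then have "agree (box n) (yv j) 0" using assms unfolding box_def by (intro agree_var_0) auto
    from agree_mult[OF box_down agree_refl agree_mult[OF box_down this agree_refl]] show ?thesis by simp
  qed
  then show ?thesis by (subst kernel_factor_minus_1) (simp add: agree_def)
qed

text \<open>At monomials in the first \<open>n\<close> variables of both kinds a factor with an
  index outside this range acts as \<open>1\<close>, so the partial products are eventually constant
  there.\<close>

lemma coeff_cauchy_kernel:
  assumes "M \<in> box n"
  shows "mps_coeff cauchy_kernel M = mps_coeff (\<Prod>(i, j)\<in>{..<n} \<times> {..<n}. kernel_factor i j) M"
proof -
  let ?f = "\<lambda>(i, j). kernel_factor i j" and ?B = "\<lambda>n. {..<n::nat} \<times> {..<n::nat}"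
  have key: "mps_coeff (prod ?f S) M = mps_coeff (prod ?f (?B n)) M" if "finite S" "?B n \<subseteq> S" "M \<in> box n" for S n M
  proof -
    have "agree (box n) (prod ?f (S - ?B n)) (prod (\<lambda>_. 1) (S - ?B n))"
      by (rule agree_prod[OF box_down]) (auto intro: kernel_factor_agree simp: not_less)
    then have "agree (box n) (prod ?f (S - ?B n) * prod ?f (?B n)) (1 * prod ?f (?B n))"
      by (intro agree_mult[OF box_down]) auto
    moreover have "prod ?f (S - ?B n) * prod ?f (?B n) = prod ?f S"
      using that(1,2) by (simp add: prod.subset_diff)
    ultimately show ?thesis using that(3) by (simp add: agree_def)
  qed
  have ex: "\<exists>n. M \<in> box n" for M
  proof -
    obtain n where n: "\<forall>k. Inl k \<in> Poly_Mapping.keys M \<or> Inr k \<in> Poly_Mapping.keys M \<longrightarrow> k < n" using bound_keys by blast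
    have "Poly_Mapping.keys M \<subseteq> Inl ` {..<n} \<union> Inr ` {..<n}"
    proof
      fix v assume "v \<in> Poly_Mapping.keys M"
      then show "v \<in> Inl ` {..<n} \<union> Inr ` {..<n}" using n by (cases v) auto
    qed
    then show ?thesis by (auto simp: box_def keyset_def)
  qed
  define nn where "nn M = (SOME n. M \<in> box n)" for M
  have nn: "M \<in> box (nn M)" for M unfolding nn_def by (rule someI_ex[OF ex])
  define L where "L = Abs_mps (\<lambda>M. mps_coeff (prod ?f (?B (nn M))) M)"
  have "(prod ?f \<longlongrightarrow> L) (finite_subsets_at_top UNIV)"
  proof (rule tendsto_mpsI)
    fix M
    have "eventually (\<lambda>S. finite S \<and> ?B (nn M) \<subseteq> S) (finite_subsets_at_top UNIV)"
      unfolding eventually_finite_subsets_at_top by (intro exI[of _ "?B (nn M)"]) auto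
    then show "eventually (\<lambda>S. mps_coeff (prod ?f S) M = mps_coeff L M) (finite_subsets_at_top UNIV)"
    proof eventually_elim
      case (elim S)
      then show ?case using key[of S "nn M" M] nn by (simp add: L_def)
    qed
  qed
  then have "Lim (finite_subsets_at_top UNIV) (prod ?f) = L"
    by (intro tendsto_Lim) auto
  then have L: "cauchy_kernel = L" by (simp add: cauchy_kernel_def mps_infprod_def kernel_factor_def)
  have "mps_coeff L M = mps_coeff (prod ?f (?B (nn M))) M" by (simp add: L_def)
  \<comment> \<open>The index squares of \<open>nn M\<close> and \<open>n\<close> are compared
    through their union.\<close>
  also have "\<dots> = mps_coeff (prod ?f (?B (nn M) \<union> ?B n)) M"
    using key[of "?B (nn M) \<union> ?B n" "nn M" M] nn by simp
  also have "\<dots> = mps_coeff (prod ?f (?B n)) M"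
    using key[of "?B (nn M) \<union> ?B n" n M] assms by simp
  finally show ?thesis by (simp add: L)
qed

theorem cauchy_identity: "(\<Sum>\<^sub>\<infinity>lam\<in>UNIV. in_x (GPQ d lam) * in_y (dual_GPQ (\<not> d) lam)) = cauchy_kernel"
proof (rule mps_eqI)
  fix M :: "nat + nat \<Rightarrow>\<^sub>0 nat"
  obtain n0 where n0: "\<forall>k. Inl k \<in> Poly_Mapping.keys M \<or> Inr k \<in> Poly_Mapping.keys M \<longrightarrow> k < n0" using bound_keys by blast
  \<comment> \<open>One \<open>n\<close> serves as the number of variables of each kind, the number
    of sites and the precision of the congruence. At \<open>M\<close> the truncation is exact
    because \<open>M\<close> has degree at most \<open>n\<close> in \<open>x\<close>.\<close>
  define n where "n = max n0 (xdeg M)"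
  have keys: "k < n" if "Inl k \<in> Poly_Mapping.keys M \<or> Inr k \<in> Poly_Mapping.keys M" for k
    using that n0 by (auto simp: n_def less_max_iff_disj)
  have Mbox: "M \<in> box n"
    unfolding box_def keyset_def mem_Collect_eq
  proof
    fix v assume "v \<in> Poly_Mapping.keys M"
    then show "v \<in> Inl ` {..<n} \<union> Inr ` {..<n}" using keys by (cases v) auto
  qed
  have xM: "xdeg M \<le> n" by (simp add: n_def)
  let ?K = "if d then KQ else KP" and ?e = "of_bool (\<not> d)"
  let ?v = "uvec n ?K \<beta> xv n" and ?w = "dvec n ?e (- \<beta>) yv n"
  have ag: "agree (box n) (in_x (GPQ d lam) * in_y (dual_GPQ (\<not> d) lam)) (?v (bits n lam) * ?w (bits n lam))"
    if lam: "lam \<in> inside n" for lam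
  proof (rule agree_mult[OF box_down])
    have k: "Inl k \<in> Poly_Mapping.keys M' \<Longrightarrow> k < n" "Inr k \<in> Poly_Mapping.keys M' \<Longrightarrow> k < n" if "M' \<in> box n" for M' k
      using that by (auto simp: box_def keyset_def)
    show "agree (box n) (in_x (GPQ d lam)) (?v (bits n lam))"
      unfolding agree_def
    proof
      fix M' assume M': "M' \<in> box n"
      have "mps_coeff (in_x (GPQ d lam)) M' = mps_coeff (svt_sum d \<beta> (\<lambda>a. xv (a div 2)) (2 * n) lam) M'"
        unfolding in_x_def by (rule coeff_rename_GPQ[OF inj_Inl_Inr(1) k(1)[OF M']])
      then show "mps_coeff (in_x (GPQ d lam)) M' = mps_coeff (?v (bits n lam)) M'"
        by (simp only: svt_sum_eq_uvec[OF lam, where x = xv and k = n and b = \<beta> and d = d])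
    qed
    show "agree (box n) (in_y (dual_GPQ (\<not> d) lam)) (?w (bits n lam))"
      unfolding agree_def
    proof
      fix M' assume M': "M' \<in> box n"
      have "mps_coeff (in_y (dual_GPQ (\<not> d) lam)) M' = mps_coeff (pp_sum (\<not> d) (- \<beta>) (\<lambda>a. yv (a div 2)) (2 * n) lam) M'"
        unfolding in_y_def by (rule coeff_rename_dual_GPQ[OF inj_Inl_Inr(2) k(2)[OF M']])
      then show "mps_coeff (in_y (dual_GPQ (\<not> d) lam)) M' = mps_coeff (?w (bits n lam)) M'"
        by (simp only: pp_sum_eq_dvec[OF lam, where y = yv and k = n and t = "- \<beta>" and d = "\<not> d"])
    qed
  qed
  let ?S = "\<Sum>ls\<in>bit_lists n. ?v ls * ?w ls"
  have "mps_coeff (\<Sum>\<^sub>\<infinity>lam\<in>UNIV. in_x (GPQ d lam) * in_y (dual_GPQ (\<not> d) lam)) M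
      = (\<Sum>lam\<in>inside n. mps_coeff (in_x (GPQ d lam) * in_y (dual_GPQ (\<not> d) lam)) M)"
    by (rule coeff_infsum_GPQ[OF xM])
  also have "\<dots> = (\<Sum>lam\<in>inside n. mps_coeff (?v (bits n lam) * ?w (bits n lam)) M)"
    using ag Mbox by (intro sum.cong refl) (simp add: agree_def)
  also have "\<dots> = mps_coeff ?S M"
    using sum_inside[of "\<lambda>ls. ?v ls * ?w ls" n] by (simp add: coeff_sum[symmetric])
  also have "\<dots> = mps_coeff (\<Prod>(i, j)\<in>{..<n} \<times> {..<n}. kernel_factor i j) M"
  proof -
    let ?P = "\<Prod>j<n. \<Prod>i<n. (1 - xv i * yv j) * (1 + \<beta> * xv i)"
      and ?W = "\<Prod>j<n. \<Prod>i<n. 1 + \<beta> * xv i + xv i * yv j"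
      and ?k = "\<Prod>j<n. \<Prod>i<n. kernel_factor i j"
      and ?I = "\<Prod>j<n. \<Prod>i<n. inverse (1 - xv i * yv j) * inverse (1 + \<beta> * xv i)"
    have "(?e, ?K) = (1, KP) \<or> (?e, ?K) = (0, KQ)" by auto
    from xfilt.truncated_cauchy[of xv, OF xfilt_var this unit_x, of n yv n n]
    have "xfilt.cong n (?P * ?S) ?W" .
    \<comment> \<open>The denominators are removed by multiplying the congruence with their
      inverses, which exist among the power series.\<close>
    from xfilt.cong_mult_left[OF this, of ?I] have c: "xfilt.cong n (?I * (?P * ?S)) (?I * ?W)" .
    have IP: "?I * ?P = 1"
    proof -
      have "inverse (1 - xv i * yv j) * inverse (1 + \<beta> * xv i) * ((1 - xv i * yv j) * (1 + \<beta> * xv i))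
          = ((1 - xv i * yv j) * inverse (1 - xv i * yv j)) * ((1 + \<beta> * xv i) * inverse (1 + \<beta> * xv i))" for i j
        by (simp only: mult_ac)
      then have "inverse (1 - xv i * yv j) * inverse (1 + \<beta> * xv i) * ((1 - xv i * yv j) * (1 + \<beta> * xv i)) = 1" for i j
        by (simp only: unit_x unit_xy mult_1_left)
      then show ?thesis by (simp only: prod.distrib[symmetric] prod.neutral_const)
    qed
    have kP: "?k * ?P = ?W" by (simp only: prod.distrib[symmetric] kernel_factor_mult)
    have 1: "I * (P * S) = S" "I * W = k" if "I * P = 1" "k * P = W" for I P S W k :: xyseries
    proof -
      show "I * (P * S) = S" using that(1) by (simp add: mult.assoc[symmetric])
      have "I * W = k * (I * P)" by (simp add: that(2)[symmetric] mult_ac)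
      then show "I * W = k" by (simp add: that(1))
    qed
    from c have "xfilt.cong n ?S ?k" by (simp only: 1[OF IP kP])
    then have "?S - ?k \<in> xfilt (Suc n)" by (simp add: xfilt.cong_def)
    then have "mps_coeff (?S - ?k) M = 0" using xM unfolding xfilt_def by (simp del: coeff_simps)
    then have "mps_coeff ?S M = mps_coeff ?k M" by simp
    moreover have "?k = (\<Prod>(i, j)\<in>{..<n} \<times> {..<n}. kernel_factor i j)"
      by (subst prod.swap) (simp add: prod.cartesian_product)
    ultimately show ?thesis by simp
  qed
  also have "\<dots> = mps_coeff cauchy_kernel M" by (rule coeff_cauchy_kernel[OF Mbox, symmetric])
  finally show "mps_coeff (\<Sum>\<^sub>\<infinity>lam\<in>UNIV. in_x (GPQ d lam) * in_y (dual_GPQ (\<not> d) lam)) M = mps_coeff cauchy_kernel M" .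
qed

section \<open>Uniqueness of the dual functions\<close>

text \<open>An exponent in both sets of variables splits in exactly one way into an \<open>x\<close>
  part and a \<open>y\<close> part.\<close>

lemma coeff_xy_product:
  "mps_coeff (in_x f * in_y g) M = mps_coeff f (Poly_Mapping.map_key Inl M) * mps_coeff g (Poly_Mapping.map_key Inr M)"
proof -
  define A where "A = (\<Sum>k\<in>Poly_Mapping.keys (Poly_Mapping.map_key Inl M). Poly_Mapping.single (Inl k :: nat + nat) (Poly_Mapping.lookup M (Inl k)))"
  define C where "C = (\<Sum>k\<in>Poly_Mapping.keys (Poly_Mapping.map_key Inr M). Poly_Mapping.single (Inr k :: nat + nat) (Poly_Mapping.lookup M (Inr k)))"
  have A: "Poly_Mapping.lookup A (Inl k) = Poly_Mapping.lookup M (Inl k)" "Poly_Mapping.lookup A (Inr k) = 0" for k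
    unfolding A_def
    using lookup_sum_single[of "Poly_Mapping.keys (Poly_Mapping.map_key Inl M)" "Inl :: nat \<Rightarrow> nat + nat" "\<lambda>k. Poly_Mapping.lookup M (Inl k)" k]
      lookup_sum_single_other[of "Inr k" "Inl :: nat \<Rightarrow> nat + nat" "\<lambda>k. Poly_Mapping.lookup M (Inl k)"]
    by (auto simp: in_keys_iff lookup_map_key[OF inj_Inl_Inr(1)])
  have C: "Poly_Mapping.lookup C (Inr k) = Poly_Mapping.lookup M (Inr k)" "Poly_Mapping.lookup C (Inl k) = 0" for k
    unfolding C_def
    using lookup_sum_single[of "Poly_Mapping.keys (Poly_Mapping.map_key Inr M)" "Inr :: nat \<Rightarrow> nat + nat" "\<lambda>k. Poly_Mapping.lookup M (Inr k)" k]
      lookup_sum_single_other[of "Inl k" "Inr :: nat \<Rightarrow> nat + nat" "\<lambda>k. Poly_Mapping.lookup M (Inr k)"]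
    by (auto simp: in_keys_iff lookup_map_key[OF inj_Inl_Inr(2)])
  have eqI: "m = m'" if "\<And>k. Poly_Mapping.lookup m (Inl k) = Poly_Mapping.lookup m' (Inl k)"
    "\<And>k. Poly_Mapping.lookup m (Inr k) = Poly_Mapping.lookup m' (Inr k)" for m m' :: "nat + nat \<Rightarrow>\<^sub>0 nat"
  proof (rule poly_mapping_eqI)
    fix v show "Poly_Mapping.lookup m v = Poly_Mapping.lookup m' v" using that by (cases v) auto
  qed
  have AC: "A + C = M" by (rule eqI) (simp_all add: lookup_add A C)
  have kA: "Poly_Mapping.keys A \<subseteq> range Inl" and kC: "Poly_Mapping.keys C \<subseteq> range Inr"
  proof -
    show "Poly_Mapping.keys A \<subseteq> range Inl"
    proof
      fix v assume "v \<in> Poly_Mapping.keys A"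
      then show "v \<in> range Inl" by (cases v) (auto simp: in_keys_iff A)
    qed
    show "Poly_Mapping.keys C \<subseteq> range Inr"
    proof
      fix v assume "v \<in> Poly_Mapping.keys C"
      then show "v \<in> range Inr" by (cases v) (auto simp: in_keys_iff C)
    qed
  qed
  have "mps_coeff (in_x f * in_y g) M = (\<Sum>(a, c)\<in>{(A, C)}. mps_coeff (in_x f) a * mps_coeff (in_y g) c)"
    unfolding coeff_mult
  proof (rule sum.mono_neutral_right)
    show "\<forall>p\<in>{(a, c). a + c = M} - {(A, C)}. (case p of (a, c) \<Rightarrow> mps_coeff (in_x f) a * mps_coeff (in_y g) c) = 0"
    proof
      fix p assume p: "p \<in> {(a, c). a + c = M} - {(A, C)}"
      obtain a c where ac: "p = (a, c)" by force
      have M: "a + c = M" "(a, c) \<noteq> (A, C)" using p ac by auto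
      have "\<not> (Poly_Mapping.keys a \<subseteq> range Inl \<and> Poly_Mapping.keys c \<subseteq> range Inr)"
      proof
        assume k: "Poly_Mapping.keys a \<subseteq> range Inl \<and> Poly_Mapping.keys c \<subseteq> range Inr"
        have 0: "Poly_Mapping.lookup a (Inr k) = 0" "Poly_Mapping.lookup c (Inl k) = 0" for k
          using k by (auto simp: in_keys_iff subset_iff)
        have "a = A" by (rule eqI) (simp_all add: A 0 M(1)[symmetric] lookup_add)
        moreover have "c = C" by (rule eqI) (simp_all add: C 0 M(1)[symmetric] lookup_add)
        ultimately show False using M(2) by simp
      qed
      then show "(case p of (a, c) \<Rightarrow> mps_coeff (in_x f) a * mps_coeff (in_y g) c) = 0"
        by (auto simp: ac in_x_def in_y_def coeff_rename)
    qed
  qed (use AC in auto)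
  also have "\<dots> = mps_coeff f (Poly_Mapping.map_key Inl A) * mps_coeff g (Poly_Mapping.map_key Inr C)"
    using kA kC by (simp add: in_x_def in_y_def coeff_rename)
  also have "Poly_Mapping.map_key Inl A = Poly_Mapping.map_key Inl M"
    by (rule poly_mapping_eqI) (simp add: lookup_map_key[OF inj_Inl_Inr(1)] A)
  also have "Poly_Mapping.map_key Inr C = Poly_Mapping.map_key Inr M"
    by (rule poly_mapping_eqI) (simp add: lookup_map_key[OF inj_Inl_Inr(2)] C)
  finally show ?thesis .
qed

lemma xy_exponent:
  fixes mx my :: "nat \<Rightarrow>\<^sub>0 nat"
  shows "\<exists>M. Poly_Mapping.map_key Inl M = mx \<and> Poly_Mapping.map_key Inr M = my"
proof -
  let ?A = "\<Sum>k\<in>Poly_Mapping.keys mx. Poly_Mapping.single (Inl k :: nat + nat) (Poly_Mapping.lookup mx k)"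
  let ?C = "\<Sum>k\<in>Poly_Mapping.keys my. Poly_Mapping.single (Inr k :: nat + nat) (Poly_Mapping.lookup my k)"
  have "Poly_Mapping.map_key Inl (?A + ?C) = mx"
  proof (rule poly_mapping_eqI)
    fix k
    show "Poly_Mapping.lookup (Poly_Mapping.map_key Inl (?A + ?C)) k = Poly_Mapping.lookup mx k"
      using lookup_sum_single[of "Poly_Mapping.keys mx" "Inl :: nat \<Rightarrow> nat + nat" "Poly_Mapping.lookup mx" k]
        lookup_sum_single_other[of "Inl k" Inr "Poly_Mapping.lookup my" "Poly_Mapping.keys my"]
      by (auto simp: lookup_map_key[OF inj_Inl_Inr(1)] lookup_add in_keys_iff)
  qed
  moreover have "Poly_Mapping.map_key Inr (?A + ?C) = my"
  proof (rule poly_mapping_eqI)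
    fix k
    show "Poly_Mapping.lookup (Poly_Mapping.map_key Inr (?A + ?C)) k = Poly_Mapping.lookup my k"
      using lookup_sum_single[of "Poly_Mapping.keys my" "Inr :: nat \<Rightarrow> nat + nat" "Poly_Mapping.lookup my" k]
        lookup_sum_single_other[of "Inr k" Inl "Poly_Mapping.lookup mx" "Poly_Mapping.keys mx"]
      by (auto simp: lookup_map_key[OF inj_Inl_Inr(2)] lookup_add in_keys_iff)
  qed
  ultimately show ?thesis by blast
qed

section \<open>Leading terms and dominance order\<close>

lemma coeff_GPQ:
  "mps_coeff (GPQ d lam) m = (\<Sum>T\<in>{T \<in> svt d lam. \<forall>k. Poly_Mapping.lookup m k = svt_exponent lam T k}. [:0, 1:] ^ (svt_size lam T - psize lam))"
  unfolding GPQ_eq by (rule coeff_infsum_monomials) (use svt_exponent_supp finite_svt_exponent in auto)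

text \<open>An entry of row \<open>i\<close> is at least \<open>i'\<close>, because two consecutive diagonal boxes cannot both be
  filled from \<open>{k', k}\<close>.\<close>

lemma svt_row_bound:
  assumes T: "T \<in> svt d lam" and "letter a \<in> T (i, j)"
  shows "2 * i \<le> Suc a"
proof -
  have mem: "b \<in> SD lam" if "v \<in> T b" for v b using T that unfolding svt_iff by blast
  have val: "\<exists>c. v = letter c \<and> 1 \<le> c" if "v \<in> T b" for v b
  proof -
    have "v \<in> letters" using T that mem[OF that] unfolding svt_iff by blast
    then show ?thesis by (elim lettersE) blast
  qed
  have ne: "T b \<noteq> {}" if "b \<in> SD lam" for b using T that unfolding svt_iff by blast
  have right: "u \<le> v" if "u \<in> T (i, k)" "v \<in> T (i, Suc k)" for u v i k using T that unfolding svt_iff by blast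
  have down: "u \<le> v" if "u \<in> T (i, k)" "v \<in> T (Suc i, k)" for u v i k using T that unfolding svt_iff by blast
  have row: "p = r" if "odd c" "letter c \<in> T p" "letter c \<in> T r" "fst p = fst r" for c p r
  proof -
    have "1 \<le> c" using \<open>odd c\<close> by (cases c) auto
    then have "inj_on (line c) {b. letter c \<in> T b}" using T unfolding svt_iff by blast
    then show ?thesis using that by (auto simp: line_def dest: inj_onD)
  qed
  have col: "p = r" if "even c" "1 \<le> c" "letter c \<in> T p" "letter c \<in> T r" "snd p = snd r" for c p r
  proof -
    have "inj_on (line c) {b. letter c \<in> T b}" using T that(2) unfolding svt_iff by blast
    then show ?thesis using that by (auto simp: line_def dest: inj_onD)
  qed
  have diag: "2 * i \<le> Suc a" if "letter a \<in> T (i, i)" "1 \<le> i" for i a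
    using that
  proof (induction i arbitrary: a)
    case (Suc i)
    show ?case
    proof (cases "i = 0")
      case True
      then show ?thesis using val[OF Suc.prems(1)] by auto
    next
      case False
      then have i: "1 \<le> i" by simp
      have S1: "(i, Suc i) \<in> SD lam" using SD_up[OF mem[OF Suc.prems(1)] i] .
      have S0: "(i, i) \<in> SD lam" using SD_left[OF S1] by simp
      obtain u where u: "u \<in> T (i, Suc i)" using ne[OF S1] by blast
      obtain c where c: "u = letter c" using val[OF u] by blast
      obtain w where w: "w \<in> T (i, i)" using ne[OF S0] by blast
      obtain e where e: "w = letter e" using val[OF w] by blast
      have ec: "e \<le> c" using right[of w i i u] w u c e by simp
      have ca: "c \<le> a" using down[of u i "Suc i" "letter a"] u c Suc.prems(1) by simp
      have ie: "2 * i \<le> Suc e" using Suc.IH[of e] w e i by simp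
      show ?thesis
      proof (rule ccontr)
        assume "\<not> 2 * Suc i \<le> Suc a"
        \<comment> \<open>The entries \<open>e \<le> c \<le> a\<close> of \<open>(i, i)\<close>,
          \<open>(i, Suc i)\<close>, \<open>(Suc i, Suc i)\<close> are confined to
          \<open>2 * i - 1\<close> and \<open>2 * i\<close>; in each case an odd letter repeats in
          row \<open>i\<close> or an even one in column \<open>Suc i\<close>.\<close>
        then have "a = 2 * i - 1 \<and> c = a \<and> e = a \<or> a = 2 * i \<and> c = a \<or> a = 2 * i \<and> c = 2 * i - 1 \<and> e = c"
          using ec ca ie i by arith
        then consider "a = 2 * i - 1" "c = a" "e = a" | "a = 2 * i" "c = a" | "a = 2 * i" "c = 2 * i - 1" "e = c"
          by blast
        then show False
        proof cases
          case 1
          then have "odd a" using i by simp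
          from row[OF this, of "(i, i)" "(i, Suc i)"] 1 w e u c show False by simp
        next
          case 2
          then have "even a" "1 \<le> a" using i by simp_all
          from col[OF this, of "(i, Suc i)" "(Suc i, Suc i)"] 2 u c Suc.prems(1) show False by simp
        next
          case 3
          then have "odd c" using i by simp
          from row[OF this, of "(i, i)" "(i, Suc i)"] 3 w e u c show False by simp
        qed
      qed
    qed
  qed simp
  have step: "2 * i \<le> Suc a" if "letter a \<in> T (i, j)" "i \<le> j" "1 \<le> i" for a
    using that(2,1)
  proof (induction j arbitrary: a rule: dec_induct)
    case base
    then show ?case using diag that(3) by blast
  next
    case (step n)
    have "(i, n) \<in> SD lam" using SD_left[OF mem[OF step.prems]] step.hyps by simp
    then obtain u where u: "u \<in> T (i, n)" using ne by blast
    obtain c where c: "u = letter c" using val[OF u] by blast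
    have "c \<le> a" using right[OF u step.prems] c by simp
    moreover have "2 * i \<le> Suc c" using step.IH u c by blast
    ultimately show ?case by simp
  qed
  show ?thesis using step assms(2) SD_bounds[OF mem[OF assms(2)]] by blast
qed

text \<open>The partial sums of the parts, by which dominance order is defined.\<close>

definition rows_upto :: "strict_partition \<Rightarrow> nat \<Rightarrow> nat" where
  "rows_upto lam k = card {b \<in> SD lam. fst b \<le> k}"

lemma rows_upto_Suc: "rows_upto lam (Suc k) = rows_upto lam k + card {b \<in> SD lam. fst b = Suc k}"
proof -
  have "{b \<in> SD lam. fst b \<le> Suc k} = {b \<in> SD lam. fst b \<le> k} \<union> {b \<in> SD lam. fst b = Suc k}" by auto
  then show ?thesis unfolding rows_upto_def by (simp add: card_Un_disjoint disjoint_iff)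
qed

lemma rows_upto_0: "rows_upto lam 0 = 0"
  using SD_bounds by (fastforce simp: rows_upto_def)

lemma svt_occ_sum: "(\<Sum>a<m. svt_occ lam T (letter (Suc a))) = (\<Sum>b\<in>SD lam. card {a. a < m \<and> letter (Suc a) \<in> T b})"
proof -
  have "(\<Sum>a<m. svt_occ lam T (letter (Suc a))) = (\<Sum>a<m. \<Sum>b\<in>SD lam. if letter (Suc a) \<in> T b then 1 else 0)"
    by (simp add: svt_occ_def sum.If_cases Int_def)
  also have "\<dots> = (\<Sum>b\<in>SD lam. \<Sum>a<m. if letter (Suc a) \<in> T b then 1 else 0)" by (rule sum.swap)
  also have "\<dots> = (\<Sum>b\<in>SD lam. card {a. a < m \<and> letter (Suc a) \<in> T b})"
    by (simp add: sum.If_cases Int_def)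
  finally show ?thesis .
qed

lemma card_letters_le:
  assumes "finite (T b)"
  shows "card {a. a < m \<and> letter (Suc a) \<in> T b} \<le> card (T b)"
proof -
  have "(\<lambda>a. letter (Suc a)) ` {a. a < m \<and> letter (Suc a) \<in> T b} \<subseteq> T b" by auto
  from card_mono[OF assms this] show ?thesis by (simp add: card_image inj_on_def)
qed

lemma svt_exponent_sum: "(\<Sum>k<n. svt_exponent lam T k) = (\<Sum>a<2 * n. svt_occ lam T (letter (Suc a)))"
  by (simp add: sum_pairs svt_exponent_def unprimed_Suc primed_Suc)

lemma svt_size_eq:
  assumes "T \<in> svt_upto d (2 * n) lam"
  shows "svt_size lam T = (\<Sum>k<n. svt_exponent lam T k)"
  unfolding svt_exponent_sum svt_occ_sum svt_size_def
proof (rule sum.cong[OF refl])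
  fix b
  have "T b = (\<lambda>a. letter (Suc a)) ` {a. a < 2 * n \<and> letter (Suc a) \<in> T b}"
  proof
    show "T b \<subseteq> (\<lambda>a. letter (Suc a)) ` {a. a < 2 * n \<and> letter (Suc a) \<in> T b}"
    proof
      fix v assume v: "v \<in> T b"
      then obtain c where c: "v = letter c" "1 \<le> c" "c \<le> 2 * n" using svt_upto_sub[OF assms] by blast
      then obtain a where "c = Suc a" by (cases c) auto
      with c v show "v \<in> (\<lambda>a. letter (Suc a)) ` {a. a < 2 * n \<and> letter (Suc a) \<in> T b}" by auto
    qed
  qed auto
  then show "card (T b) = card {a. a < 2 * n \<and> letter (Suc a) \<in> T b}"
    by (metis (no_types, lifting) card_image inj_onI letter_eq nat.inject)
qed

text \<open>The exponent vector of the leading monomial: the parts of \<open>lam\<close> in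
  decreasing order.\<close>

definition row_content :: "strict_partition \<Rightarrow> nat \<Rightarrow>\<^sub>0 nat" where
  "row_content lam = Abs_poly_mapping (\<lambda>k. card {b \<in> SD lam. fst b = Suc k})"

lemma lookup_row_content: "Poly_Mapping.lookup (row_content lam) k = card {b \<in> SD lam. fst b = Suc k}"
proof -
  have "{k. card {b \<in> SD lam. fst b = Suc k} \<noteq> 0} \<subseteq> (\<lambda>b. fst b - 1) ` SD lam"
  proof
    fix k assume "k \<in> {k. card {b \<in> SD lam. fst b = Suc k} \<noteq> 0}"
    then have "{b \<in> SD lam. fst b = Suc k} \<noteq> {}" by (metis (mono_tags, lifting) card.empty mem_Collect_eq)
    then obtain b where "b \<in> SD lam" "fst b = Suc k" by blast
    then show "k \<in> (\<lambda>b. fst b - 1) ` SD lam" by force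
  qed
  then have "finite {k. card {b \<in> SD lam. fst b = Suc k} \<noteq> 0}" by (rule finite_subset) simp
  then show ?thesis unfolding row_content_def by simp
qed

lemma rows_upto_eq_sum: "rows_upto lam k = (\<Sum>j<k. Poly_Mapping.lookup (row_content lam) j)"
  by (induction k) (simp_all add: rows_upto_0 rows_upto_Suc lookup_row_content)

lemma rows_upto_le: "rows_upto lam k \<le> psize lam"
  unfolding rows_upto_def card_SD[symmetric] by (rule card_mono) auto

lemma rows_upto_psize: "psize lam \<le> k \<Longrightarrow> rows_upto lam k = psize lam"
proof -
  assume k: "psize lam \<le> k"
  have "fst b \<le> k" if "b \<in> SD lam" for b
  proof -
    obtain i j where b: "b = (i, j)" by force
    have i: "i \<le> cnt lam 0" using that cnt_antimono[of 0 "j - i" lam] by (simp add: b in_SD)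
    have "(\<lambda>i. (i, i + 0)) ` {1..i} \<subseteq> SD lam"
    proof (rule image_subsetI)
      fix i' assume "i' \<in> {1..i}"
      then show "(i', i' + 0) \<in> SD lam" unfolding in_SD_content using i by auto
    qed
    from card_mono[OF finite_SD this] show ?thesis using k by (simp add: b card_SD card_image inj_on_def)
  qed
  then have "{b \<in> SD lam. fst b \<le> k} = SD lam" by auto
  then show ?thesis by (simp add: rows_upto_def card_SD)
qed

lemma row_content_inject:
  assumes "\<And>k. card {b \<in> SD lam. fst b = Suc k} = card {b \<in> SD mu. fst b = Suc k}"
  shows "lam = mu"
proof -
  have row: "(i, i + c) \<in> SD nu \<longleftrightarrow> 1 \<le> i \<and> c < card {b \<in> SD nu. fst b = i}" for i c nu
  proof -
    let ?R = "{c. (i, i + c) \<in> SD nu}"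
    have "{b \<in> SD nu. fst b = i} = (\<lambda>c. (i, i + c)) ` ?R"
    proof
      show "{b \<in> SD nu. fst b = i} \<subseteq> (\<lambda>c. (i, i + c)) ` ?R"
      proof clarify
        fix a k assume "(a, k) \<in> SD nu" "i = fst (a, k)"
        then show "(a, k) \<in> (\<lambda>c. (fst (a, k), fst (a, k) + c)) ` {c. (fst (a, k), fst (a, k) + c) \<in> SD nu}"
          using SD_bounds[of a k nu] by (intro image_eqI[of _ _ "k - a"]) auto
      qed
    qed auto
    then have card: "card {b \<in> SD nu. fst b = i} = card ?R" by (simp add: card_image inj_on_def)
    have fin: "finite ?R"
      by (rule finite_subset[of _ "(\<lambda>b. snd b - fst b) ` SD nu"]) (force, simp)
    have down: "c' \<in> ?R" if "c \<in> ?R" "c' \<le> c" for c c'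
      using that cnt_antimono[of c' c nu] by (simp add: in_SD)
    have R: "?R = {..<card ?R}"
    proof -
      have sub: "{..c} \<subseteq> ?R" if "c \<in> ?R" for c using down[OF that] by blast
      have "c < card ?R" if "c \<in> ?R" for c using card_mono[OF fin sub[OF that]] by simp
      then have "?R \<subseteq> {..<card ?R}" by blast
      then show ?thesis by (intro card_subset_eq) simp_all
    qed
    have "c \<in> ?R \<longleftrightarrow> c < card ?R" using R by blast
    then show ?thesis using card SD_bounds[of i "i + c" nu] by auto
  qed
  have "(i, k) \<in> SD lam \<longleftrightarrow> (i, k) \<in> SD mu" for i k
  proof (cases "1 \<le> i \<and> i \<le> k")
    case True
    then obtain j where "i = Suc j" by (cases i) auto
    then show ?thesis using row[of i "k - i" lam] row[of i "k - i" mu] assms[of j] True by simp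
  next
    case False
    then show ?thesis using SD_bounds by blast
  qed
  then have "SD lam = SD mu" by auto
  then show ?thesis by (rule SD_inject)
qed

text \<open>Equal size forces one letter per box. By \<open>svt_row_bound\<close> the letters up to
  \<open>k\<close> then sit in the first \<open>k\<close> rows of \<open>mu\<close>, so there are at
  most as many of them as boxes there.\<close>

lemma GPQ_dominance:
  assumes "mps_coeff (GPQ d mu) (row_content lam) \<noteq> 0" "psize mu = psize lam"
  shows "rows_upto lam k \<le> rows_upto mu k"
proof -
  from assms(1) obtain T where T: "T \<in> svt d mu" "\<And>k. Poly_Mapping.lookup (row_content lam) k = svt_exponent mu T k"
    unfolding coeff_GPQ by (metis (mono_tags, lifting) mem_Collect_eq sum.not_neutral_contains_not_neutral)
  obtain n0 where "T \<in> svt_upto d (2 * n0) mu" by (rule exE[OF svt_bounded[OF T(1)]])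
  then have Tn: "T \<in> svt_upto d (2 * (n0 + psize lam)) mu" using svt_upto_mono[of "2 * n0" "2 * (n0 + psize lam)"] by auto
  have "svt_size mu T = rows_upto lam (n0 + psize lam)"
    by (simp add: svt_size_eq[OF Tn] rows_upto_eq_sum T(2))
  also have "\<dots> = psize mu" using rows_upto_psize[of lam "n0 + psize lam"] assms(2) by simp
  finally have size: "(\<Sum>b\<in>SD mu. card (T b)) = (\<Sum>b\<in>SD mu. 1)" by (simp add: svt_size_def card_SD)
  have fin: "finite (T b)" "1 \<le> card (T b)" if "b \<in> SD mu" for b
    using T(1) that unfolding svt_iff by (auto simp: Suc_le_eq card_gt_0_iff)
  have one: "card (T b) = 1" if "b \<in> SD mu" for b
  proof (rule ccontr)
    assume "card (T b) \<noteq> 1"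
    then have "1 < card (T b)" using fin[OF that] by simp
    then have "(\<Sum>b\<in>SD mu. 1) < (\<Sum>b\<in>SD mu. card (T b))"
      using fin that by (intro sum_strict_mono_ex1) auto
    then show False using size by simp
  qed
  have "rows_upto lam k = (\<Sum>b\<in>SD mu. card {a. a < 2 * k \<and> letter (Suc a) \<in> T b})"
    by (simp add: rows_upto_eq_sum T(2) svt_exponent_sum svt_occ_sum)
  also have "\<dots> \<le> (\<Sum>b\<in>SD mu. if fst b \<le> k then 1 else 0)"
  proof (rule sum_mono)
    fix b assume b: "b \<in> SD mu"
    obtain i j where ij: "b = (i, j)" by force
    show "card {a. a < 2 * k \<and> letter (Suc a) \<in> T b} \<le> (if fst b \<le> k then 1 else 0)"
    proof (cases "fst b \<le> k")
      case True
      then show ?thesis using card_letters_le[of T b "2 * k"] fin(1)[OF b] one[OF b] by simp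
    next
      case False
      have "{a. a < 2 * k \<and> letter (Suc a) \<in> T b} = {}"
      proof (rule ccontr)
        assume "{a. a < 2 * k \<and> letter (Suc a) \<in> T b} \<noteq> {}"
        then obtain a where a: "a < 2 * k" "letter (Suc a) \<in> T (i, j)" by (auto simp: ij)
        from svt_row_bound[OF T(1) a(2)] a(1) False show False by (simp add: ij)
      qed
      then show ?thesis by (simp only: card.empty le0)
    qed
  qed
  also have "\<dots> = rows_upto mu k"
    by (simp add: rows_upto_def sum.If_cases Int_def)
  finally show ?thesis .
qed

text \<open>All tableaux involved have one letter per box, so no power of \<beta> occurs and the
  coefficient is a number of tableaux, without cancellation. Filling row \<open>i\<close> with
  \<open>i\<close> provides one.\<close>

lemma GPQ_diagonal: "mps_coeff (GPQ d lam) (row_content lam) \<noteq> 0"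
proof -
  let ?S = "{T \<in> svt d lam. \<forall>k. Poly_Mapping.lookup (row_content lam) k = svt_exponent lam T k}"
  have e: "svt_size lam T = psize lam" if TS: "T \<in> ?S" for T
  proof -
    have "T \<in> svt d lam" using TS by simp
    then obtain n0 where "T \<in> svt_upto d (2 * n0) lam" by (elim svt_bounded[THEN exE])
    then have Tn: "T \<in> svt_upto d (2 * (n0 + psize lam)) lam" using svt_upto_mono[of "2 * n0" "2 * (n0 + psize lam)"] by auto
    have "svt_size lam T = rows_upto lam (n0 + psize lam)"
      using TS by (simp add: svt_size_eq[OF Tn] rows_upto_eq_sum)
    then show ?thesis using rows_upto_psize[of lam "n0 + psize lam"] by simp
  qed
  have "mps_coeff (GPQ d lam) (row_content lam) = of_nat (card ?S)"
    unfolding coeff_GPQ using e by simp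
  moreover have "card ?S \<noteq> 0"
  proof -
    \<comment> \<open>All entries are unprimed, so the witness serves for both values of
      \<open>d\<close>.\<close>
    define T where "T b = (if b \<in> SD lam then {letter (2 * fst b)} else {})" for b
    have "T \<in> svt d lam"
      unfolding svt_iff
    proof (intro conjI allI impI ballI)
      fix b assume b: "b \<in> SD lam"
      have "1 \<le> fst b" using b SD_bounds[of "fst b" "snd b" lam] by simp
      then show "T b \<noteq> {}" "finite (T b)" "T b \<subseteq> letters" using b by (auto simp: T_def letters_eq)
    next
      fix a :: nat
      show "inj_on (line a) {b. letter a \<in> T b}"
      proof (rule inj_onI)
        fix p r assume "p \<in> {b. letter a \<in> T b}" "r \<in> {b. letter a \<in> T b}" and l: "line a p = line a r"
        then have "a = 2 * fst p" "a = 2 * fst r" by (auto simp: T_def split: if_splits)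
        with l show "p = r" by (auto simp: line_def prod_eq_iff)
      qed
      show "svt_admissible d a b" if "letter a \<in> T b" for b using that by (auto simp: T_def svt_admissible_def split: if_splits)
    qed (auto simp: T_def split: if_splits)
    moreover have "Poly_Mapping.lookup (row_content lam) k = svt_exponent lam T k" for k
    proof -
      have "{b \<in> SD lam. letter (Suc (Suc (2 * k))) \<in> T b} = {b \<in> SD lam. fst b = Suc k}"
        "{b \<in> SD lam. letter (Suc (2 * k)) \<in> T b} = {}"
        by (auto simp: T_def) presburger
      then show ?thesis by (simp only: lookup_row_content svt_exponent_def unprimed_Suc primed_Suc svt_occ_def) simp
    qed
    ultimately have "T \<in> ?S" by simp
    moreover have "finite ?S"
    proof -
      obtain n where n: "\<And>k. k \<in> Poly_Mapping.keys (row_content lam) \<Longrightarrow> k < n"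
        using finite_keys[of "row_content lam"] unfolding finite_nat_set_iff_bounded by auto
      have "svt_exponent lam T k = 0" if "T \<in> ?S" "n \<le> k" for T k
      proof -
        have "k \<notin> Poly_Mapping.keys (row_content lam)" using n[of k] that(2) by auto
        then show ?thesis using that(1) by (simp add: in_keys_iff)
      qed
      then have "?S \<subseteq> {T \<in> svt d lam. \<forall>k\<ge>n. svt_exponent lam T k = 0}" by blast
      then show ?thesis using finite_svt_exponent by (rule finite_subset)
    qed
    ultimately show ?thesis by (metis card_0_eq empty_iff)
  qed
  ultimately show ?thesis by simp
qed

text \<open>Triangularity: fix a \<open>y\<close> monomial at which the two families differ, take
  the shapes of least size whose coefficients differ there, and among them a maximal one in
  dominance order, \<open>lam\<close>. At the monomial \<open>row_content lam\<close> no other shape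
  contributes: smaller ones do not differ, larger ones start in higher degree, and one of equal size
  would dominate \<open>lam\<close>.\<close>

theorem GPQ_independent:
  assumes eq: "(\<Sum>\<^sub>\<infinity>lam\<in>UNIV. in_x (GPQ d lam) * in_y (g lam)) = (\<Sum>\<^sub>\<infinity>lam\<in>UNIV. in_x (GPQ d lam) * in_y (g' lam))"
  shows "g = g'"
proof (rule ccontr)
  assume "g \<noteq> g'"
  define h where "h lam = g lam - g' lam" for lam
  obtain lam0 where "g lam0 \<noteq> g' lam0" using \<open>g \<noteq> g'\<close> by (auto simp: fun_eq_iff)
  then obtain my where my: "mps_coeff (h lam0) my \<noteq> 0" by (auto simp: mps_eq_iff h_def)
  have zero: "(\<Sum>lam\<in>inside n. mps_coeff (GPQ d lam) mx * mps_coeff (h lam) my) = 0"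
    if n: "\<And>M. Poly_Mapping.map_key Inl M = mx \<Longrightarrow> xdeg M \<le> n" for mx n
  proof -
    obtain M where M: "Poly_Mapping.map_key Inl M = mx" "Poly_Mapping.map_key Inr M = my"
      using xy_exponent by blast
    have "(\<Sum>lam\<in>inside n. mps_coeff (in_x (GPQ d lam) * in_y (g lam)) M)
        = (\<Sum>lam\<in>inside n. mps_coeff (in_x (GPQ d lam) * in_y (g' lam)) M)"
      using arg_cong[OF eq, of "\<lambda>f. mps_coeff f M"] by (simp only: coeff_infsum_GPQ[OF n[OF M(1)]])
    then show ?thesis
      by (simp add: coeff_xy_product M h_def right_diff_distrib sum_subtractf)
  qed
  define A where "A = {lam. mps_coeff (h lam) my \<noteq> 0}"
  define n where "n = (LEAST n. \<exists>lam\<in>A. psize lam = n)"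
  have "\<exists>lam\<in>A. psize lam = n"
    unfolding n_def by (rule LeastI[of _ "psize lam0"]) (use my in \<open>auto simp: A_def\<close>)
  \<comment> \<open>\<open>A\<close> may be infinite, but its shapes of least size form a finite
    set, on which a maximum exists.\<close>
  define B where "B = {lam \<in> A. psize lam = n}"
  have nmin: "n \<le> psize lam" if "lam \<in> A" for lam
    unfolding n_def by (rule Least_le) (use that in blast)
  have finB: "finite B" by (rule finite_subset[OF _ finite_psize[of n]]) (auto simp: B_def)
  have Bne: "B \<noteq> {}" using \<open>\<exists>lam\<in>A. psize lam = n\<close> by (auto simp: B_def)
  \<comment> \<open>\<open>Phi\<close> is strictly increasing in dominance order.\<close>
  define Phi where "Phi lam = (\<Sum>k\<le>n. rows_upto lam k)" for lam
  have "Max (Phi ` B) \<in> Phi ` B" by (rule Max_in) (use finB Bne in auto)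
  then obtain lam where lamB: "lam \<in> B" and "Phi lam = Max (Phi ` B)" by auto
  then have max: "Phi mu \<le> Phi lam" if "mu \<in> B" for mu using that finB by simp
  have pl: "psize lam = n" using lamB by (simp add: B_def)
  let ?mx = "row_content lam"
  \<comment> \<open>All \<open>M\<close> with this \<open>x\<close> part have the same degree in
    \<open>x\<close>, whatever their \<open>y\<close> part, so a common bound exists.\<close>
  obtain N0 where N0: "xdeg M \<le> N0" if "Poly_Mapping.map_key Inl M = ?mx" for M
  proof -
    have "xdeg M = mdeg ?mx" if M: "Poly_Mapping.map_key Inl M = ?mx" for M
    proof -
      have "Poly_Mapping.keys M \<inter> {v. isl v} = Inl ` Poly_Mapping.keys ?mx"
      proof (intro set_eqI iffI)
        fix v :: "nat + nat" assume "v \<in> Poly_Mapping.keys M \<inter> {v. isl v}"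
        then obtain k where "v = Inl k" "Inl k \<in> Poly_Mapping.keys M" by (cases v) auto
        then show "v \<in> Inl ` Poly_Mapping.keys ?mx"
          unfolding M[symmetric] by (simp add: in_keys_iff lookup_map_key[OF inj_Inl_Inr(1)])
      next
        fix v :: "nat + nat" assume "v \<in> Inl ` Poly_Mapping.keys ?mx"
        then show "v \<in> Poly_Mapping.keys M \<inter> {v. isl v}"
          unfolding M[symmetric] by (auto simp: in_keys_iff lookup_map_key[OF inj_Inl_Inr(1)])
      qed
      then have "xdeg M = (\<Sum>v\<in>Inl ` Poly_Mapping.keys ?mx. Poly_Mapping.lookup M v)"
        unfolding xdeg_def by (simp add: sum.If_cases)
      also have "\<dots> = mdeg ?mx"
        unfolding mdeg_def using lookup_map_key[OF inj_Inl_Inr(1), of M] M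
        by (subst sum.reindex) (auto simp: inj_on_def)
      finally show ?thesis .
    qed
    then show ?thesis using that[of "mdeg ?mx"] by simp
  qed
  define N where "N = max N0 n"
  have lamN: "lam \<in> inside N" using psize_ge[of lam] pl by (force simp: inside_def N_def)
  have other: "mps_coeff (GPQ d mu) ?mx * mps_coeff (h mu) my = 0" if "mu \<noteq> lam" for mu
  proof (rule ccontr)
    assume "mps_coeff (GPQ d mu) ?mx * mps_coeff (h mu) my \<noteq> 0"
    then have c: "mps_coeff (GPQ d mu) ?mx \<noteq> 0" and "mu \<in> A" by (auto simp: A_def)
    from c obtain T where T: "T \<in> svt d mu" "\<And>k. Poly_Mapping.lookup ?mx k = svt_exponent mu T k"
      unfolding coeff_GPQ by (metis (mono_tags, lifting) mem_Collect_eq sum.not_neutral_contains_not_neutral)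
    obtain n0 where "T \<in> svt_upto d (2 * n0) mu" by (rule exE[OF svt_bounded[OF T(1)]])
    then have "svt_size mu T = rows_upto lam n0" by (simp add: svt_size_eq rows_upto_eq_sum T(2))
    then have "psize mu \<le> n" using psize_le_svt_size[OF T(1)] rows_upto_le[of lam n0] pl by simp
    then have pm: "psize mu = n" using nmin[OF \<open>mu \<in> A\<close>] by simp
    then have "mu \<in> B" using \<open>mu \<in> A\<close> by (simp add: B_def)
    have dom: "rows_upto lam k \<le> rows_upto mu k" for k
      by (rule GPQ_dominance[OF c]) (simp add: pm pl)
    have eqk: "rows_upto lam k = rows_upto mu k" for k
    proof (cases "k \<le> n")
      case True
      show ?thesis
      proof (rule ccontr)
        assume "rows_upto lam k \<noteq> rows_upto mu k"
        then have "rows_upto lam k < rows_upto mu k" using dom[of k] by simp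
        then have "Phi lam < Phi mu" unfolding Phi_def using dom True by (intro sum_strict_mono_ex1) auto
        then show False using max[OF \<open>mu \<in> B\<close>] by simp
      qed
    next
      case False
      then show ?thesis using rows_upto_psize[of lam k] rows_upto_psize[of mu k] pl pm by simp
    qed
    have "lam = mu"
    proof (rule row_content_inject)
      fix k
      show "card {b \<in> SD lam. fst b = Suc k} = card {b \<in> SD mu. fst b = Suc k}"
        using eqk[of k] eqk[of "Suc k"] by (simp add: rows_upto_Suc)
    qed
    then show False using that by simp
  qed
  have "(\<Sum>mu\<in>inside N. mps_coeff (GPQ d mu) ?mx * mps_coeff (h mu) my) = mps_coeff (GPQ d lam) ?mx * mps_coeff (h lam) my"
    using sum.mono_neutral_right[of "inside N" "{lam}" "\<lambda>mu. mps_coeff (GPQ d mu) ?mx * mps_coeff (h mu) my"] lamN other by auto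
  moreover have "(\<Sum>mu\<in>inside N. mps_coeff (GPQ d mu) ?mx * mps_coeff (h mu) my) = 0"
    by (rule zero) (use N0 in \<open>force simp: N_def le_max_iff_disj\<close>)
  ultimately have "mps_coeff (GPQ d lam) ?mx * mps_coeff (h lam) my = 0" by simp
  then show False using GPQ_diagonal[of d lam] lamB by (simp add: B_def A_def)
qed

theorem theorem1p4:
  fixes lam :: strict_partition
  shows "gp lam = (\<Sum>\<^sub>\<infinity>T\<in>ShPP_P lam. (- \<beta>) ^ (psize lam - pp_wt_size lam T) * pp_monomial lam T)
       \<and> gq lam = (\<Sum>\<^sub>\<infinity>T\<in>ShPP_Q lam. (- \<beta>) ^ (psize lam - pp_wt_size lam T) * pp_monomial lam T)"
proof -
  have dual: "(THE g. (\<Sum>\<^sub>\<infinity>lam\<in>UNIV. in_x (GPQ d lam) * in_y (g lam)) = cauchy_kernel) = dual_GPQ (\<not> d)" for d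
  proof (rule the_equality)
    show "(\<Sum>\<^sub>\<infinity>lam\<in>UNIV. in_x (GPQ d lam) * in_y (dual_GPQ (\<not> d) lam)) = cauchy_kernel" by (rule cauchy_identity)
    then show "g = dual_GPQ (\<not> d)" if "(\<Sum>\<^sub>\<infinity>lam\<in>UNIV. in_x (GPQ d lam) * in_y (g lam)) = cauchy_kernel" for g
      using GPQ_independent[of d g "dual_GPQ (\<not> d)"] that by simp
  qed
  have "gp = dual_GPQ False" using dual[of True] by (simp add: gp_def GPQ_def)
  moreover have "gq = dual_GPQ True" using dual[of False] by (simp add: gq_def GPQ_def)
  moreover have "dual_GPQ False lam = (\<Sum>\<^sub>\<infinity>T\<in>ShPP_P lam. (- \<beta>) ^ (psize lam - pp_wt_size lam T) * pp_monomial lam T)"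
    "dual_GPQ True lam = (\<Sum>\<^sub>\<infinity>T\<in>ShPP_Q lam. (- \<beta>) ^ (psize lam - pp_wt_size lam T) * pp_monomial lam T)"
    unfolding dual_GPQ_def pp_def by simp_all
  ultimately show ?thesis by simp
qed

end
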